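(* There is an absolute constant $c>0$ such that the following holds. Let $(\mathrm{Enc},\mathrm{Dec})$ be a quantum non-malleable code against $\mathsf{LO}^t$ with error $\varepsilon$ and blocklength $n$ qubits, such that for every message $\psi$ the state $\mathrm{Enc}(\psi)$ is separable across the $t$ shares. If the rate of the code is at least $1-\frac1t+\delta$ for some $\delta\ge 4\log n/n$, then $\varepsilon\ge c\,\delta^2$.
   Context: A quantum code on $t$ shares: CPTP maps $\mathrm{Enc}:\mathcal L(\mathcal H_M)\to\mathcal L(\mathcal H_{Q_1}\otimes\cdots\otimes\mathcal H_{Q_t})$, $\mathrm{Dec}$ in reverse, with $\mathrm{Dec}\circ\mathrm{Enc}=\mathrm{id}$; blocklength $n=\sum_i|Q_i|$ qubits, rate $k/n$ for $k$-qubit messages. $\mathsf{LO}^t$: channels $\Lambda_1\otimes\cdots\otimes\Lambda_t$ with $\Lambda_i$ CPTP on share $i$. Non-malleable with error $\varepsilon$: for every $\Lambda\in\mathsf{LO}^t$ there exist $p_\Lambda\in[0,1]$ and a state $\gamma_\Lambda$ depending only on $\Lambda$ such that for every message $\sigma_M$ with canonical purification $\sigma_{M\hat M}$, $\|(\mathrm{Dec}\circ\Lambda\circ\mathrm{Enc}\otimes\mathrm{id})(\sigma_{M\hat M})-(p_\Lambda\sigma_{M\hat M}+(1-p_\Lambda)\gamma_\Lambda\otimes\sigma_{\hat M})\|_1\le\varepsilon$. A multipartite state is separable if it is a convex combination of product states across the parts. *)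

theory Defs
  imports "Jordan_Normal_Form.Matrix" Complex_Main
begin

type_synonym cmat = "complex mat"

definition adj :: "cmat \<Rightarrow> cmat" where
  "adj A = mat (dim_col A) (dim_row A) (\<lambda>(i,j). cnj (A $$ (j,i)))"

definition mtrace :: "cmat \<Rightarrow> complex" where
  "mtrace A = (\<Sum>i<dim_row A. A $$ (i,i))"

definition psd :: "cmat \<Rightarrow> bool" where
  "psd A \<longleftrightarrow> dim_row A = dim_col A \<and>
     (\<forall>v :: complex vec. dim_vec v = dim_col A \<longrightarrow>
        (\<exists>r::real. r \<ge> 0 \<and> (\<Sum>i<dim_vec v. cnj (v $ i) * (A *\<^sub>v v) $ i) = complex_of_real r))"

definition density :: "nat \<Rightarrow> cmat \<Rightarrow> bool" where
  "density d \<rho> \<longleftrightarrow> \<rho> \<in> carrier_mat d d \<and> psd \<rho> \<and> mtrace \<rho> = 1"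

definition msqrt :: "cmat \<Rightarrow> cmat" where
  "msqrt A = (THE B. B \<in> carrier_mat (dim_row A) (dim_row A) \<and> psd B \<and> B * B = A)"

definition trace_norm :: "cmat \<Rightarrow> real" where
  "trace_norm A = Re (mtrace (msqrt (adj A * A)))"

text \<open>Kronecker product; the index (a,b) of A \<otimes> B (dim B = m x n) is a*m+b.\<close>
definition kron :: "cmat \<Rightarrow> cmat \<Rightarrow> cmat" where
  "kron A B = mat (dim_row A * dim_row B) (dim_col A * dim_col B)
     (\<lambda>(i,j). A $$ (i div dim_row B, j div dim_col B) * B $$ (i mod dim_row B, j mod dim_col B))"

fun kron_list :: "cmat list \<Rightarrow> cmat" where
  "kron_list [] = 1\<^sub>m 1"
| "kron_list (A # As) = kron A (kron_list As)"

definition ketbra :: "nat \<Rightarrow> nat \<Rightarrow> nat \<Rightarrow> cmat" where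
  "ketbra d a b = mat d d (\<lambda>(i,j). if i = a \<and> j = b then 1 else 0)"

text \<open>Tensor product of two linear maps (superoperators) acting on d1 x d1 resp. d2 x d2
  matrices, defined as the unique linear extension of
  (\<Phi>1 \<otimes> \<Phi>2)(|a><b| \<otimes> |c><e|) = \<Phi>1(|a><b|) \<otimes> \<Phi>2(|c><e|).\<close>
definition superop_tensor ::
  "nat \<Rightarrow> nat \<Rightarrow> (cmat \<Rightarrow> cmat) \<Rightarrow> (cmat \<Rightarrow> cmat) \<Rightarrow> cmat \<Rightarrow> cmat" where
  "superop_tensor d1 d2 \<Phi>1 \<Phi>2 X =
     (let r1 = dim_row (\<Phi>1 (ketbra d1 0 0)); r2 = dim_row (\<Phi>2 (ketbra d2 0 0)) in
      mat (r1 * r2) (r1 * r2) (\<lambda>(i,j).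
        \<Sum>a<d1. \<Sum>b<d1. \<Sum>c<d2. \<Sum>e<d2.
          X $$ (a * d2 + c, b * d2 + e) * kron (\<Phi>1 (ketbra d1 a b)) (\<Phi>2 (ketbra d2 c e)) $$ (i,j)))"

fun superop_tensor_list :: "(nat \<times> (cmat \<Rightarrow> cmat)) list \<Rightarrow> cmat \<Rightarrow> cmat" where
  "superop_tensor_list [] = (\<lambda>X. X)"
| "superop_tensor_list ((d, \<Phi>) # rest) =
     superop_tensor d (\<Prod>p\<leftarrow>rest. fst p) \<Phi> (superop_tensor_list rest)"

definition cptp :: "nat \<Rightarrow> nat \<Rightarrow> (cmat \<Rightarrow> cmat) \<Rightarrow> bool" where
  "cptp dA dB \<Phi> \<longleftrightarrow>
     (\<forall>X \<in> carrier_mat dA dA. \<Phi> X \<in> carrier_mat dB dB) \<and>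
     (\<forall>X \<in> carrier_mat dA dA. \<forall>Y \<in> carrier_mat dA dA. \<forall>a b :: complex.
        \<Phi> (a \<cdot>\<^sub>m X + b \<cdot>\<^sub>m Y) = a \<cdot>\<^sub>m \<Phi> X + b \<cdot>\<^sub>m \<Phi> Y) \<and>
     (\<forall>X \<in> carrier_mat dA dA. mtrace (\<Phi> X) = mtrace X) \<and>
     (\<forall>r. \<forall>X \<in> carrier_mat (dA * r) (dA * r). psd X \<longrightarrow> psd (superop_tensor dA r \<Phi> (\<lambda>Y. Y) X))"

definition LO :: "nat list \<Rightarrow> (cmat \<Rightarrow> cmat) set" where
  "LO qs = {superop_tensor_list (map (\<lambda>i. (2 ^ (qs ! i), \<Lambda>s i)) [0..<length qs]) | \<Lambda>s.
              \<forall>i < length qs. cptp (2 ^ (qs ! i)) (2 ^ (qs ! i)) (\<Lambda>s i)}"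

text \<open>Canonical purification of \<sigma> on C^d \<otimes> C^d: |\<Psi>><\<Psi>| with
  |\<Psi>> = \<Sum>_i (sqrt \<sigma> \<otimes> I)|i>|i>, i.e. \<Psi>(j*d+i) = (sqrt \<sigma>)_{j,i}.\<close>
definition canon_purif :: "nat \<Rightarrow> cmat \<Rightarrow> cmat" where
  "canon_purif d \<sigma> =
     (let S = msqrt \<sigma>; \<psi> = (\<lambda>x. S $$ (x div d, x mod d)) in
      mat (d * d) (d * d) (\<lambda>(x,y). \<psi> x * cnj (\<psi> y)))"

definition ptrace1 :: "nat \<Rightarrow> nat \<Rightarrow> cmat \<Rightarrow> cmat" where
  "ptrace1 dA dB X = mat dB dB (\<lambda>(b,b'). \<Sum>a<dA. X $$ (a * dB + b, a * dB + b'))"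

definition separable :: "nat list \<Rightarrow> cmat \<Rightarrow> bool" where
  "separable ds \<rho> \<longleftrightarrow>
     (\<exists>m :: nat. \<exists>p :: nat \<Rightarrow> real. \<exists>\<rho>s :: nat \<Rightarrow> nat \<Rightarrow> cmat.
        (\<forall>j<m. p j \<ge> 0) \<and> (\<Sum>j<m. p j) = 1 \<and>
        (\<forall>j<m. \<forall>i<length ds. density (ds ! i) (\<rho>s j i)) \<and>
        \<rho> = mat (prod_list ds) (prod_list ds) (\<lambda>(x,y).
               \<Sum>j<m. complex_of_real (p j) * kron_list (map (\<rho>s j) [0..<length ds]) $$ (x,y)))"

definition quantum_code :: "nat \<Rightarrow> nat list \<Rightarrow> (cmat \<Rightarrow> cmat) \<Rightarrow> (cmat \<Rightarrow> cmat) \<Rightarrow> bool" where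
  "quantum_code k qs Enc Dec \<longleftrightarrow>
     cptp (2 ^ k) (2 ^ sum_list qs) Enc \<and> cptp (2 ^ sum_list qs) (2 ^ k) Dec \<and>
     (\<forall>\<rho> \<in> carrier_mat (2 ^ k) (2 ^ k). Dec (Enc \<rho>) = \<rho>)"

definition non_malleable_LO ::
  "nat \<Rightarrow> nat list \<Rightarrow> (cmat \<Rightarrow> cmat) \<Rightarrow> (cmat \<Rightarrow> cmat) \<Rightarrow> real \<Rightarrow> bool" where
  "non_malleable_LO k qs Enc Dec \<epsilon> \<longleftrightarrow>
     (\<forall>\<Lambda> \<in> LO qs. \<exists>p::real. \<exists>\<gamma>. 0 \<le> p \<and> p \<le> 1 \<and> density (2 ^ k) \<gamma> \<and>
        (\<forall>\<sigma>. density (2 ^ k) \<sigma> \<longrightarrow>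
           (let d = 2 ^ k; \<Psi> = canon_purif d \<sigma> in
            trace_norm (superop_tensor d d (Dec \<circ> \<Lambda> \<circ> Enc) (\<lambda>Y. Y) \<Psi>
              - (complex_of_real p \<cdot>\<^sub>m \<Psi> + complex_of_real (1 - p) \<cdot>\<^sub>m kron \<gamma> (ptrace1 d d \<Psi>)))
            \<le> \<epsilon>)))"

end

(* A separable state with marginal rho_A is dominated by rho_A (x) 1, so perfect decoding of many
   messages forces the largest share A to reveal the message. Let E_m be the effect by which the
   decoder announces m, and let F_m = Tr_B E_m be its reduction to A. Product vectors satisfy
   <u (x) v| E_m |u (x) v> <= |v|^2 <u|F_m|u>, and the F_m sum to dim(B) times the identity. Hence
   the spectral projection of F_m onto eigenvalues >= 1/8 keeps a fixed share of the encoding of m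
   (the complement has E_m-weight at most 1/8), while on average over m it rarely accepts the
   encoding of another message, because dim(B) is much smaller than the number of messages.
   Tampering that measures this projection on A and erases A on rejection keeps m0 but destroys m1,
   which no mixture of the identity and a constant channel does; this bounds the error below by an
   absolute constant, stronger than delta^2. The hypothesis delta >= 4 log n / n leaves n = 1 as the
   only nontrivial case in which dim(B) is not small enough; there B is trivial, and measuring A and preparing
   the encoding of the other message swaps two messages. *)

theory Submission
  imports Defs "Jordan_Normal_Form.Spectral_Radius" "HOL-Analysis.Convex"
begin

section \<open>Spectral theorem and positive forms\<close>

text \<open>Non-malleability is applied to basis messages: for \<open>m\<close> the purification is
  |mm><mm|, and diagonal entries of the error operator say that the probability of decoding a
  tampered \<open>m\<close> as \<open>i\<close> lies within \<open>\<epsilon>\<close> of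
  \<open>p * of_bool (i = m) + (1 - p) * g i\<close>. Linear inequalities between a few such
  probabilities then bound \<open>\<epsilon>\<close> from below. The obstacle is that the projection
  on A need not commute with the decoder's effects, so the accepted part of an encoding might decode
  badly. The parallelogram law replaces commutation at the cost of a factor 2: with threshold 1/8
  the accepted part keeps weight at least (1 - 2/8)/2 = 3/8. A rejection cannot be signalled to the
  decoder; A is reset to a fixed basis vector instead. Hence m0 and m1 must also be messages that
  the decoder seldom announces from that vector, and averaging has to secure this together with the
  rare acceptance of m1. The factor 81 between the number of messages and dim(B) is 3^4: a share of
  at least average size leaves dim(B) at most n^4 times smaller than needed only when n < 3. With it
  the two unwanted probabilities of m1 stay below 1/8, and 3/8 - 1/8 = 3/12 leaves 1/12 for each of
  three uses of the error.\<close>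

definition ip :: "nat \<Rightarrow> (nat \<Rightarrow> complex) \<Rightarrow> (nat \<Rightarrow> complex) \<Rightarrow> complex" where
  "ip n u v = (\<Sum>a<n. cnj (u a) * v a)"

text \<open>Vectors and kernels are total functions of which only the indices below \<open>n\<close>
  count, so no carrier conditions arise in the analytic part.\<close>

definition sf :: "nat \<Rightarrow> (nat \<Rightarrow> nat \<Rightarrow> complex) \<Rightarrow> (nat \<Rightarrow> complex) \<Rightarrow> (nat \<Rightarrow> complex) \<Rightarrow> complex" where
  "sf n M u v = (\<Sum>i<n. \<Sum>j<n. cnj (u i) * M i j * v j)"

definition pos :: "nat \<Rightarrow> (nat \<Rightarrow> nat \<Rightarrow> complex) \<Rightarrow> bool" where
  "pos n M \<longleftrightarrow> (\<forall>v. \<exists>r\<ge>0. sf n M v v = complex_of_real r)"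

definition orthonormal :: "nat \<Rightarrow> (nat \<Rightarrow> nat \<Rightarrow> complex) \<Rightarrow> bool" where
  "orthonormal n e \<longleftrightarrow> (\<forall>k<n. \<forall>l<n. ip n (e k) (e l) = of_bool (k = l))"

lemma ip_self: "ip n v v = complex_of_real (\<Sum>a<n. (cmod (v a))\<^sup>2)"
  by (simp only: ip_def of_real_sum complex_norm_square mult.commute)

lemma ip_cnj: "ip n u v = cnj (ip n v u)"
  by (simp add: ip_def mult.commute)

lemma ip_diff_right: "ip n u (\<lambda>a. v a - w a) = ip n u v - ip n u w"
  by (simp add: ip_def algebra_simps sum_subtractf)

lemma ip_scale_right: "ip n u (\<lambda>a. c * v a) = c * ip n u v"
  by (simp add: ip_def algebra_simps sum_distrib_left)

lemma ip_sum_right: "ip n u (\<lambda>a. \<Sum>j\<in>J. f j a) = (\<Sum>j\<in>J. ip n u (f j))"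
  unfolding ip_def by (simp add: sum_distrib_left) (rule sum.swap)

lemma ip_delta_left: "x < n \<Longrightarrow> ip n (\<lambda>a. of_bool (a = x)) v = v x"
  by (simp add: ip_def of_bool_def if_distrib[of cnj] if_distrib[of "\<lambda>x. x * _"] sum.delta cong: if_cong)

text \<open>A one-sided inverse of a square matrix is two-sided, so orthonormal rows force
  orthonormal columns.\<close>

lemma orthonormal_complete:
  assumes "orthonormal n e" "x < n" "y < n"
  shows "(\<Sum>k<n. e k x * cnj (e k y)) = of_bool (x = y)"
proof -
  define A where "A = mat n n (\<lambda>(k,a). cnj (e k a))"
  define B where "B = mat n n (\<lambda>(a,k). e k a)"
  have c: "A \<in> carrier_mat n n" "B \<in> carrier_mat n n" by (auto simp: A_def B_def)
  have "A * B = 1\<^sub>m n"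
    by (rule eq_matI) (use assms(1) in \<open>auto simp: A_def B_def orthonormal_def ip_def scalar_prod_def atLeast0LessThan\<close>)
  then have "B * A = 1\<^sub>m n" using mat_mult_left_right_inverse[OF c] by blast
  then have "(B * A) $$ (x,y) = of_bool (x = y)" using assms by simp
  then show ?thesis using assms by (simp add: A_def B_def scalar_prod_def atLeast0LessThan)
qed

lemma orthonormal_separates:
  assumes "orthonormal n e" "\<And>k. k < n \<Longrightarrow> ip n (e k) z = 0" "x < n"
  shows "z x = 0"
proof -
  have "z x = (\<Sum>y<n. of_bool (x = y) * z y)"
    using assms(3) by (simp add: of_bool_def if_distrib[of "\<lambda>x. x * _"] sum.delta' cong: if_cong)
  also have "\<dots> = (\<Sum>y<n. (\<Sum>k<n. e k x * cnj (e k y)) * z y)"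
    by (intro sum.cong refl) (use orthonormal_complete[OF assms(1,3)] in simp)
  also have "\<dots> = (\<Sum>k<n. e k x * ip n (e k) z)"
    unfolding ip_def by (subst sum_distrib_left, subst sum.swap) (simp add: sum_distrib_left sum_distrib_right algebra_simps)
  finally show ?thesis using assms(2) by simp
qed

text \<open>The Householder reflection that carries the first coordinate vector to \<open>v\<close>. If \<open>v\<close> is
  itself that vector then \<open>s = 0\<close>, and division by zero turns the reflection into the identity.\<close>

lemma orthonormal_extend_real:
  assumes n: "0 < n" and v: "ip n v v = 1" and v0: "v 0 = complex_of_real r"
  shows "\<exists>g. orthonormal n g \<and> (\<forall>a<n. g 0 a = v a)"
proof -
  define w where "w = (\<lambda>a. v a - of_bool (a = 0))"
  define s where "s = complex_of_real (1 - r)"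
  define g where "g = (\<lambda>k a. of_bool (a = k) - cnj (w k) / s * w a)"
  have iw: "ip n (\<lambda>a. of_bool (a = k)) w = w k" if "k < n" for k
    using that by (rule ip_delta_left)
  have wi: "ip n w (\<lambda>a. of_bool (a = k)) = cnj (w k)" if "k < n" for k
    by (subst ip_cnj) (simp add: iw that)
  have dd: "ip n (\<lambda>a. of_bool (a = k)) (\<lambda>a. of_bool (a = l)) = of_bool (k = l)" if "k < n" for k l
    using ip_delta_left[OF that, of "\<lambda>a. of_bool (a = l)"] by simp
  have vd: "ip n v (\<lambda>a. of_bool (a = 0)) = of_real r"
    using ip_delta_left[OF n, of v] v0 ip_cnj[of n v] by simp
  have ww: "ip n w w = 2 * s"
  proof -
    have "ip n w w = ip n w v - ip n w (\<lambda>a. of_bool (a = 0))"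
      unfolding w_def by (rule ip_diff_right)
    also have "ip n w v = cnj (ip n v v - ip n v (\<lambda>a. of_bool (a = 0)))"
      by (subst ip_cnj) (simp only: w_def ip_diff_right)
    finally show ?thesis using wi[OF n] v0 vd v by (simp add: w_def s_def)
  qed
  have "ip n (g k) (g l) = of_bool (k = l)" if "k < n" "l < n" for k l
  proof -
    have gr: "ip n u (g l) = ip n u (\<lambda>a. of_bool (a = l)) - cnj (w l) / s * ip n u w" for u l
      by (simp only: g_def ip_diff_right ip_scale_right)
    have gw: "ip n (g k) w = w k - w k / cnj s * (2 * s)"
      by (subst ip_cnj) (simp add: gr wi that ww s_def)
    have gd: "ip n (g k) (\<lambda>a. of_bool (a = l)) = of_bool (k = l) - w k / cnj s * cnj (w l)"
      by (subst ip_cnj) (use that in \<open>simp add: gr dd iw eq_commute\<close>)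
    have "cnj s = s" by (simp add: s_def)
    then show ?thesis by (cases "s = 0") (simp_all add: gr gw gd field_simps)
  qed
  moreover have "g 0 a = v a" if "a < n" for a
  proof (cases "s = 0")
    case True
    then have "complex_of_real (\<Sum>a<n. (cmod (w a))\<^sup>2) = 0" using ww ip_self[of n w] by simp
    then have "(\<Sum>a<n. (cmod (w a))\<^sup>2) = 0" using of_real_eq_0_iff by blast
    then have "w a = 0" using that by (subst (asm) sum_nonneg_eq_0_iff) auto
    then show ?thesis by (simp add: g_def w_def)
  next
    case False
    have "cnj (w 0) = - s" by (simp add: w_def v0 s_def)
    with False show ?thesis by (simp add: g_def w_def)
  qed
  ultimately show ?thesis unfolding orthonormal_def by blast
qed

lemma eigenvector_exists:
  assumes "0 < n"
  shows "\<exists>v l r. ip n v v = 1 \<and> v 0 = complex_of_real r \<and> (\<forall>a<n. (\<Sum>b<n. M a b * v b) = l * v a)"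
proof -
  define A where "A = mat n n (\<lambda>(i,j). M i j :: complex)"
  have A: "A \<in> carrier_mat n n" by (simp add: A_def)
  obtain l where "l \<in> spectrum A" using spectrum_non_empty[OF A] assms by blast
  then obtain x where x: "eigenvector A x l" by (auto simp: spectrum_def eigenvalue_def)
  then have xn: "dim_vec x = n" and x0: "x \<noteq> 0\<^sub>v n" and xe: "A *\<^sub>v x = l \<cdot>\<^sub>v x"
    using A by (auto simp: eigenvector_def)
  define N where "N = (\<Sum>a<n. (cmod (x $ a))\<^sup>2)"
  obtain b where b: "b < n" "x $ b \<noteq> 0" using x0 xn by (metis eq_vecI index_zero_vec)
  have "0 < (cmod (x $ b))\<^sup>2" using b by simp
  also have "\<dots> \<le> N" unfolding N_def by (rule member_le_sum) (use b in auto)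
  finally have N: "0 < N" .
  \<comment> \<open>Besides normalizing, \<open>c\<close> rotates the phase so that coordinate 0
    becomes real, as the Householder reflection requires.\<close>
  define c where "c = (if x $ 0 = 0 then 1 else cnj (x $ 0) / cmod (x $ 0)) / complex_of_real (sqrt N)"
  define v where "v = (\<lambda>a. c * x $ a)"
  have cc: "(cmod c)\<^sup>2 = 1 / N"
    using N by (auto simp: c_def norm_divide power_divide)
  have "ip n v v = complex_of_real (\<Sum>a<n. (cmod c)\<^sup>2 * (cmod (x $ a))\<^sup>2)"
    by (simp add: ip_self v_def norm_mult power_mult_distrib)
  also have "\<dots> = 1" using N by (simp add: cc N_def flip: sum_divide_distrib)
  finally have 1: "ip n v v = 1" .
  have 2: "v 0 = complex_of_real (cmod (x $ 0) / sqrt N)"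
  proof (cases "x $ 0 = 0")
    case False
    have "cnj (x $ 0) * x $ 0 = complex_of_real (cmod (x $ 0)) * complex_of_real (cmod (x $ 0))"
      using complex_norm_square[of "x $ 0"] by (simp add: power2_eq_square mult.commute)
    with False show ?thesis by (simp add: v_def c_def)
  qed (simp add: v_def)
  have "(\<Sum>b<n. M a b * v b) = l * v a" if "a < n" for a
  proof -
    have "(A *\<^sub>v x) $ a = l * x $ a" using xe that xn by simp
    then have "(\<Sum>b<n. M a b * x $ b) = l * x $ a"
      using that xn A by (simp add: A_def scalar_prod_def atLeast0LessThan)
    then show ?thesis by (simp add: v_def algebra_simps flip: sum_distrib_left)
  qed
  with 1 2 show ?thesis by blast
qed

text \<open>Induction on the dimension: the orthogonal complement of an eigenvector is invariant
  because \<open>M\<close> is hermitian. The eigenvalues are left complex; their reality is derived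
  where it is used.\<close>

lemma spectral_hermitian:
  assumes "\<And>i j. i < n \<Longrightarrow> j < n \<Longrightarrow> M i j = cnj (M j i)"
  shows "\<exists>e l. orthonormal n e \<and> (\<forall>k<n. \<forall>a<n. (\<Sum>b<n. M a b * e k b) = l k * e k a)"
  using assms
proof (induction n arbitrary: M)
  case 0
  then show ?case by (simp add: orthonormal_def)
next
  case (Suc m)
  let ?n = "Suc m"
  define T where "T = (\<lambda>x a. \<Sum>b<?n. M a b * x b)"
  have Tsym: "ip ?n x (T y) = ip ?n (T x) y" for x y
  proof -
    have "ip ?n x (T y) = (\<Sum>a<?n. \<Sum>b<?n. cnj (x a) * M a b * y b)"
      by (simp only: ip_def T_def sum_distrib_left mult.assoc)
    also have "\<dots> = (\<Sum>b<?n. \<Sum>a<?n. cnj (x a) * M a b * y b)" by (rule sum.swap)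
    also have "\<dots> = (\<Sum>b<?n. \<Sum>a<?n. cnj (M b a * x a) * y b)"
    proof (intro sum.cong refl)
      fix a b assume "b \<in> {..<?n}" "a \<in> {..<?n}"
      then have "cnj (M b a) = M a b" using Suc.prems[of a b] by (metis lessThan_iff)
      then show "cnj (x a) * M a b * y b = cnj (M b a * x a) * y b" by simp
    qed
    also have "\<dots> = ip ?n (T x) y"
      by (simp only: ip_def T_def sum_distrib_right cnj_sum)
    finally show ?thesis .
  qed
  obtain v l r where v: "ip ?n v v = 1" "v 0 = complex_of_real r"
    and ev: "\<And>a. a < ?n \<Longrightarrow> (\<Sum>b<?n. M a b * v b) = l * v a"
    using eigenvector_exists[of ?n M] by blast
  obtain g where g: "orthonormal ?n g" and g0: "\<And>a. a < ?n \<Longrightarrow> g 0 a = v a"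
    using orthonormal_extend_real[OF _ v] by blast
  have gg: "ip ?n (g i) (g j) = of_bool (i = j)" if "i < ?n" "j < ?n" for i j
    using g that by (simp add: orthonormal_def)
  have Tg0: "T (g 0) a = l * g 0 a" if "a < ?n" for a
    using ev[OF that] g0 that by (simp add: T_def)
  \<comment> \<open>The compression of \<open>M\<close> to the complement of the eigenvector, in the
    basis \<open>g 1\<close>, ..., \<open>g m\<close>.\<close>
  define M' where "M' = (\<lambda>i j. ip ?n (g (Suc i)) (T (g (Suc j))))"
  have "M' i j = cnj (M' j i)" for i j
    unfolding M'_def by (subst Tsym, subst ip_cnj) simp
  from Suc.IH[of M', OF this] obtain e' l' where e': "orthonormal m e'"
    and ev': "\<And>k a. k < m \<Longrightarrow> a < m \<Longrightarrow> (\<Sum>b<m. M' a b * e' k b) = l' k * e' k a"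
    by blast
  \<comment> \<open>Eigenvectors of the compression are carried back to dimension
    \<open>Suc m\<close>; index 0 keeps the first eigenvector.\<close>
  define f where "f = (\<lambda>k a. case k of 0 \<Rightarrow> g 0 a | Suc k' \<Rightarrow> (\<Sum>j<m. e' k' j * g (Suc j) a))"
  define L where "L = (\<lambda>k. case k of 0 \<Rightarrow> l | Suc k' \<Rightarrow> l' k')"
  have ipf: "ip ?n x (f (Suc k)) = (\<Sum>j<m. e' k j * ip ?n x (g (Suc j)))" for x k
    unfolding f_def by (simp add: ip_sum_right ip_scale_right)
  have gf: "ip ?n (g 0) (f (Suc k)) = 0" for k
    by (simp add: ipf gg)
  have gSf: "ip ?n (g (Suc i)) (f (Suc k)) = e' k i" if "i < m" for i k
    using that by (simp add: ipf gg of_bool_def if_distrib[of "\<lambda>x. _ * x"] sum.delta' cong: if_cong)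
  have Tf: "T (f (Suc k)) a = (\<Sum>j<m. e' k j * T (g (Suc j)) a)" for k a
    unfolding T_def f_def nat.case
    by (subst (2) sum_distrib_left, subst sum.swap, intro sum.cong refl, subst sum_distrib_left,
        intro sum.cong refl) (simp add: algebra_simps)
  have 1: "ip ?n (f i) (f j) = of_bool (i = j)" if ij: "i < ?n" "j < ?n" for i j
  proof (cases i)
    case 0
    have f0: "f 0 = g 0" by (simp add: f_def)
    show ?thesis
      using 0 ij by (cases j) (simp_all add: f0 gf gg)
  next
    case i: (Suc i')
    show ?thesis
    proof (cases j)
      case 0
      have f0: "f 0 = g 0" by (simp add: f_def)
      show ?thesis using i 0 by (subst ip_cnj) (simp add: f0 gf)
    next
      case j: (Suc j')
      have "ip ?n (f i) (g (Suc x)) = cnj (e' i' x)" if "x < m" for x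
        using that i by (subst ip_cnj) (simp add: gSf)
      then have "ip ?n (f i) (f j) = ip m (e' i') (e' j')"
        unfolding j ipf by (simp add: ip_def mult.commute)
      then show ?thesis using e' i j ij by (simp add: orthonormal_def)
    qed
  qed
  have 2: "T (f k) a = L k * f k a" if k: "k < ?n" and a: "a < ?n" for k a
  proof (cases k)
    case 0
    then show ?thesis using Tg0[OF a] by (simp add: f_def L_def T_def)
  next
    case (Suc k')
    \<comment> \<open>The residual of the eigenvalue equation is orthogonal to every
      \<open>g i\<close>: to \<open>g 0\<close> by symmetry of \<open>M\<close>, to the others by
      the eigenvalue equation of \<open>M'\<close>.\<close>
    define z where "z = (\<lambda>a. T (f k) a - L k * f k a)"
    have zz: "ip ?n x z = ip ?n x (T (f k)) - L k * ip ?n x (f k)" for x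
      unfolding z_def by (simp add: ip_diff_right ip_scale_right)
    have "ip ?n (g i) z = 0" if i: "i < ?n" for i
    proof (cases i)
      case 0
      have "ip ?n (T (g 0)) x = cnj l * ip ?n (g 0) x" for x
        using Tg0 by (simp add: ip_def sum_distrib_left algebra_simps)
      then show ?thesis using 0 Suc gf by (simp add: zz Tsym)
    next
      case i': (Suc i')
      have "ip ?n (g i) (T (f k)) = (\<Sum>j<m. e' k' j * M' i' j)"
        unfolding Suc Tf i' M'_def by (simp add: ip_sum_right ip_scale_right)
      also have "\<dots> = L k * e' k' i'"
        using ev'[of k' i'] i' i k Suc by (simp add: L_def mult.commute)
      finally show ?thesis using i' i Suc gSf by (simp add: zz)
    qed
    then have "z a = 0" by (rule orthonormal_separates[OF g _ a])
    then show ?thesis by (simp add: z_def)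
  qed
  show ?case using 1 2 unfolding orthonormal_def T_def by blast
qed

section \<open>Positive sesquilinear forms: polarization, Cauchy-Schwarz, spectral
  decomposition\<close>

lemma sf_add_right: "sf n M u (\<lambda>i. v i + w i) = sf n M u v + sf n M u w"
  by (simp add: sf_def algebra_simps sum.distrib)

lemma sf_add_left: "sf n M (\<lambda>i. v i + w i) u = sf n M v u + sf n M w u"
  by (simp add: sf_def algebra_simps sum.distrib)

lemma sf_scale_right: "sf n M u (\<lambda>i. c * v i) = c * sf n M u v"
  by (simp add: sf_def algebra_simps sum_distrib_left)

lemma sf_scale_left: "sf n M (\<lambda>i. c * v i) u = cnj c * sf n M v u"
  by (simp add: sf_def algebra_simps sum_distrib_left)

lemma sf_delta:
  assumes "i < n" "j < n"
  shows "sf n M (\<lambda>a. of_bool (a = i)) (\<lambda>a. of_bool (a = j)) = M i j"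
proof -
  have "sf n M (\<lambda>a. of_bool (a = i)) (\<lambda>a. of_bool (a = j))
      = (\<Sum>a<n. if a = i then \<Sum>b<n. if b = j then M a b else 0 else 0)"
    unfolding sf_def by (intro sum.cong refl) (auto intro!: sum.cong sum.neutral)
  then show ?thesis using assms by simp
qed

lemma posD: "pos n M \<Longrightarrow> 0 \<le> Re (sf n M v v) \<and> Im (sf n M v v) = 0"
  unfolding pos_def by (metis Im_complex_of_real Re_complex_of_real)

lemma pos_real: "pos n M \<Longrightarrow> sf n M v v = complex_of_real (Re (sf n M v v))"
  using posD by (simp add: complex_eq_iff)

text \<open>Polarization: reality of the form at u + v fixes the imaginary parts, reality at u + iv
  the real parts.\<close>

lemma pos_sym:
  assumes "pos n M"
  shows "sf n M u v = cnj (sf n M v u)"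
proof -
  have e: "sf n M (\<lambda>i. u i + c * v i) (\<lambda>i. u i + c * v i)
     = sf n M u u + c * sf n M u v + cnj c * sf n M v u + cnj c * c * sf n M v v" for c
    by (simp only: sf_add_right sf_add_left sf_scale_right sf_scale_left) (simp add: algebra_simps)
  have r: "Im (sf n M x x) = 0" for x using posD[OF assms] by blast
  have "Im (sf n M u v) + Im (sf n M v u) = 0"
    using arg_cong[OF e[of 1], of Im] r[of u] r[of v] r[of "\<lambda>i. u i + 1 * v i"] by simp
  moreover have "Re (sf n M u v) - Re (sf n M v u) = 0"
    using arg_cong[OF e[of \<i>], of Im] r[of u] r[of v] r[of "\<lambda>i. u i + \<i> * v i"] by simp
  ultimately show ?thesis by (simp add: complex_eq_iff)
qed

lemma pos_hermitian: "pos n M \<Longrightarrow> i < n \<Longrightarrow> j < n \<Longrightarrow> M i j = cnj (M j i)"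
  using pos_sym[of n M "\<lambda>a. of_bool (a = i)" "\<lambda>a. of_bool (a = j)"] by (simp add: sf_delta)

lemma pos_cauchy_schwarz:
  assumes "pos n M"
  shows "(cmod (sf n M u v))\<^sup>2 \<le> Re (sf n M u u) * Re (sf n M v v)"
proof -
  define s where "s = sf n M u v"
  define q where "q = (\<lambda>x. Re (sf n M x x))"
  have vu: "sf n M v u = cnj s" unfolding s_def by (rule pos_sym[OF assms])
  have key: "0 \<le> q u - 2 * t * (cmod s)\<^sup>2 + t\<^sup>2 * (cmod s)\<^sup>2 * q v" for t :: real
  proof -
    \<comment> \<open>The phase of this coefficient turns both cross terms into -t |s|^2.\<close>
    let ?c = "- of_real t * cnj s"
    have "sf n M (\<lambda>i. u i + ?c * v i) (\<lambda>i. u i + ?c * v i)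
       = sf n M u u + ?c * s + cnj ?c * cnj s + cnj ?c * ?c * sf n M v v"
      unfolding sf_add_right sf_add_left sf_scale_right sf_scale_left vu s_def[symmetric]
      by (simp add: algebra_simps)
    also have "\<dots> = complex_of_real (q u - 2 * t * (cmod s)\<^sup>2 + t\<^sup>2 * (cmod s)\<^sup>2 * q v)"
      using pos_real[OF assms, of u] pos_real[OF assms, of v] complex_norm_square[of s]
      by (simp add: q_def algebra_simps power2_eq_square)
    finally show ?thesis using posD[OF assms, of "\<lambda>i. u i + ?c * v i"] by simp
  qed
  have "0 \<le> q v" unfolding q_def using posD[OF assms] by blast
  show ?thesis
  proof (cases "q v = 0")
    case True
    have "(cmod s)\<^sup>2 = 0"
    proof (rule ccontr)
      assume "(cmod s)\<^sup>2 \<noteq> 0"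
      \<comment> \<open>This \<open>t\<close> would make the right-hand side of \<open>key\<close>
        equal to -1.\<close>
      then have "2 * ((q u + 1) / (2 * (cmod s)\<^sup>2)) * (cmod s)\<^sup>2 = q u + 1" by (simp add: field_simps)
      then show False using key[of "(q u + 1) / (2 * (cmod s)\<^sup>2)"] True by simp
    qed
    then show ?thesis using True by (simp add: s_def q_def)
  next
    case False
    then have "q v > 0" using \<open>0 \<le> q v\<close> by simp
    then show ?thesis using key[of "1 / q v"]
      by (simp add: s_def q_def field_simps power2_eq_square)
  qed
qed

text \<open>Cauchy-Schwarz against each coordinate vector puts an isotropic vector of a positive
  form into its kernel.\<close>

lemma pos_null: 
  assumes "pos n M" "sf n M v v = 0" "a < n"
  shows "(\<Sum>b<n. M a b * v b) = 0"
proof -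
  have "sf n M (\<lambda>x. of_bool (x = a)) v = 0"
    using pos_cauchy_schwarz[OF assms(1), of "\<lambda>x. of_bool (x = a)" v] assms(2) by simp
  moreover have "sf n M (\<lambda>x. of_bool (x = a)) v = ip n (\<lambda>x. of_bool (x = a)) (\<lambda>a. \<Sum>b<n. M a b * v b)"
    by (simp add: sf_def ip_def sum_distrib_left mult.assoc)
  ultimately show ?thesis using ip_delta_left[OF assms(3)] by metis
qed

lemma pos_diag: "pos n M \<Longrightarrow> i < n \<Longrightarrow> 0 \<le> Re (M i i) \<and> Im (M i i) = 0"
  using posD[of n M "\<lambda>a. of_bool (a = i)"] by (simp add: sf_delta)

lemma pos_entry_bound: "pos n M \<Longrightarrow> i < n \<Longrightarrow> j < n \<Longrightarrow> (cmod (M i j))\<^sup>2 \<le> Re (M i i) * Re (M j j)"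
  using pos_cauchy_schwarz[of n M "\<lambda>a. of_bool (a = i)" "\<lambda>a. of_bool (a = j)"] by (simp add: sf_delta)

text \<open>The entry bound |M_ij| \<le> sqrt(M_ii M_jj) majorizes the form by the square of the sum
  of |v_i| sqrt(M_ii), and Cauchy-Schwarz separates the two factors.\<close>

lemma pos_le_trace:
  assumes "pos n M"
  shows "Re (sf n M v v) \<le> (\<Sum>i<n. (cmod (v i))\<^sup>2) * (\<Sum>i<n. Re (M i i))"
proof -
  let ?m = "\<lambda>i. sqrt (Re (M i i))"
  have "Re (sf n M v v) \<le> cmod (sf n M v v)" by (rule complex_Re_le_cmod)
  also have "\<dots> \<le> (\<Sum>i<n. \<Sum>j<n. cmod (cnj (v i) * M i j * v j))"
    unfolding sf_def by (intro order.trans[OF norm_sum] sum_mono norm_sum)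
  also have "\<dots> \<le> (\<Sum>i<n. \<Sum>j<n. (cmod (v i) * ?m i) * (cmod (v j) * ?m j))"
  proof (intro sum_mono)
    fix i j assume "i \<in> {..<n}" "j \<in> {..<n}"
    then have "cmod (M i j) \<le> ?m i * ?m j"
      using pos_entry_bound[OF assms] by (simp add: real_le_rsqrt flip: real_sqrt_mult)
    then have "cmod (v i) * cmod (v j) * cmod (M i j) \<le> cmod (v i) * cmod (v j) * (?m i * ?m j)"
      by (intro mult_left_mono) auto
    then show "cmod (cnj (v i) * M i j * v j) \<le> (cmod (v i) * ?m i) * (cmod (v j) * ?m j)"
      by (simp add: norm_mult algebra_simps)
  qed
  also have "\<dots> = (\<Sum>i<n. cmod (v i) * ?m i)\<^sup>2"
    by (simp add: power2_eq_square sum_product)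
  also have "\<dots> \<le> (\<Sum>i<n. (cmod (v i))\<^sup>2) * (\<Sum>i<n. (?m i)\<^sup>2)"
    by (rule Cauchy_Schwarz_ineq_sum)
  also have "(\<Sum>i<n. (?m i)\<^sup>2) = (\<Sum>i<n. Re (M i i))"
    using pos_diag[OF assms] by simp
  finally show ?thesis .
qed

lemma sf_rank_one_sum:
  "sf n (\<lambda>a b. \<Sum>k\<in>K. complex_of_real (c k) * e k a * cnj (e k b)) v v
    = complex_of_real (\<Sum>k\<in>K. c k * (cmod (ip n (e k) v))\<^sup>2)"
proof -
  have "sf n (\<lambda>a b. \<Sum>k\<in>K. complex_of_real (c k) * e k a * cnj (e k b)) v v
     = (\<Sum>i<n. \<Sum>j<n. \<Sum>k\<in>K. complex_of_real (c k) * ((cnj (v i) * e k i) * (cnj (e k j) * v j)))"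
    by (simp add: sf_def sum_distrib_left sum_distrib_right algebra_simps)
  also have "\<dots> = (\<Sum>i<n. \<Sum>k\<in>K. \<Sum>j<n. complex_of_real (c k) * ((cnj (v i) * e k i) * (cnj (e k j) * v j)))"
    by (intro sum.cong refl sum.swap)
  also have "\<dots> = (\<Sum>k\<in>K. \<Sum>i<n. \<Sum>j<n. complex_of_real (c k) * ((cnj (v i) * e k i) * (cnj (e k j) * v j)))"
    by (rule sum.swap)
  also have "\<dots> = (\<Sum>k\<in>K. complex_of_real (c k) * (ip n v (e k) * ip n (e k) v))"
    by (simp only: ip_def sum_product) (simp only: sum_distrib_left)
  also have "\<dots> = (\<Sum>k\<in>K. complex_of_real (c k * (cmod (ip n (e k) v))\<^sup>2))"
  proof (intro sum.cong refl)
    fix k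
    have "ip n v (e k) * ip n (e k) v = complex_of_real ((cmod (ip n (e k) v))\<^sup>2)"
      by (subst (1) ip_cnj) (metis complex_norm_square mult.commute of_real_power)
    then show "complex_of_real (c k) * (ip n v (e k) * ip n (e k) v) = complex_of_real (c k * (cmod (ip n (e k) v))\<^sup>2)"
      by simp
  qed
  finally show ?thesis by simp
qed

lemma parseval:
  assumes "orthonormal n e"
  shows "(\<Sum>k<n. (cmod (ip n (e k) v))\<^sup>2) = (\<Sum>a<n. (cmod (v a))\<^sup>2)"
proof -
  have "complex_of_real (\<Sum>k<n. 1 * (cmod (ip n (e k) v))\<^sup>2)
      = sf n (\<lambda>a b. \<Sum>k<n. complex_of_real 1 * e k a * cnj (e k b)) v v"
    by (rule sf_rank_one_sum[symmetric])
  also have "\<dots> = sf n (\<lambda>a b. of_bool (a = b)) v v"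
    unfolding sf_def by (intro sum.cong refl) (use orthonormal_complete[OF assms] in auto)
  also have "\<dots> = ip n v v"
    unfolding sf_def ip_def by (intro sum.cong refl) (simp add: of_bool_def if_distrib[of "\<lambda>x. _ * x"] if_distrib[of "\<lambda>x. x * _"] sum.delta' cong: if_cong)
  also have "\<dots> = complex_of_real (\<Sum>a<n. (cmod (v a))\<^sup>2)" by (rule ip_self)
  finally show ?thesis using of_real_eq_iff by fastforce
qed

text \<open>The eigenvalue at a unit eigenvector is the value of the form there, so positivity makes
  it real and nonnegative.\<close>

lemma pos_spectral:
  assumes "pos n M"
  obtains e l where "orthonormal n e" "\<And>k. k < n \<Longrightarrow> 0 \<le> l k"
    "\<And>a b. a < n \<Longrightarrow> b < n \<Longrightarrow> M a b = (\<Sum>k<n. complex_of_real (l k) * e k a * cnj (e k b))"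
proof -
  obtain e l where e: "orthonormal n e"
    and ev: "\<And>k a. k < n \<Longrightarrow> a < n \<Longrightarrow> (\<Sum>b<n. M a b * e k b) = l k * e k a"
    using spectral_hermitian[of n M] pos_hermitian[OF assms] by blast
  have "sf n M (e k) (e k) = l k" if "k < n" for k
  proof -
    have "sf n M (e k) (e k) = ip n (e k) (\<lambda>a. \<Sum>b<n. M a b * e k b)"
      by (simp add: sf_def ip_def sum_distrib_left mult.assoc)
    also have "\<dots> = ip n (e k) (\<lambda>a. l k * e k a)" using ev[OF that] by (simp add: ip_def)
    finally show ?thesis using e that by (simp add: ip_scale_right orthonormal_def)
  qed
  then have l: "l k = complex_of_real (Re (l k))" "0 \<le> Re (l k)" if "k < n" for k
    using posD[OF assms, of "e k"] that by (auto simp: complex_eq_iff)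
  have "M a b = (\<Sum>k<n. complex_of_real (Re (l k)) * e k a * cnj (e k b))" if ab: "a < n" "b < n" for a b
  proof -
    have "M a b = (\<Sum>c<n. M a c * of_bool (c = b))"
      using ab by (simp add: of_bool_def if_distrib[of "\<lambda>x. _ * x"] cong: if_cong)
    also have "\<dots> = (\<Sum>c<n. M a c * (\<Sum>k<n. e k c * cnj (e k b)))"
      by (intro sum.cong refl) (use orthonormal_complete[OF e] ab in simp)
    also have "\<dots> = (\<Sum>k<n. (\<Sum>c<n. M a c * e k c) * cnj (e k b))"
      by (simp add: sum_distrib_left sum_distrib_right mult.assoc) (rule sum.swap)
    also have "\<dots> = (\<Sum>k<n. complex_of_real (Re (l k)) * e k a * cnj (e k b))"
      by (intro sum.cong refl) (use ev ab l in simp)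
    finally show ?thesis .
  qed
  with e l show ?thesis using that[of e "\<lambda>k. Re (l k)"] by blast
qed

section \<open>Square roots and the trace norm\<close>

lemma psd_iff_pos:
  assumes "A \<in> carrier_mat n n"
  shows "psd A \<longleftrightarrow> pos n (\<lambda>i j. A $$ (i,j))"
proof -
  have e: "(\<Sum>i<dim_vec v. cnj (v $ i) * (A *\<^sub>v v) $ i) = sf n (\<lambda>i j. A $$ (i,j)) (\<lambda>i. v $ i) (\<lambda>i. v $ i)"
    if "dim_vec v = n" for v
    using that assms by (simp add: sf_def scalar_prod_def atLeast0LessThan sum_distrib_left mult.assoc)
  have f: "sf n (\<lambda>i j. A $$ (i,j)) v v = sf n (\<lambda>i j. A $$ (i,j)) (\<lambda>i. vec n v $ i) (\<lambda>i. vec n v $ i)" for v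
    by (simp add: sf_def)
  have dim: "dim_row A = n" "dim_col A = n" using assms by auto
  show ?thesis
  proof
    assume p: "psd A"
    show "pos n (\<lambda>i j. A $$ (i,j))"
      unfolding pos_def
    proof
      fix v
      show "\<exists>r\<ge>0. sf n (\<lambda>i j. A $$ (i,j)) v v = complex_of_real r"
        unfolding f[of v] using p e[of "vec n v"] dim unfolding psd_def by (metis dim_vec)
    qed
  next
    assume "pos n (\<lambda>i j. A $$ (i,j))"
    then show "psd A" unfolding psd_def pos_def dim using e by simp
  qed
qed

lemma posI:
  assumes "\<And>v. sf n M v v = complex_of_real (f v)" "\<And>v. 0 \<le> f v"
  shows "pos n M"
  using assms unfolding pos_def by blast

lemma sf_comp_right:
  "sf n M u (\<lambda>b. \<Sum>c<n. N b c * v c) = sf n (\<lambda>a c. \<Sum>b<n. M a b * N b c) u v"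
proof -
  have "sf n M u (\<lambda>b. \<Sum>c<n. N b c * v c) = (\<Sum>a<n. \<Sum>b<n. \<Sum>c<n. cnj (u a) * M a b * (N b c * v c))"
    by (simp only: sf_def sum_distrib_left)
  also have "\<dots> = (\<Sum>a<n. \<Sum>c<n. \<Sum>b<n. cnj (u a) * M a b * (N b c * v c))"
    by (intro sum.cong refl sum.swap)
  finally show ?thesis by (simp add: sf_def sum_distrib_left sum_distrib_right mult.assoc)
qed

lemma sf_comp_left:
  "sf n M (\<lambda>b. \<Sum>c<n. N b c * u c) v = sf n (\<lambda>c a. \<Sum>b<n. cnj (N b c) * M b a) u v"
proof -
  have "sf n M (\<lambda>b. \<Sum>c<n. N b c * u c) v = (\<Sum>b<n. \<Sum>a<n. \<Sum>c<n. cnj (N b c * u c) * M b a * v a)"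
    by (simp only: sf_def sum_distrib_right cnj_sum)
  also have "\<dots> = (\<Sum>b<n. \<Sum>c<n. \<Sum>a<n. cnj (N b c * u c) * M b a * v a)"
    by (intro sum.cong refl sum.swap)
  also have "\<dots> = (\<Sum>c<n. \<Sum>b<n. \<Sum>a<n. cnj (N b c * u c) * M b a * v a)"
    by (rule sum.swap)
  also have "\<dots> = (\<Sum>c<n. \<Sum>a<n. \<Sum>b<n. cnj (N b c * u c) * M b a * v a)"
    by (intro sum.cong refl sum.swap)
  finally show ?thesis by (simp add: sf_def sum_distrib_left sum_distrib_right algebra_simps)
qed

text \<open>With d = B - C, equal squares give B d + d C = 0. At an eigenvector e of d with nonzero
  eigenvalue this makes <e|B|e> + <e|C|e> vanish; both are nonnegative, so B e = C e = 0 and hence d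
  e = 0. This uniqueness gives the \<open>THE\<close> in \<open>msqrt\<close> its value.\<close>

lemma psd_sqrt_unique:
  assumes c: "B \<in> carrier_mat n n" "C \<in> carrier_mat n n" and p: "psd B" "psd C" and eq: "B * B = C * C"
  shows "B = C"
proof -
  define b where "b = (\<lambda>i j. B $$ (i,j))"
  define c where "c = (\<lambda>i j. C $$ (i,j))"
  define d where "d = (\<lambda>i j. b i j - c i j)"
  have pb: "pos n b" and pc: "pos n c" using p psd_iff_pos c(1,2) unfolding b_def c_def by blast+
  have dh: "d i j = cnj (d j i)" if "i < n" "j < n" for i j
    using pos_hermitian[OF pb that] pos_hermitian[OF pc that] by (simp add: d_def)
  have bc: "(\<Sum>k<n. b i k * b k j) = (\<Sum>k<n. c i k * c k j)" if "i < n" "j < n" for i j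
    using arg_cong[OF eq, of "\<lambda>X. X $$ (i,j)"] that assms(1,2)
    by (simp add: b_def c_def scalar_prod_def atLeast0LessThan)
  have z: "(\<Sum>k<n. b i k * d k j) + (\<Sum>k<n. d i k * c k j) = 0" if "i < n" "j < n" for i j
    using bc[OF that] by (simp add: d_def algebra_simps sum.distrib sum_subtractf)
  obtain e l where e: "orthonormal n e"
    and ev: "\<And>k a. k < n \<Longrightarrow> a < n \<Longrightarrow> (\<Sum>b<n. d a b * e k b) = l k * e k a"
    using spectral_hermitian[of n d] dh by blast
  have null: "(\<Sum>y<n. d a y * e k y) = 0" if k: "k < n" and a: "a < n" for k a
  proof (cases "l k = 0")
    case True
    then show ?thesis using ev[OF k a] by simp
  next
    case False
    have "sf n b (e k) (\<lambda>a. \<Sum>y<n. d a y * e k y) + sf n c (\<lambda>a. \<Sum>y<n. d a y * e k y) (e k)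
        = sf n (\<lambda>i j. (\<Sum>y<n. b i y * d y j) + (\<Sum>y<n. cnj (d y i) * c y j)) (e k) (e k)"
      unfolding sf_comp_right sf_comp_left by (simp add: sf_def algebra_simps sum.distrib)
    also have "\<dots> = sf n (\<lambda>i j. (\<Sum>y<n. b i y * d y j) + (\<Sum>y<n. d i y * c y j)) (e k) (e k)"
      unfolding sf_def
    proof (intro sum.cong refl)
      fix i j assume "i \<in> {..<n}" "j \<in> {..<n}"
      then have "(\<Sum>y<n. cnj (d y i) * c y j) = (\<Sum>y<n. d i y * c y j)"
        by (intro sum.cong refl) (metis dh lessThan_iff)
      then show "cnj (e k i) * ((\<Sum>y<n. b i y * d y j) + (\<Sum>y<n. cnj (d y i) * c y j)) * e k j
        = cnj (e k i) * ((\<Sum>y<n. b i y * d y j) + (\<Sum>y<n. d i y * c y j)) * e k j" by simp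
    qed
    also have "\<dots> = 0" unfolding sf_def by (intro sum.neutral ballI) (simp add: z)
    finally have s0: "sf n b (e k) (\<lambda>a. \<Sum>y<n. d a y * e k y) + sf n c (\<lambda>a. \<Sum>y<n. d a y * e k y) (e k) = 0" .
    have "sf n b (e k) (\<lambda>a. \<Sum>y<n. d a y * e k y) = sf n b (e k) (\<lambda>a. l k * e k a)"
      unfolding sf_def by (intro sum.cong refl) (use ev k in simp)
    moreover have "sf n c (\<lambda>a. \<Sum>y<n. d a y * e k y) (e k) = sf n c (\<lambda>a. l k * e k a) (e k)"
      unfolding sf_def by (intro sum.cong refl) (use ev k in simp)
    ultimately have s: "l k * sf n b (e k) (e k) + cnj (l k) * sf n c (e k) (e k) = 0"
      using s0 by (simp add: sf_scale_left sf_scale_right)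
    \<comment> \<open>Hermiticity of \<open>d\<close> makes the eigenvalue real, so it can be
      cancelled from both summands of \<open>s\<close>.\<close>
    have "l k * ip n (e k) (e k) = cnj (l k) * ip n (e k) (e k)"
    proof -
      have "l k * ip n (e k) (e k) = sf n d (e k) (e k)"
        unfolding ip_scale_right[symmetric] using ev[OF k]
        by (simp add: ip_def sf_def sum_distrib_left mult.assoc flip: sum_distrib_left)
      also have "\<dots> = cnj (sf n d (e k) (e k))"
      proof -
        have "cnj (sf n d (e k) (e k)) = (\<Sum>i<n. \<Sum>j<n. cnj (e k j) * d j i * e k i)"
          unfolding sf_def cnj_sum
          by (intro sum.cong refl) (use dh in \<open>metis complex_cnj_cnj complex_cnj_mult lessThan_iff mult.assoc mult.commute\<close>)
        also have "\<dots> = sf n d (e k) (e k)" unfolding sf_def by (rule sum.swap)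
        finally show ?thesis by simp
      qed
      also have "sf n d (e k) (e k) = l k * ip n (e k) (e k)"
        unfolding ip_scale_right[symmetric] using ev[OF k]
        by (simp add: ip_def sf_def sum_distrib_left mult.assoc flip: sum_distrib_left)
      finally show ?thesis by (simp add: ip_self)
    qed
    then have "cnj (l k) = l k" using e k by (simp add: orthonormal_def)
    then have "sf n b (e k) (e k) + sf n c (e k) (e k) = 0"
      using s False by (simp flip: distrib_left)
    then have "sf n b (e k) (e k) = 0" "sf n c (e k) (e k) = 0"
      using posD[OF pb, of "e k"] posD[OF pc, of "e k"] by (auto simp: complex_eq_iff)
    then have "(\<Sum>y<n. b a y * e k y) = 0" "(\<Sum>y<n. c a y * e k y) = 0"
      using pos_null[OF pb _ a] pos_null[OF pc _ a] by blast+
    then show ?thesis by (simp add: d_def left_diff_distrib sum_subtractf)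
  qed
  have "d x y = 0" if "x < n" "y < n" for x y
  proof -
    have "ip n (e k) (\<lambda>y. cnj (d x y)) = 0" if "k < n" for k
    proof -
      have "ip n (e k) (\<lambda>y. cnj (d x y)) = cnj (\<Sum>y<n. d x y * e k y)"
        by (simp add: ip_def mult.commute)
      then show ?thesis using null[OF that \<open>x < n\<close>] by simp
    qed
    then have "cnj (d x y) = 0" using orthonormal_separates[OF e _ \<open>y < n\<close>] by blast
    then show ?thesis by simp
  qed
  then show ?thesis using assms(1,2) by (intro eq_matI) (auto simp: d_def b_def c_def)
qed

lemma psd_sqrt_exists:
  assumes A: "A \<in> carrier_mat n n" and p: "psd A"
  shows "\<exists>B \<in> carrier_mat n n. psd B \<and> B * B = A"
proof -
  obtain e l where e: "orthonormal n e" and l: "\<And>k. k < n \<Longrightarrow> 0 \<le> l k"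
    and M: "\<And>a b. a < n \<Longrightarrow> b < n \<Longrightarrow> A $$ (a,b) = (\<Sum>k<n. complex_of_real (l k) * e k a * cnj (e k b))"
    by (rule pos_spectral[OF p[unfolded psd_iff_pos[OF A]]]) blast
  define S where "S = (\<lambda>a b. \<Sum>k<n. complex_of_real (sqrt (l k)) * e k a * cnj (e k b))"
  define B where "B = mat n n (\<lambda>(a,b). S a b)"
  have B: "B \<in> carrier_mat n n" by (simp add: B_def)
  have "pos n S"
    unfolding S_def by (rule posI[OF sf_rank_one_sum]) (auto intro!: sum_nonneg simp: l)
  then have "pos n (\<lambda>i j. B $$ (i,j))" by (simp add: B_def pos_def sf_def)
  then have "psd B" using psd_iff_pos[OF B] by blast
  moreover have "B * B = A"
  proof (rule eq_matI)
    fix a b assume "a < dim_row A" "b < dim_col A"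
    then have ab: "a < n" "b < n" using A by auto
    let ?s = "\<lambda>k. complex_of_real (sqrt (l k))"
    have "(B * B) $$ (a,b) = (\<Sum>c<n. S a c * S c b)"
      using ab by (simp add: B_def scalar_prod_def atLeast0LessThan)
    also have "\<dots> = (\<Sum>c<n. \<Sum>k<n. \<Sum>j<n. ?s k * e k a * cnj (e k c) * (?s j * e j c * cnj (e j b)))"
      by (simp only: S_def sum_product)
    also have "\<dots> = (\<Sum>k<n. \<Sum>c<n. \<Sum>j<n. ?s k * e k a * cnj (e k c) * (?s j * e j c * cnj (e j b)))"
      by (rule sum.swap)
    also have "\<dots> = (\<Sum>k<n. \<Sum>j<n. \<Sum>c<n. ?s k * e k a * cnj (e k c) * (?s j * e j c * cnj (e j b)))"
      by (intro sum.cong refl sum.swap)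
    also have "\<dots> = (\<Sum>k<n. \<Sum>j<n. ?s k * e k a * ?s j * cnj (e j b) * ip n (e k) (e j))"
      by (simp add: ip_def sum_distrib_left algebra_simps)
    also have "\<dots> = (\<Sum>k<n. \<Sum>j<n. if j = k then ?s k * e k a * ?s j * cnj (e j b) else 0)"
      by (intro sum.cong refl) (use e in \<open>auto simp: orthonormal_def\<close>)
    also have "\<dots> = (\<Sum>k<n. complex_of_real (l k) * e k a * cnj (e k b))"
    proof (intro sum.cong refl)
      fix k assume "k \<in> {..<n}"
      then have "?s k * ?s k = complex_of_real (l k)" using l[of k] by (simp flip: of_real_mult)
      then show "(\<Sum>j<n. if j = k then ?s k * e k a * ?s j * cnj (e j b) else 0) = complex_of_real (l k) * e k a * cnj (e k b)"
        using \<open>k \<in> {..<n}\<close> by (simp add: algebra_simps)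
    qed
    finally show "(B * B) $$ (a,b) = A $$ (a,b)" using M[OF ab] by simp
  qed (use A B in auto)
  ultimately show ?thesis using B by blast
qed

lemma msqrt_eqI:
  assumes "B \<in> carrier_mat n n" "psd B" "B * B = A"
  shows "msqrt A = B"
  unfolding msqrt_def
proof (rule the_equality)
  have A: "dim_row A = n" using assms by auto
  show "B \<in> carrier_mat (dim_row A) (dim_row A) \<and> psd B \<and> B * B = A" using assms A by simp
  show "C = B" if "C \<in> carrier_mat (dim_row A) (dim_row A) \<and> psd C \<and> C * C = A" for C
    using psd_sqrt_unique[of C n B] that assms A by simp
qed

text \<open>Let S be the root of X^* X. Then |X_ii|^2 is at most the (i,i) entry of S S, which is
  the sum of |S_ij|^2 over j; the entry bound makes this at most S_ii Tr S, hence at most the square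
  of Tr S.\<close>

lemma diag_le_trace_norm:
  assumes X: "X \<in> carrier_mat n n" and i: "i < n"
  shows "cmod (X $$ (i,i)) \<le> trace_norm X"
proof -
  have aX: "adj X * X \<in> carrier_mat n n" using X by (auto simp: adj_def)
  have ent: "(adj X * X) $$ (a,b) = (\<Sum>c<n. cnj (X $$ (c,a)) * X $$ (c,b))" if "a < n" "b < n" for a b
    using that X by (simp add: adj_def scalar_prod_def atLeast0LessThan)
  have sfX: "sf n (\<lambda>i j. (adj X * X) $$ (i,j)) v v = complex_of_real (\<Sum>c<n. (cmod (\<Sum>b<n. X $$ (c,b) * v b))\<^sup>2)" for v
  proof -
    have "sf n (\<lambda>i j. (adj X * X) $$ (i,j)) v v = sf n (\<lambda>a b. \<Sum>c<n. cnj (X $$ (c,a)) * X $$ (c,b)) v v"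
      unfolding sf_def by (intro sum.cong refl) (simp add: ent del: index_mult_mat)
    also have "\<dots> = sf n (\<lambda>a b. X $$ (a,b)) (\<lambda>b. \<Sum>c<n. X $$ (b,c) * v c) v"
      by (rule sf_comp_left[symmetric])
    also have "\<dots> = ip n (\<lambda>b. \<Sum>c<n. X $$ (b,c) * v c) (\<lambda>b. \<Sum>c<n. X $$ (b,c) * v c)"
      by (simp only: sf_def ip_def sum_distrib_left mult.assoc)
    finally show ?thesis by (simp only: ip_self)
  qed
  have "psd (adj X * X)"
    unfolding psd_iff_pos[OF aX] by (rule posI[OF sfX]) (auto intro!: sum_nonneg)
  then obtain S where S: "S \<in> carrier_mat n n" "psd S" "S * S = adj X * X"
    using psd_sqrt_exists[OF aX] by blast
  then have ms: "msqrt (adj X * X) = S" by (rule msqrt_eqI)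
  have pS: "pos n (\<lambda>i j. S $$ (i,j))" using S psd_iff_pos by blast
  let ?t = "\<Sum>j<n. Re (S $$ (j,j))"
  have d: "0 \<le> Re (S $$ (j,j))" if "j < n" for j using pos_diag[OF pS that] by simp
  have "complex_of_real (\<Sum>c<n. (cmod (X $$ (c,i)))\<^sup>2) = (S * S) $$ (i,i)"
    unfolding S(3) ent[OF i i] of_real_sum complex_norm_square by (simp add: mult.commute)
  also have "\<dots> = (\<Sum>j<n. S $$ (i,j) * S $$ (j,i))"
    using S(1) i by (simp add: scalar_prod_def atLeast0LessThan)
  also have "\<dots> = complex_of_real (\<Sum>j<n. (cmod (S $$ (i,j)))\<^sup>2)"
    unfolding of_real_sum complex_norm_square
    by (intro sum.cong refl) (use pos_hermitian[OF pS _ i] in simp)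
  finally have "(\<Sum>c<n. (cmod (X $$ (c,i)))\<^sup>2) = (\<Sum>j<n. (cmod (S $$ (i,j)))\<^sup>2)"
    using of_real_eq_iff by blast
  also have "\<dots> \<le> (\<Sum>j<n. Re (S $$ (i,i)) * Re (S $$ (j,j)))"
    by (intro sum_mono) (use pos_entry_bound[OF pS i] in simp)
  also have "\<dots> = Re (S $$ (i,i)) * ?t" by (simp add: sum_distrib_left)
  also have "\<dots> \<le> ?t * ?t"
    by (intro mult_right_mono sum_nonneg member_le_sum) (use d i in auto)
  finally have "(\<Sum>c<n. (cmod (X $$ (c,i)))\<^sup>2) \<le> ?t\<^sup>2" by (simp add: power2_eq_square)
  moreover have "(cmod (X $$ (i,i)))\<^sup>2 \<le> (\<Sum>c<n. (cmod (X $$ (c,i)))\<^sup>2)"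
    by (rule member_le_sum) (use i in auto)
  moreover have "0 \<le> ?t" by (intro sum_nonneg) (use d in auto)
  ultimately have "cmod (X $$ (i,i)) \<le> ?t" by (meson order.trans power2_le_imp_le)
  moreover have "trace_norm X = ?t"
    using S(1) by (simp add: trace_norm_def ms mtrace_def Re_sum)
  ultimately show ?thesis by simp
qed

lemma sum_single:
  assumes "finite A" "m \<in> A" "\<And>x. x \<in> A \<Longrightarrow> x \<noteq> m \<Longrightarrow> f x = 0"
  shows "sum f A = f m"
proof -
  have "sum f A = sum f {m}" by (rule sum.mono_neutral_right) (use assms in auto)
  then show ?thesis by simp
qed

section \<open>Basis messages and the diagonal of the non-malleability condition\<close>

lemma ketbra_carrier [simp]: "ketbra d a b \<in> carrier_mat d d"
  by (simp add: ketbra_def)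

lemma ketbra_index [simp]: "i < d \<Longrightarrow> j < d \<Longrightarrow> ketbra d a b $$ (i,j) = of_bool (i = a \<and> j = b)"
  by (simp add: ketbra_def)

lemma ketbra_dim [simp]: "dim_row (ketbra d a b) = d" "dim_col (ketbra d a b) = d"
  by (simp_all add: ketbra_def)

lemma psd_ketbra:
  assumes "m < d"
  shows "psd (ketbra d m m)"
proof -
  have "sf d (\<lambda>i j. ketbra d m m $$ (i,j)) v v = complex_of_real ((cmod (v m))\<^sup>2)" for v
  proof -
    have "sf d (\<lambda>i j. ketbra d m m $$ (i,j)) v v = cnj (v m) * v m"
      unfolding sf_def using assms
      by (subst sum_single[of _ m], simp, simp, force simp: ketbra_def, subst sum_single[of _ m])
        (auto simp: ketbra_def)
    then show ?thesis by (simp only: complex_norm_square mult.commute)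
  qed
  then show ?thesis unfolding psd_iff_pos[OF ketbra_carrier] pos_def by (metis zero_le_power2)
qed

lemma density_ketbra: "m < d \<Longrightarrow> density d (ketbra d m m)"
  unfolding density_def mtrace_def
  by (auto simp: psd_ketbra intro!: trans[OF sum_single[of _ m]])

lemma msqrt_ketbra:
  assumes "m < d"
  shows "msqrt (ketbra d m m) = ketbra d m m"
proof (rule msqrt_eqI[OF ketbra_carrier psd_ketbra[OF assms]])
  show "ketbra d m m * ketbra d m m = ketbra d m m"
  proof (rule eq_matI)
    fix i j assume "i < dim_row (ketbra d m m)" "j < dim_col (ketbra d m m)"
    then have ij: "i < d" "j < d" by auto
    then have "(ketbra d m m * ketbra d m m) $$ (i,j) = (\<Sum>c<d. of_bool (i = m \<and> c = m) * of_bool (c = m \<and> j = m))"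
      by (simp add: scalar_prod_def atLeast0LessThan del: of_bool_conj)
    also have "\<dots> = of_bool (i = m \<and> j = m)"
      using assms by (subst sum_single[of _ m]) auto
    finally show "(ketbra d m m * ketbra d m m) $$ (i,j) = ketbra d m m $$ (i,j)" using ij by simp
  qed simp_all
qed

lemma index_bound:
  fixes x y :: nat
  assumes "x < n" "y < m"
  shows "x * m + y < n * m"
proof -
  have "x * m + y < Suc x * m" using assms(2) by (simp only: mult_Suc add.commute add_less_cancel_left)
  also have "\<dots> \<le> n * m" by (rule mult_le_mono1) (simp add: Suc_leI assms(1))
  finally show ?thesis .
qed

text \<open>The projector |m><m| is its own square root, so its canonical purification is the
  product vector |m>|m>.\<close>

lemma canon_purif_ketbra:
  assumes "m < d" "a < d" "b < d" "c < d" "e < d"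
  shows "canon_purif d (ketbra d m m) $$ (a * d + c, b * d + e) = of_bool (a = m \<and> c = m \<and> b = m \<and> e = m)"
  using assms index_bound by (simp add: canon_purif_def msqrt_ketbra Let_def)

text \<open>Extracts a classical condition on decoding probabilities. One pair \<open>p\<close>,
  \<open>g\<close> serves all messages, because \<open>p\<close> and \<open>\<gamma>\<close> depend
  on the tampering only; this uniformity is what both attacks violate.\<close>

lemma non_malleable_diagonal:
  assumes nm: "non_malleable_LO k qs Enc Dec \<epsilon>" and L: "\<Lambda> \<in> LO qs"
    and c: "\<And>X. X \<in> carrier_mat (2^k) (2^k) \<Longrightarrow> Dec (\<Lambda> (Enc X)) \<in> carrier_mat (2^k) (2^k)"
  shows "\<exists>p g. 0 \<le> p \<and> p \<le> 1 \<and> (\<forall>i<2^k. 0 \<le> g i) \<and> (\<Sum>i<2^k. g i) = 1 \<and>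
    (\<forall>m<2^k. \<forall>i<2^k. \<bar>Re (Dec (\<Lambda> (Enc (ketbra (2^k) m m))) $$ (i,i)) - (p * of_bool (i = m) + (1 - p) * g i)\<bar> \<le> \<epsilon>)"
proof -
  define d :: nat where "d = 2 ^ k"
  define E where "E = Dec \<circ> \<Lambda> \<circ> Enc"
  have E: "E X \<in> carrier_mat d d" if "X \<in> carrier_mat d d" for X
    using c that by (simp add: E_def d_def)
  let ?err = "\<lambda>p \<gamma> \<sigma>. superop_tensor d d E (\<lambda>Y. Y) (canon_purif d \<sigma>)
       - (complex_of_real p \<cdot>\<^sub>m canon_purif d \<sigma> + complex_of_real (1 - p) \<cdot>\<^sub>m kron \<gamma> (ptrace1 d d (canon_purif d \<sigma>)))"
  have "\<exists>p \<gamma>. 0 \<le> p \<and> p \<le> 1 \<and> density d \<gamma> \<and> (\<forall>\<sigma>. density d \<sigma> \<longrightarrow> trace_norm (?err p \<gamma> \<sigma>) \<le> \<epsilon>)"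
    unfolding d_def E_def by (rule bspec[OF nm[unfolded non_malleable_LO_def Let_def] L])
  then obtain p \<gamma> where p: "0 \<le> p" "p \<le> 1" and \<gamma>: "density d \<gamma>"
    and b: "\<And>\<sigma>. density d \<sigma> \<Longrightarrow> trace_norm (?err p \<gamma> \<sigma>) \<le> \<epsilon>"
    by blast
  have \<gamma>c: "\<gamma> \<in> carrier_mat d d" "psd \<gamma>" "mtrace \<gamma> = 1" using \<gamma> by (auto simp: density_def)
  define g where "g = (\<lambda>i. Re (\<gamma> $$ (i,i)))"
  have gd: "\<gamma> $$ (i,i) = complex_of_real (g i)" "0 \<le> g i" if "i < d" for i
    using pos_diag[OF \<gamma>c(2)[unfolded psd_iff_pos[OF \<gamma>c(1)]] that] by (auto simp: g_def complex_eq_iff)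
  have "(\<Sum>i<d. g i) = 1"
    using arg_cong[OF \<gamma>c(3), of Re] \<gamma>c(1) by (simp add: mtrace_def g_def)
  moreover have "\<bar>Re (E (ketbra d m m) $$ (i,i)) - (p * of_bool (i = m) + (1 - p) * g i)\<bar> \<le> \<epsilon>"
    if m: "m < d" and i: "i < d" for m i
  proof -
    let ?P = "canon_purif d (ketbra d m m)"
    let ?T = "superop_tensor d d E (\<lambda>Y. Y) ?P"
    let ?X = "?T - (complex_of_real p \<cdot>\<^sub>m ?P + complex_of_real (1 - p) \<cdot>\<^sub>m kron \<gamma> (ptrace1 d d ?P))"
    \<comment> \<open>The basis vector |i>|m>: decoded value \<open>i\<close>, reference still at
      \<open>m\<close>.\<close>
    let ?x = "i * d + m"
    have x: "?x < d * d" using index_bound i m by blast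
    have dE: "dim_row (E (ketbra d a b)) = d" "dim_col (E (ketbra d a b)) = d" for a b
      using E[OF ketbra_carrier] by auto
    have T: "?T $$ (?x,?x) = E (ketbra d m m) $$ (i,i)"
    proof -
      have "?T $$ (?x,?x) = (\<Sum>a<d. \<Sum>b<d. \<Sum>c<d. \<Sum>e<d. ?P $$ (a * d + c, b * d + e)
          * (E (ketbra d a b) $$ (i,i) * ketbra d c e $$ (m,m)))"
        using x i m unfolding superop_tensor_def Let_def dE ketbra_dim
        by (subst index_mat) (simp_all add: kron_def dE ketbra_dim)
      also have "\<dots> = (\<Sum>a<d. \<Sum>b<d. \<Sum>c<d. \<Sum>e<d. of_bool (a = m \<and> c = m \<and> b = m \<and> e = m)
          * (E (ketbra d a b) $$ (i,i) * ketbra d c e $$ (m,m)))"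
        by (intro sum.cong refl) (simp add: canon_purif_ketbra m)
      also have "\<dots> = E (ketbra d m m) $$ (i,i) * ketbra d m m $$ (m,m)"
        using m by (subst sum_single[of _ m], simp, simp, simp)+ simp
      finally show ?thesis using m by simp
    qed
    have Pxx: "?P $$ (?x,?x) = of_bool (i = m)" using canon_purif_ketbra[OF m i i m m] by simp
    have K: "kron \<gamma> (ptrace1 d d ?P) $$ (?x,?x) = \<gamma> $$ (i,i)"
    proof -
      have "ptrace1 d d ?P $$ (m,m) = (\<Sum>a<d. ?P $$ (a * d + m, a * d + m))"
        using m by (simp add: ptrace1_def)
      also have "\<dots> = (\<Sum>a<d. of_bool (a = m))"
        by (intro sum.cong refl) (simp add: canon_purif_ketbra m)
      also have "\<dots> = 1" using m by (subst sum_single[of _ m]) auto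
      finally have pt: "ptrace1 d d ?P $$ (m,m) = 1" .
      have dp: "dim_row (ptrace1 d d ?P) = d" "dim_col (ptrace1 d d ?P) = d" by (simp_all add: ptrace1_def)
      show ?thesis using x i m \<gamma>c(1) unfolding kron_def dp
        by (subst index_mat) (simp_all add: pt)
    qed
    have cT: "?T \<in> carrier_mat (d*d) (d*d)" by (simp add: superop_tensor_def Let_def dE ketbra_dim)
    have cP: "?P \<in> carrier_mat (d*d) (d*d)" by (simp add: canon_purif_def Let_def)
    have cK: "kron \<gamma> (ptrace1 d d ?P) \<in> carrier_mat (d*d) (d*d)"
      using \<gamma>c(1) by (simp add: kron_def ptrace1_def)
    have cX: "?X \<in> carrier_mat (d*d) (d*d)" using cT cP cK by auto
    have "?X $$ (?x,?x) = E (ketbra d m m) $$ (i,i) - complex_of_real (p * of_bool (i = m) + (1 - p) * g i)"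
      using x cT cP cK T Pxx K gd(1)[OF i] by (simp add: carrier_matD)
    then have "Re (?X $$ (?x,?x)) = Re (E (ketbra d m m) $$ (i,i)) - (p * of_bool (i = m) + (1 - p) * g i)"
      by simp
    then show ?thesis
      using diag_le_trace_norm[OF cX x] b[OF density_ketbra[OF m]] abs_Re_le_cmod[of "?X $$ (?x,?x)"]
      by linarith
  qed
  ultimately show ?thesis using p gd(2) unfolding d_def E_def o_def by blast
qed

section \<open>Kraus maps and tensor products of channels\<close>

text \<open>Equal input and output dimension suffices, since Kraus form is used for tampering only.
  Trace preservation is kept apart, as the hypothesis \<open>tp\<close> of
  \<open>kraus_cptp\<close>.\<close>

definition kraus :: "nat \<Rightarrow> 'i set \<Rightarrow> ('i \<Rightarrow> nat \<Rightarrow> nat \<Rightarrow> complex) \<Rightarrow> (cmat \<Rightarrow> cmat) \<Rightarrow> bool" where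
  "kraus n I K \<Phi> \<longleftrightarrow> finite I \<and> (\<forall>X \<in> carrier_mat n n.
     \<Phi> X = mat n n (\<lambda>(i,j). \<Sum>s\<in>I. \<Sum>x<n. \<Sum>y<n. K s i x * X $$ (x,y) * cnj (K s j y)))"

lemma kraus_apply:
  "kraus n I K \<Phi> \<Longrightarrow> X \<in> carrier_mat n n \<Longrightarrow>
     \<Phi> X = mat n n (\<lambda>(i,j). \<Sum>s\<in>I. \<Sum>x<n. \<Sum>y<n. K s i x * X $$ (x,y) * cnj (K s j y))"
  by (simp add: kraus_def)

lemma kraus_carrier: "kraus n I K \<Phi> \<Longrightarrow> X \<in> carrier_mat n n \<Longrightarrow> \<Phi> X \<in> carrier_mat n n"
  by (simp add: kraus_apply)

lemma kraus_ketbra: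
  assumes "kraus n I K \<Phi>" "a < n" "b < n" "i < n" "j < n"
  shows "\<Phi> (ketbra n a b) $$ (i,j) = (\<Sum>s\<in>I. K s i a * cnj (K s j b))"
proof -
  have "(\<Sum>x<n. \<Sum>y<n. K s i x * ketbra n a b $$ (x,y) * cnj (K s j y)) = K s i a * cnj (K s j b)" for s
    using assms(2,3) by (subst sum_single[of _ a], simp, simp, simp, subst sum_single[of _ b]) auto
  then show ?thesis using assms by (simp add: kraus_apply[OF assms(1) ketbra_carrier])
qed

lemma sum_index_split:
  fixes f :: "nat \<Rightarrow> 'a :: comm_monoid_add"
  shows "(\<Sum>x<n * m. f x) = (\<Sum>a<n. \<Sum>c<m. f (a * m + c))"
proof -
  have "sum f {a * m..<a * m + m} = (\<Sum>c<m. f (a * m + c))" for a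
    using sum.shift_bounds_nat_ivl[of f 0 "a * m" m] by (simp add: add.commute atLeast0LessThan)
  then show ?thesis by (simp flip: sum.nat_group)
qed

lemma kraus_id: "kraus n {()} (\<lambda>_ x y. of_bool (x = y)) (\<lambda>X. X)"
  unfolding kraus_def
proof (intro conjI ballI)
  fix X :: cmat assume X: "X \<in> carrier_mat n n"
  have "(\<Sum>x<n. \<Sum>y<n. of_bool (i = x) * X $$ (x,y) * cnj (of_bool (j = y))) = X $$ (i,j)"
    if "i < n" "j < n" for i j
    using that by (subst sum_single[of _ i], simp, simp, simp, subst sum_single[of _ j]) auto
  with X show "X = mat n n (\<lambda>(i,j). \<Sum>s\<in>{()}. \<Sum>x<n. \<Sum>y<n. of_bool (i = x) * X $$ (x,y) * cnj (of_bool (j = y)))"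
    by (intro eq_matI) auto
qed simp

text \<open>Serves to drop the unit components that tensoring with the identity adds to the index
  set, and to rewrite the operators on indices below \<open>n\<close>.\<close>

lemma kraus_reindex:
  assumes "kraus n I K \<Phi>" "bij_betw h J I"
    and "\<And>t x y. t \<in> J \<Longrightarrow> x < n \<Longrightarrow> y < n \<Longrightarrow> L t x y = K (h t) x y"
  shows "kraus n J L \<Phi>"
  unfolding kraus_def
proof (intro conjI ballI)
  show "finite J" using assms(1,2) bij_betw_finite kraus_def by blast
  fix X :: cmat assume X: "X \<in> carrier_mat n n"
  have "(\<Sum>s\<in>I. \<Sum>x<n. \<Sum>y<n. K s i x * X $$ (x,y) * cnj (K s j y))
      = (\<Sum>t\<in>J. \<Sum>x<n. \<Sum>y<n. L t i x * X $$ (x,y) * cnj (L t j y))" if "i < n" "j < n" for i j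
    unfolding sum.reindex_bij_betw[OF assms(2), symmetric]
    by (intro sum.cong refl) (use assms(3) that in auto)
  then show "\<Phi> X = mat n n (\<lambda>(i,j). \<Sum>s\<in>J. \<Sum>x<n. \<Sum>y<n. L s i x * X $$ (x,y) * cnj (L s j y))"
    unfolding kraus_apply[OF assms(1) X] by (intro eq_matI) auto
qed

text \<open>\<open>superop_tensor\<close> expands its argument in matrix units, on which a Kraus map
  is explicit by \<open>kraus_ketbra\<close>; regrouping the sums leaves the operators
  \<open>K s\<close> tensor \<open>L t\<close>.\<close>

lemma kraus_tensor:
  assumes K: "kraus n I K \<Phi>" and L: "kraus m J L \<Psi>"
  shows "kraus (n * m) (I \<times> J) (\<lambda>(s,t) x y. K s (x div m) (y div m) * L t (x mod m) (y mod m))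
    (superop_tensor n m \<Phi> \<Psi>)"
  unfolding kraus_def
proof (intro conjI ballI)
  show "finite (I \<times> J)" using K L by (simp add: kraus_def)
  fix X :: cmat assume X: "X \<in> carrier_mat (n * m) (n * m)"
  have dK: "dim_row (\<Phi> (ketbra n a b)) = n" "dim_col (\<Phi> (ketbra n a b)) = n" for a b
    using kraus_carrier[OF K ketbra_carrier] by auto
  have dL: "dim_row (\<Psi> (ketbra m a b)) = m" "dim_col (\<Psi> (ketbra m a b)) = m" for a b
    using kraus_carrier[OF L ketbra_carrier] by auto
  let ?rhs = "\<lambda>i j. \<Sum>p\<in>I \<times> J. \<Sum>x<n * m. \<Sum>y<n * m.
      (case p of (s,t) \<Rightarrow> \<lambda>x y. K s (x div m) (y div m) * L t (x mod m) (y mod m)) i x * X $$ (x,y)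
      * cnj ((case p of (s,t) \<Rightarrow> \<lambda>x y. K s (x div m) (y div m) * L t (x mod m) (y mod m)) j y)"
  show "superop_tensor n m \<Phi> \<Psi> X = mat (n * m) (n * m) (\<lambda>(i,j). ?rhs i j)"
    unfolding superop_tensor_def Let_def dK dL
  proof (intro eq_matI)
    fix i j assume "i < dim_row (mat (n * m) (n * m) (\<lambda>(i,j). ?rhs i j))"
      "j < dim_col (mat (n * m) (n * m) (\<lambda>(i,j). ?rhs i j))"
    then have ij: "i < n * m" "j < n * m" by auto
    then have m: "0 < m" by (cases m) auto
    have d: "i div m < n" "j div m < n" "i mod m < m" "j mod m < m"
      using ij m by (auto simp: less_mult_imp_div_less)
    define g where "g = (\<lambda>a b c e s t. K s (i div m) a * L t (i mod m) c * X $$ (a * m + c, b * m + e)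
       * cnj (K s (j div m) b * L t (j mod m) e))"
    have "(\<Sum>a<n. \<Sum>b<n. \<Sum>c<m. \<Sum>e<m. X $$ (a * m + c, b * m + e) * kron (\<Phi> (ketbra n a b)) (\<Psi> (ketbra m c e)) $$ (i,j))
       = (\<Sum>a<n. \<Sum>b<n. \<Sum>c<m. \<Sum>e<m. \<Sum>s\<in>I. \<Sum>t\<in>J. g a b c e s t)"
    proof (intro sum.cong refl)
      fix a b c e assume r: "a \<in> {..<n}" "b \<in> {..<n}" "c \<in> {..<m}" "e \<in> {..<m}"
      have "kron (\<Phi> (ketbra n a b)) (\<Psi> (ketbra m c e)) $$ (i,j)
          = \<Phi> (ketbra n a b) $$ (i div m, j div m) * \<Psi> (ketbra m c e) $$ (i mod m, j mod m)"
        using ij by (simp add: kron_def dK dL)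
      also have "\<dots> = (\<Sum>s\<in>I. \<Sum>t\<in>J. K s (i div m) a * cnj (K s (j div m) b) * (L t (i mod m) c * cnj (L t (j mod m) e)))"
        using r d by (simp only: lessThan_iff kraus_ketbra[OF K] kraus_ketbra[OF L] sum_product)
      finally show "X $$ (a * m + c, b * m + e) * kron (\<Phi> (ketbra n a b)) (\<Psi> (ketbra m c e)) $$ (i,j)
          = (\<Sum>s\<in>I. \<Sum>t\<in>J. g a b c e s t)"
        by (simp add: sum_distrib_left g_def algebra_simps)
    qed
    also have "\<dots> = (\<Sum>s\<in>I. \<Sum>t\<in>J. \<Sum>a<n. \<Sum>c<m. \<Sum>b<n. \<Sum>e<m. g a b c e s t)"
      unfolding sum.cartesian_product
      by (rule sum.reindex_bij_witness[where i = "\<lambda>(s,t,a,c,b,e). (a,b,c,e,s,t)" and j = "\<lambda>(a,b,c,e,s,t). (s,t,a,c,b,e)"]) auto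
    also have "\<dots> = (\<Sum>s\<in>I. \<Sum>t\<in>J. \<Sum>x<n * m. \<Sum>y<n * m.
        K s (i div m) (x div m) * L t (i mod m) (x mod m) * X $$ (x,y) * cnj (K s (j div m) (y div m) * L t (j mod m) (y mod m)))"
      unfolding sum_index_split by (intro sum.cong refl) (simp add: g_def)
    also have "\<dots> = ?rhs i j"
      by (subst sum.cartesian_product, intro sum.cong refl) auto
    finally show "mat (n * m) (n * m) (\<lambda>(i,j). \<Sum>a<n. \<Sum>b<n. \<Sum>c<m. \<Sum>e<m. X $$ (a * m + c, b * m + e)
       * kron (\<Phi> (ketbra n a b)) (\<Psi> (ketbra m c e)) $$ (i,j)) $$ (i,j)
       = mat (n * m) (n * m) (\<lambda>(i,j). ?rhs i j) $$ (i,j)"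
      using ij by simp
  qed auto
qed

text \<open><v|\<Phi>(X)|v> is the sum over s of <w_s|X|w_s>, where w_s is the adjoint of
  \<open>K s\<close> applied to v.\<close>

lemma kraus_psd:
  assumes K: "kraus n I K \<Phi>" and X: "X \<in> carrier_mat n n" "psd X"
  shows "psd (\<Phi> X)"
proof -
  have pX: "pos n (\<lambda>i j. X $$ (i,j))" using X psd_iff_pos by blast
  define w where "w = (\<lambda>v s x. \<Sum>i<n. cnj (K s i x) * v i)"
  have "sf n (\<lambda>i j. \<Phi> X $$ (i,j)) v v = complex_of_real (\<Sum>s\<in>I. Re (sf n (\<lambda>i j. X $$ (i,j)) (w v s) (w v s)))" for v
  proof -
    have "sf n (\<lambda>i j. \<Phi> X $$ (i,j)) v v
       = (\<Sum>i<n. \<Sum>j<n. \<Sum>s\<in>I. \<Sum>x<n. \<Sum>y<n. cnj (v i) * (K s i x * X $$ (x,y) * cnj (K s j y)) * v j)"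
      by (simp add: sf_def kraus_apply[OF K X(1)] sum_distrib_left sum_distrib_right)
    also have "\<dots> = (\<Sum>s\<in>I. \<Sum>x<n. \<Sum>y<n. \<Sum>i<n. \<Sum>j<n. cnj (v i) * (K s i x * X $$ (x,y) * cnj (K s j y)) * v j)"
      unfolding sum.cartesian_product
      by (rule sum.reindex_bij_witness[where i = "\<lambda>(s,x,y,i,j). (i,j,s,x,y)" and j = "\<lambda>(i,j,s,x,y). (s,x,y,i,j)"]) auto
    also have "\<dots> = (\<Sum>s\<in>I. sf n (\<lambda>i j. X $$ (i,j)) (w v s) (w v s))"
      unfolding sf_def
    proof (intro sum.cong refl)
      fix s x y
      have "cnj (w v s x) * X $$ (x,y) * w v s y = (\<Sum>i<n. \<Sum>j<n. K s i x * cnj (v i) * (cnj (K s j y) * v j)) * X $$ (x,y)"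
        unfolding sum_product[symmetric] by (simp add: w_def)
      then show "(\<Sum>i<n. \<Sum>j<n. cnj (v i) * (K s i x * X $$ (x,y) * cnj (K s j y)) * v j) = cnj (w v s x) * X $$ (x,y) * w v s y"
        by (simp add: sum_distrib_left sum_distrib_right algebra_simps)
    qed
    finally show ?thesis using pos_real[OF pX] by simp
  qed
  then have "pos n (\<lambda>i j. \<Phi> X $$ (i,j))"
    by (rule posI) (auto intro!: sum_nonneg simp: posD[OF pX])
  then show ?thesis using psd_iff_pos[OF kraus_carrier[OF K X(1)]] by blast
qed

text \<open>Complete positivity reduces to \<open>kraus_psd\<close>, because tensoring with the
  identity stays in Kraus form. The hypothesis \<open>tp\<close> is the completeness relation of the
  Kraus operators.\<close>

lemma kraus_cptp:
  assumes K: "kraus n I K \<Phi>"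
    and tp: "\<And>x y. x < n \<Longrightarrow> y < n \<Longrightarrow> (\<Sum>s\<in>I. \<Sum>i<n. cnj (K s i y) * K s i x) = of_bool (x = y)"
  shows "cptp n n \<Phi>"
  unfolding cptp_def
proof (intro conjI ballI allI impI)
  show "\<Phi> X \<in> carrier_mat n n" if "X \<in> carrier_mat n n" for X using kraus_carrier[OF K that] .
  show "\<Phi> (a \<cdot>\<^sub>m X + b \<cdot>\<^sub>m Y) = a \<cdot>\<^sub>m \<Phi> X + b \<cdot>\<^sub>m \<Phi> Y"
    if X: "X \<in> carrier_mat n n" and Y: "Y \<in> carrier_mat n n" for X Y a b
  proof -
    have c: "a \<cdot>\<^sub>m X + b \<cdot>\<^sub>m Y \<in> carrier_mat n n" using X Y by auto
    have "(\<Sum>s\<in>I. \<Sum>x<n. \<Sum>y<n. K s i x * (a \<cdot>\<^sub>m X + b \<cdot>\<^sub>m Y) $$ (x,y) * cnj (K s j y))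
       = a * (\<Sum>s\<in>I. \<Sum>x<n. \<Sum>y<n. K s i x * X $$ (x,y) * cnj (K s j y))
       + b * (\<Sum>s\<in>I. \<Sum>x<n. \<Sum>y<n. K s i x * Y $$ (x,y) * cnj (K s j y))" for i j
      unfolding sum_distrib_left sum.distrib[symmetric]
      by (intro sum.cong refl) (use X Y in \<open>simp add: carrier_matD algebra_simps\<close>)
    then show ?thesis
      by (intro eq_matI) (auto simp: kraus_apply[OF K X] kraus_apply[OF K Y] kraus_apply[OF K c])
  qed
  show "mtrace (\<Phi> X) = mtrace X" if X: "X \<in> carrier_mat n n" for X
  proof -
    have "mtrace (\<Phi> X) = (\<Sum>i<n. \<Sum>s\<in>I. \<Sum>x<n. \<Sum>y<n. K s i x * X $$ (x,y) * cnj (K s i y))"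
      by (simp add: mtrace_def kraus_apply[OF K X])
    also have "\<dots> = (\<Sum>x<n. \<Sum>y<n. \<Sum>s\<in>I. \<Sum>i<n. K s i x * X $$ (x,y) * cnj (K s i y))"
      unfolding sum.cartesian_product
      by (rule sum.reindex_bij_witness[where i = "\<lambda>(x,y,s,i). (i,s,x,y)" and j = "\<lambda>(i,s,x,y). (x,y,s,i)"]) auto
    also have "\<dots> = (\<Sum>x<n. \<Sum>y<n. X $$ (x,y) * of_bool (x = y))"
    proof (intro sum.cong refl)
      fix x y assume "x \<in> {..<n}" "y \<in> {..<n}"
      then have t: "(\<Sum>s\<in>I. \<Sum>i<n. cnj (K s i y) * K s i x) = of_bool (x = y)" using tp by simp
      show "(\<Sum>s\<in>I. \<Sum>i<n. K s i x * X $$ (x,y) * cnj (K s i y)) = X $$ (x,y) * of_bool (x = y)"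
        unfolding t[symmetric] sum_distrib_left by (intro sum.cong refl) (simp add: algebra_simps)
    qed
    also have "\<dots> = mtrace X"
      unfolding mtrace_def using X by (intro sum.cong) (auto simp: sum_single)
    finally show ?thesis .
  qed
  show "psd (superop_tensor n r \<Phi> (\<lambda>Y. Y) X)" if "X \<in> carrier_mat (n * r) (n * r)" "psd X" for r X
    using kraus_psd[OF kraus_tensor[OF K kraus_id] that] .
qed

lemma cptp_id: "cptp n n (\<lambda>X. X)"
proof (rule kraus_cptp[OF kraus_id])
  fix x y assume "x < n"
  then have "(\<Sum>i<n. cnj (of_bool (i = y)) * of_bool (i = x)) = (of_bool (x = y) :: complex)"
    by (subst sum_single[of _ x]) auto
  then show "(\<Sum>s\<in>{()}. \<Sum>i<n. cnj (of_bool (i = y)) * of_bool (i = x)) = (of_bool (x = y) :: complex)"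
    by (simp only: sum.insert finite.emptyI empty_iff not_False_eq_True sum.empty add_0_right)
qed

lemma kraus_tensor_list_id:
  assumes "\<And>p. p \<in> set ps \<Longrightarrow> snd p = (\<lambda>X. X)"
  shows "kraus (\<Prod>p\<leftarrow>ps. fst p) {()} (\<lambda>_ x y. of_bool (x = y)) (superop_tensor_list ps)"
  using assms
proof (induction ps)
  case Nil
  show ?case by (simp add: kraus_id)
next
  case (Cons p ps)
  obtain d \<Phi> where p: "p = (d, \<Phi>)" by fastforce
  let ?m = "\<Prod>p\<leftarrow>ps. fst p"
  have \<Phi>: "\<Phi> = (\<lambda>X. X)" using Cons.prems[of p] p by simp
  have "kraus ?m {()} (\<lambda>_ x y. of_bool (x = y)) (superop_tensor_list ps)"
    using Cons by auto
  from kraus_tensor[OF kraus_id this, of d]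
  have k: "kraus (d * ?m) ({()} \<times> {()}) (\<lambda>(s,t) x y. of_bool (x div ?m = y div ?m) * of_bool (x mod ?m = y mod ?m))
      (superop_tensor_list (p # ps))" by (simp add: p \<Phi>)
  have "(x div ?m = y div ?m \<and> x mod ?m = y mod ?m) = (x = y)" for x y
    by (metis div_mult_mod_eq)
  then have "kraus (d * ?m) {()} (\<lambda>_ x y. of_bool (x = y)) (superop_tensor_list (p # ps))"
    by (intro kraus_reindex[OF k, of "\<lambda>s. (s,s)"])
      (auto simp: bij_betw_def simp flip: of_bool_conj)
  then show ?case by (simp add: p)
qed

text \<open>An index has three digits: \<open>x div (dA * dR)\<close> for the shares before A,
  \<open>x mod (dA * dR) div dR\<close> for A, and \<open>x mod dR\<close> for the shares after it.
  The operators are \<open>K s\<close> on the middle digit and the identity on the outer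
  two.\<close>

lemma kraus_tensor_list:
  assumes K: "kraus dA I K \<Phi>" and post: "\<And>p. p \<in> set post \<Longrightarrow> snd p = (\<lambda>X. X)"
    and pre: "\<And>p. p \<in> set pre \<Longrightarrow> snd p = (\<lambda>X. X)"
  defines "dR \<equiv> \<Prod>p\<leftarrow>post. fst p"
  shows "kraus ((\<Prod>p\<leftarrow>pre. fst p) * (dA * dR)) I
    (\<lambda>s x y. of_bool (x div (dA * dR) = y div (dA * dR)) *
       (of_bool (x mod dR = y mod dR) * K s (x mod (dA * dR) div dR) (y mod (dA * dR) div dR)))
    (superop_tensor_list (pre @ (dA, \<Phi>) # post))"
  using pre
proof (induction pre)
  case Nil
  from kraus_tensor[OF K kraus_tensor_list_id[OF post]]
  have k: "kraus (dA * dR) (I \<times> {()}) (\<lambda>(s,t) x y. K s (x div dR) (y div dR) * of_bool (x mod dR = y mod dR))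
     (superop_tensor_list ((dA, \<Phi>) # post))" by (simp add: dR_def)
  have "bij_betw (\<lambda>s. (s,())) I (I \<times> {()})" by (auto simp: bij_betw_def inj_on_def)
  from kraus_reindex[OF k this] show ?case by simp
next
  case (Cons p ps)
  obtain d \<Phi>' where p: "p = (d, \<Phi>')" by fastforce
  have \<Phi>': "\<Phi>' = (\<lambda>X. X)" using Cons.prems[of p] p by simp
  let ?l = "\<Prod>p\<leftarrow>ps. fst p"
  let ?m = "?l * (dA * dR)"
  let ?K = "\<lambda>s x y. of_bool (x div (dA * dR) = y div (dA * dR)) *
       (of_bool (x mod dR = y mod dR) * K s (x mod (dA * dR) div dR) (y mod (dA * dR) div dR))"
  have pl: "(\<Prod>p\<leftarrow>ps @ (dA, \<Phi>) # post. fst p) = ?m" by (simp add: dR_def)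
  have "kraus ?m I ?K (superop_tensor_list (ps @ (dA, \<Phi>) # post))" using Cons by auto
  from kraus_tensor[OF kraus_id this, of d]
  have k: "kraus (d * ?m) ({()} \<times> I) (\<lambda>(t,s) x y. of_bool (x div ?m = y div ?m) * ?K s (x mod ?m) (y mod ?m))
      (superop_tensor_list (p # ps @ (dA, \<Phi>) # post))"
    by (simp only: p \<Phi>' superop_tensor_list.simps pl)
  \<comment> \<open>A further factor on the left only splits the left digit in two; these identities
    show that the two comparisons recombine into one.\<close>
  have 1: "x div ?m = x div (dA * dR) div ?l" for x
    by (metis div_mult2_eq mult.commute)
  have 2: "x mod ?m div (dA * dR) = x div (dA * dR) mod ?l" for x
  proof (cases "dA * dR = 0")
    case False
    then show ?thesis by (subst mult.commute, subst mod_mult2_eq) simp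
  qed auto
  have 3: "x mod ?m mod (dA * dR) = x mod (dA * dR)" for x
    by (simp add: mod_mod_cancel)
  have 4: "x mod ?m mod dR = x mod dR" for x
    by (simp add: mod_mod_cancel)
  have 5: "(u div ?l = v div ?l \<and> u mod ?l = v mod ?l) = (u = v)" for u v
    by (metis div_mult_mod_eq)
  have "of_bool (x div (dA * dR) = y div (dA * dR))
      = of_bool (x div (dA * dR) div ?l = y div (dA * dR) div ?l) * (of_bool (x div (dA * dR) mod ?l = y div (dA * dR) mod ?l) :: complex)" for x y
    using 5 by (simp flip: of_bool_conj)
  then have "kraus (d * ?m) I ?K (superop_tensor_list (p # ps @ (dA, \<Phi>) # post))"
    by (intro kraus_reindex[OF k, of "\<lambda>s. ((),s)"]) (simp_all only: 1 2 3 4 case_prod_conv mult.assoc, auto simp: bij_betw_def inj_on_def)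
  then show ?case by (simp add: p mult.assoc)
qed

section \<open>Effects of a decoder and separable states\<close>

text \<open>The adjoint of the decoder applied to |m><m|. The indices of \<open>ketbra\<close> are
  transposed so that <m|\<Phi>(X)|m> is the trace of X times the effect.\<close>

definition effect :: "nat \<Rightarrow> (cmat \<Rightarrow> cmat) \<Rightarrow> nat \<Rightarrow> nat \<Rightarrow> nat \<Rightarrow> complex" where
  "effect N \<Phi> m x y = \<Phi> (ketbra N y x) $$ (m,m)"

text \<open>Linearity is available for two summands only, so the expansion grows by one matrix entry
  at a time: \<open>R S\<close> keeps the entries of \<open>X\<close> in \<open>S\<close> and sets
  the others to 0.\<close>

lemma cptp_expand:
  assumes \<Phi>: "cptp N D \<Phi>" and X: "X \<in> carrier_mat N N" and ij: "i < D" "j < D"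
  shows "\<Phi> X $$ (i,j) = (\<Sum>x<N. \<Sum>y<N. X $$ (x,y) * \<Phi> (ketbra N x y) $$ (i,j))"
proof -
  have car: "\<Phi> Y \<in> carrier_mat D D" if "Y \<in> carrier_mat N N" for Y
    using \<Phi> that by (simp add: cptp_def)
  have lin: "\<Phi> (a \<cdot>\<^sub>m Y + b \<cdot>\<^sub>m Z) $$ (i,j) = a * \<Phi> Y $$ (i,j) + b * \<Phi> Z $$ (i,j)"
    if "Y \<in> carrier_mat N N" "Z \<in> carrier_mat N N" for a b Y Z
  proof -
    have "\<Phi> (a \<cdot>\<^sub>m Y + b \<cdot>\<^sub>m Z) = a \<cdot>\<^sub>m \<Phi> Y + b \<cdot>\<^sub>m \<Phi> Z" using \<Phi> that by (simp add: cptp_def)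
    then show ?thesis using car[OF that(1)] car[OF that(2)] ij by (simp add: carrier_matD)
  qed
  define R where "R = (\<lambda>S. mat N N (\<lambda>p. if p \<in> S then X $$ p else 0))"
  have R: "R S \<in> carrier_mat N N" for S by (simp add: R_def)
  have on_set: "\<Phi> (R S) $$ (i,j) = (\<Sum>(x,y)\<in>S. X $$ (x,y) * \<Phi> (ketbra N x y) $$ (i,j))"
    if "finite S" "S \<subseteq> {..<N} \<times> {..<N}" for S
    using that
  proof (induction S rule: finite_induct)
    case empty
    \<comment> \<open>Writing the zero matrix as a trivial combination makes linearity yield that
      its image vanishes.\<close>
    have "0 \<cdot>\<^sub>m R {} + 0 \<cdot>\<^sub>m R {} = R {}" by (rule eq_matI) (auto simp: R_def)
    then show ?case using lin[OF R R, of 0 "{}" 0 "{}"] by simp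
  next
    case (insert p S)
    obtain x y where p: "p = (x,y)" by fastforce
    have "1 \<cdot>\<^sub>m R S + X $$ (x,y) \<cdot>\<^sub>m ketbra N x y = R (insert p S)"
      using insert.hyps(2) by (intro eq_matI) (auto simp: R_def p)
    then show ?case using lin[OF R ketbra_carrier, of 1 S "X $$ (x,y)" x y] insert by (simp add: p)
  qed
  have "\<Phi> (R ({..<N} \<times> {..<N})) $$ (i,j) = (\<Sum>(x,y)\<in>{..<N} \<times> {..<N}. X $$ (x,y) * \<Phi> (ketbra N x y) $$ (i,j))"
    by (rule on_set) auto
  moreover have "R ({..<N} \<times> {..<N}) = X" using X by (intro eq_matI) (auto simp: R_def)
  ultimately show ?thesis by (simp add: sum.cartesian_product)
qed

text \<open>Positivity is complete positivity with a one-dimensional ancilla.\<close>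

lemma cptp_psd:
  assumes \<Phi>: "cptp N D \<Phi>" and X: "X \<in> carrier_mat N N" "psd X"
  shows "psd (\<Phi> X)"
proof -
  have car: "\<Phi> Y \<in> carrier_mat D D" if "Y \<in> carrier_mat N N" for Y
    using \<Phi> that by (simp add: cptp_def)
  have d: "dim_row (\<Phi> (ketbra N a b)) = D" "dim_col (\<Phi> (ketbra N a b)) = D" for a b
    using car[OF ketbra_carrier] by auto
  have "X \<in> carrier_mat (N * 1) (N * 1)" using X by simp
  with \<Phi> X(2) have "psd (superop_tensor N 1 \<Phi> (\<lambda>Y. Y) X)" unfolding cptp_def by blast
  also have "superop_tensor N 1 \<Phi> (\<lambda>Y. Y) X = \<Phi> X"
    using car[OF X(1)]
    by (intro eq_matI) (auto simp: superop_tensor_def Let_def d kron_def cptp_expand[OF \<Phi> X(1)])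
  finally show ?thesis .
qed

text \<open>Turns an outcome probability into a sum of values of a quadratic form. Encodings are
  handled in this shape so that the product vectors of a separable state become visible.\<close>

lemma effect_gram:
  assumes \<Phi>: "cptp N D \<Phi>" and X: "X \<in> carrier_mat N N" and m: "m < D"
    and g: "\<And>x y. x < N \<Longrightarrow> y < N \<Longrightarrow> X $$ (x,y) = (\<Sum>j\<in>J. f j x * cnj (f j y))"
  shows "\<Phi> X $$ (m,m) = (\<Sum>j\<in>J. sf N (effect N \<Phi> m) (f j) (f j))"
proof -
  have "\<Phi> X $$ (m,m) = (\<Sum>x<N. \<Sum>y<N. \<Sum>j\<in>J. f j x * cnj (f j y) * effect N \<Phi> m y x)"
    unfolding cptp_expand[OF \<Phi> X m m]
    by (intro sum.cong refl) (simp add: g effect_def sum_distrib_right)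
  also have "\<dots> = (\<Sum>j\<in>J. \<Sum>y<N. \<Sum>x<N. f j x * cnj (f j y) * effect N \<Phi> m y x)"
    unfolding sum.cartesian_product
    by (rule sum.reindex_bij_witness[where i = "\<lambda>(j,y,x). (x,y,j)" and j = "\<lambda>(x,y,j). (j,y,x)"]) auto
  also have "\<dots> = (\<Sum>j\<in>J. sf N (effect N \<Phi> m) (f j) (f j))"
    unfolding sf_def by (intro sum.cong refl) (simp add: algebra_simps)
  finally show ?thesis .
qed

definition outer :: "nat \<Rightarrow> (nat \<Rightarrow> complex) \<Rightarrow> cmat" where
  "outer N w = mat N N (\<lambda>(x,y). w x * cnj (w y))"

lemma outer_carrier [simp]: "outer N w \<in> carrier_mat N N"
  by (simp add: outer_def)

lemma effect_outer:
  assumes "cptp N D \<Phi>" "m < D"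
  shows "sf N (effect N \<Phi> m) w w = \<Phi> (outer N w) $$ (m,m)"
  using effect_gram[OF assms(1) outer_carrier assms(2), where J = "{()}" and f = "\<lambda>_. w"] by (simp add: outer_def)

lemma psd_outer: "psd (outer N w)"
proof -
  have "sf N (\<lambda>x y. outer N w $$ (x,y)) v v = complex_of_real ((cmod (ip N v w))\<^sup>2)" for v
  proof -
    have "sf N (\<lambda>x y. outer N w $$ (x,y)) v v = ip N v w * ip N w v"
      unfolding ip_def sum_product sf_def by (intro sum.cong refl) (simp add: outer_def)
    also have "\<dots> = ip N v w * cnj (ip N v w)" by (subst (2) ip_cnj) simp
    finally show ?thesis by (simp only: complex_norm_square)
  qed
  then show ?thesis unfolding psd_iff_pos[OF outer_carrier] by (rule posI) simp
qed

lemma effect_pos: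
  assumes \<Phi>: "cptp N D \<Phi>" and m: "m < D"
  shows "pos N (effect N \<Phi> m)"
proof -
  have c: "\<Phi> (outer N w) \<in> carrier_mat D D" for w using \<Phi> by (simp add: cptp_def)
  have "pos D (\<lambda>i j. \<Phi> (outer N w) $$ (i,j))" for w
    using cptp_psd[OF \<Phi> outer_carrier psd_outer] psd_iff_pos[OF c] by blast
  then have "0 \<le> Re (\<Phi> (outer N w) $$ (m,m)) \<and> Im (\<Phi> (outer N w) $$ (m,m)) = 0" for w
    using pos_diag m by blast
  then show ?thesis
    by (intro posI[of _ _ "\<lambda>w. Re (\<Phi> (outer N w) $$ (m,m))"]) (auto simp: effect_outer[OF assms] complex_eq_iff)
qed

text \<open>Trace preservation of the decoder says that its effects sum to the identity.\<close>

lemma effect_sum: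
  assumes \<Phi>: "cptp N D \<Phi>"
  shows "(\<Sum>m<D. Re (sf N (effect N \<Phi> m) w w)) = (\<Sum>x<N. (cmod (w x))\<^sup>2)"
proof -
  have "\<Phi> (outer N w) \<in> carrier_mat D D" using \<Phi> by (simp add: cptp_def)
  then have "(\<Sum>m<D. sf N (effect N \<Phi> m) w w) = mtrace (\<Phi> (outer N w))"
    by (simp add: effect_outer[OF \<Phi>] mtrace_def)
  also have "\<dots> = mtrace (outer N w)" using \<Phi> by (simp add: cptp_def)
  also have "\<dots> = complex_of_real (\<Sum>x<N. (cmod (w x))\<^sup>2)"
    by (simp only: mtrace_def of_real_sum complex_norm_square) (simp add: outer_def)
  finally show ?thesis by (metis Re_complex_of_real Re_sum)
qed

text \<open>A Kraus map sends Gram vectors to Gram vectors: the new ones are \<open>K s\<close>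
  applied to \<open>f j\<close>.\<close>

lemma kraus_gram:
  assumes K: "kraus n I K \<Phi>" and X: "X \<in> carrier_mat n n"
    and g: "\<And>x y. x < n \<Longrightarrow> y < n \<Longrightarrow> X $$ (x,y) = (\<Sum>j\<in>J. f j x * cnj (f j y))"
    and a: "a < n" and b: "b < n"
  shows "\<Phi> X $$ (a,b) = (\<Sum>(s,j)\<in>I \<times> J. (\<Sum>x<n. K s a x * f j x) * cnj (\<Sum>x<n. K s b x * f j x))"
proof -
  have "\<Phi> X $$ (a,b) = (\<Sum>s\<in>I. \<Sum>x<n. \<Sum>y<n. \<Sum>j\<in>J. K s a x * f j x * cnj (K s b y * f j y))"
    using a b by (simp add: kraus_apply[OF K X] g sum_distrib_left sum_distrib_right algebra_simps)
  also have "\<dots> = (\<Sum>s\<in>I. \<Sum>j\<in>J. \<Sum>x<n. \<Sum>y<n. K s a x * f j x * cnj (K s b y * f j y))"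
    unfolding sum.cartesian_product
    by (rule sum.reindex_bij_witness[where i = "\<lambda>(s,j,x,y). (s,x,y,j)" and j = "\<lambda>(s,x,y,j). (s,j,x,y)"]) auto
  also have "\<dots> = (\<Sum>(s,j)\<in>I \<times> J. (\<Sum>x<n. K s a x * f j x) * cnj (\<Sum>x<n. K s b x * f j x))"
    by (simp only: cnj_sum sum_product sum.cartesian_product[symmetric])
  finally show ?thesis .
qed

lemma psd_gram:
  assumes A: "A \<in> carrier_mat n n" and p: "psd A"
  obtains f where "\<And>x y. x < n \<Longrightarrow> y < n \<Longrightarrow> A $$ (x,y) = (\<Sum>c<n. f c x * cnj (f c y))"
proof -
  obtain B where B: "B \<in> carrier_mat n n" "psd B" "B * B = A" using psd_sqrt_exists[OF A p] by blast
  have pB: "pos n (\<lambda>i j. B $$ (i,j))" using B psd_iff_pos by blast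
  have "A $$ (x,y) = (\<Sum>c<n. B $$ (x,c) * cnj (B $$ (y,c)))" if xy: "x < n" "y < n" for x y
  proof -
    have "A $$ (x,y) = (\<Sum>c<n. B $$ (x,c) * B $$ (c,y))"
      unfolding B(3)[symmetric] using xy B(1) by (simp add: scalar_prod_def atLeast0LessThan)
    also have "\<dots> = (\<Sum>c<n. B $$ (x,c) * cnj (B $$ (y,c)))"
      by (intro sum.cong refl) (use pos_hermitian[OF pB _ xy(2)] in simp)
    finally show ?thesis .
  qed
  then show ?thesis by (rule that[of "\<lambda>c x. B $$ (x,c)"])
qed

section \<open>Gram vectors and digits of Kronecker products\<close>

definition square_psd :: "cmat \<Rightarrow> bool" where
  "square_psd A \<longleftrightarrow> dim_row A = dim_col A \<and> psd A"

lemma kron_list_dim: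
  assumes "\<And>A. A \<in> set As \<Longrightarrow> square_psd A"
  shows "dim_row (kron_list As) = prod_list (map dim_row As) \<and> dim_col (kron_list As) = prod_list (map dim_row As)"
  using assms by (induction As) (auto simp: kron_def square_psd_def)

lemma index_div: "b < m \<Longrightarrow> (a * m + b) div m = a" for a b m :: nat
  by simp

text \<open>Products of Gram vectors of the factors do it; their label \<open>c\<close> is split
  into digits in the same way as the index \<open>x\<close>.\<close>

lemma kron_list_gram:
  assumes "\<And>A. A \<in> set As \<Longrightarrow> square_psd A"
  shows "\<exists>f. \<forall>x<prod_list (map dim_row As). \<forall>y<prod_list (map dim_row As).
     kron_list As $$ (x,y) = (\<Sum>c<prod_list (map dim_row As). f c x * cnj (f c y))"
  using assms
proof (induction As)
  case Nil
  show ?case by (intro exI[of _ "\<lambda>_ _. 1"]) simp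
next
  case (Cons A As)
  let ?n = "dim_row A" and ?m = "prod_list (map dim_row As)"
  have A: "A \<in> carrier_mat ?n ?n" "psd A" using Cons.prems[of A] by (auto simp: square_psd_def)
  have sq: "dim_col A = dim_row A" using Cons.prems[of A] by (simp add: square_psd_def)
  obtain f where f: "\<And>x y. x < ?n \<Longrightarrow> y < ?n \<Longrightarrow> A $$ (x,y) = (\<Sum>c<?n. f c x * cnj (f c y))"
    using psd_gram[OF A] by blast
  obtain g where g: "\<And>x y. x < ?m \<Longrightarrow> y < ?m \<Longrightarrow> kron_list As $$ (x,y) = (\<Sum>c<?m. g c x * cnj (g c y))"
    using Cons by auto
  have dk: "dim_row (kron_list As) = ?m" "dim_col (kron_list As) = ?m"
    using kron_list_dim[of As] Cons.prems by auto
  define h where "h = (\<lambda>c x. f (c div ?m) (x div ?m) * g (c mod ?m) (x mod ?m))"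
  have "kron_list (A # As) $$ (x,y) = (\<Sum>c<?n * ?m. h c x * cnj (h c y))"
    if xy: "x < ?n * ?m" "y < ?n * ?m" for x y
  proof -
    have m: "0 < ?m" using xy by (cases "?m = 0") auto
    have d: "x div ?m < ?n" "y div ?m < ?n" "x mod ?m < ?m" "y mod ?m < ?m"
      using xy m by (auto simp: less_mult_imp_div_less)
    have "kron_list (A # As) $$ (x,y) = A $$ (x div ?m, y div ?m) * kron_list As $$ (x mod ?m, y mod ?m)"
      using xy sq by (simp add: kron_def dk)
    also have "\<dots> = (\<Sum>a<?n. \<Sum>b<?m. f a (x div ?m) * cnj (f a (y div ?m)) * (g b (x mod ?m) * cnj (g b (y mod ?m))))"
      using d by (simp only: f g sum_product)
    also have "\<dots> = (\<Sum>c<?n * ?m. h c x * cnj (h c y))"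
    proof -
      have "h (a * ?m + b) z = f a (z div ?m) * g b (z mod ?m)" if "b < ?m" for a b z
        using that index_div[OF that] by (simp add: h_def)
      then show ?thesis unfolding sum_index_split by (intro sum.cong refl) (simp add: mult_ac)
    qed
    finally show ?thesis .
  qed
  then show ?case by (intro exI[of _ h]) simp
qed

lemma index_arith:
  fixes x l M d :: nat
  shows "x div (l * M) = x div M div l" "x mod (l * M) div M = x div M mod l"
    "x mod (l * M) mod M = x mod M" "x mod (l * (d * M)) mod M = x mod M"
proof -
  show "x div (l * M) = x div M div l" by (metis div_mult2_eq mult.commute)
  show "x mod (l * M) div M = x div M mod l"
  proof (cases "M = 0")
    case False
    then show ?thesis by (subst mult.commute, subst mod_mult2_eq) simp
  qed auto
  show "x mod (l * M) mod M = x mod M" "x mod (l * (d * M)) mod M = x mod M" by (simp_all add: mod_mod_cancel)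
qed

text \<open>Singles out one factor with the three digits that \<open>kraus_tensor_list\<close> uses,
  so that states and tampering share one indexing.\<close>

lemma kron_list_split:
  assumes "\<And>B. B \<in> set (pre @ A # post) \<Longrightarrow> square_psd B"
  defines "dR \<equiv> prod_list (map dim_row post)"
  assumes "x < prod_list (map dim_row (pre @ A # post))" "y < prod_list (map dim_row (pre @ A # post))"
  shows "kron_list (pre @ A # post) $$ (x,y) =
    kron_list pre $$ (x div (dim_row A * dR), y div (dim_row A * dR))
    * (A $$ (x mod (dim_row A * dR) div dR, y mod (dim_row A * dR) div dR) * kron_list post $$ (x mod dR, y mod dR))"
  using assms(1,3,4)
proof (induction pre arbitrary: x y)
  case Nil
  have "dim_row (kron_list post) = dR \<and> dim_col (kron_list post) = dR"
    unfolding dR_def by (rule kron_list_dim) (use Nil in auto)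
  then show ?case using Nil by (auto simp: kron_def square_psd_def dR_def)
next
  case (Cons p ps)
  let ?M = "dim_row A * dR" and ?l = "prod_list (map dim_row ps)"
  have pl: "prod_list (map dim_row (ps @ A # post)) = ?l * ?M" by (simp add: dR_def)
  have dk: "dim_row (kron_list (ps @ A # post)) = ?l * ?M \<and> dim_col (kron_list (ps @ A # post)) = ?l * ?M"
    unfolding pl[symmetric] by (rule kron_list_dim) (use Cons in auto)
  have dp: "dim_row (kron_list ps) = ?l \<and> dim_col (kron_list ps) = ?l"
    by (rule kron_list_dim) (use Cons in auto)
  have sp: "dim_col p = dim_row p" using Cons.prems(1)[of p] by (auto simp: square_psd_def)
  have xy: "x < dim_row p * (?l * ?M)" "y < dim_row p * (?l * ?M)" using Cons.prems(2,3) by (simp_all add: dR_def)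
  then have pos: "0 < ?l * ?M" by (cases "?l * ?M = 0") auto
  have xyM: "x div ?M < dim_row p * ?l" "y div ?M < dim_row p * ?l"
    using xy by (auto simp: less_mult_imp_div_less mult.assoc)
  have xyl: "x mod (?l * ?M) < ?l * ?M" "y mod (?l * ?M) < ?l * ?M" using pos by auto
  have kp: "kron_list (p # ps) $$ (u,v) = p $$ (u div ?l, v div ?l) * kron_list ps $$ (u mod ?l, v mod ?l)"
    if "u < dim_row p * ?l" "v < dim_row p * ?l" for u v
    using that by (simp add: kron_def dp sp)
  note kp = kp[OF xyM]
  have "kron_list ((p # ps) @ A # post) $$ (x,y) = p $$ (x div (?l * ?M), y div (?l * ?M))
     * kron_list (ps @ A # post) $$ (x mod (?l * ?M), y mod (?l * ?M))"
    using xy by (simp add: kron_def dk sp)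
  also have "kron_list (ps @ A # post) $$ (x mod (?l * ?M), y mod (?l * ?M))
     = kron_list ps $$ (x mod (?l * ?M) div ?M, y mod (?l * ?M) div ?M)
     * (A $$ (x mod (?l * ?M) mod ?M div dR, y mod (?l * ?M) mod ?M div dR)
        * kron_list post $$ (x mod (?l * ?M) mod dR, y mod (?l * ?M) mod dR))"
  proof (rule Cons.IH)
    show "square_psd B" if "B \<in> set (ps @ A # post)" for B using Cons.prems(1) that by auto
  qed (unfold pl, (fact xyl)+)
  also have "p $$ (x div (?l * ?M), y div (?l * ?M)) * \<dots> = kron_list (p # ps) $$ (x div ?M, y div ?M)
     * (A $$ (x mod ?M div dR, y mod ?M div dR) * kron_list post $$ (x mod dR, y mod dR))"
    by (simp only: kp index_arith(1-3)[of _ ?l ?M] index_arith(4)[of _ ?l "dim_row A" dR] mult.assoc)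
  finally show ?case .
qed

section \<open>Bipartite product vectors\<close>

definition nrm2 :: "nat \<Rightarrow> (nat \<Rightarrow> complex) \<Rightarrow> real" where
  "nrm2 n v = (\<Sum>a<n. (cmod (v a))\<^sup>2)"

definition mat_app :: "nat \<Rightarrow> (nat \<Rightarrow> nat \<Rightarrow> complex) \<Rightarrow> (nat \<Rightarrow> complex) \<Rightarrow> nat \<Rightarrow> complex" where
  "mat_app n M v = (\<lambda>a. \<Sum>b<n. M a b * v b)"

definition qf :: "nat \<Rightarrow> (nat \<Rightarrow> nat \<Rightarrow> complex) \<Rightarrow> (nat \<Rightarrow> complex) \<Rightarrow> real" where
  "qf n M v = Re (sf n M v v)"

lemma nrm2_nonneg: "0 \<le> nrm2 n v"
  by (simp add: nrm2_def sum_nonneg)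

lemma qf_nonneg: "pos n M \<Longrightarrow> 0 \<le> qf n M v"
  by (simp add: qf_def posD)

lemma sf_cong: "(\<And>i. i < n \<Longrightarrow> u i = u' i) \<Longrightarrow> (\<And>i. i < n \<Longrightarrow> v i = v' i) \<Longrightarrow> sf n M u v = sf n M u' v'"
  unfolding sf_def by (intro sum.cong refl) simp

lemma qf_cong: "(\<And>i. i < n \<Longrightarrow> v i = v' i) \<Longrightarrow> qf n M v = qf n M v'"
  unfolding qf_def using sf_cong[of n v v' v v' M] by simp

lemma qf_scale: "qf n M (\<lambda>a. c * v a) = (cmod c)\<^sup>2 * qf n M v"
proof -
  have "sf n M (\<lambda>a. c * v a) (\<lambda>a. c * v a) = complex_of_real ((cmod c)\<^sup>2) * sf n M v v"
    unfolding sf_scale_left sf_scale_right complex_norm_square by simp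
  then show ?thesis by (simp add: qf_def)
qed

lemma nrm2_scale: "nrm2 n (\<lambda>a. c * v a) = (cmod c)\<^sup>2 * nrm2 n v"
  by (simp add: nrm2_def norm_mult power_mult_distrib sum_distrib_left)

text \<open>The parallelogram law with the nonnegative term at u - v discarded. It stands in for a
  commutation of the form with the projections that split the vector.\<close>

lemma qf_split:
  assumes "pos n M"
  shows "qf n M (\<lambda>a. u a + v a) \<le> 2 * qf n M u + 2 * qf n M v"
proof -
  have "sf n M (\<lambda>a. u a + v a) (\<lambda>a. u a + v a) + sf n M (\<lambda>a. u a + (- 1) * v a) (\<lambda>a. u a + (- 1) * v a)
      = 2 * sf n M u u + 2 * sf n M v v"
    unfolding sf_add_left sf_add_right sf_scale_left sf_scale_right by simp
  then have "qf n M (\<lambda>a. u a + v a) + qf n M (\<lambda>a. u a + (- 1) * v a) = 2 * qf n M u + 2 * qf n M v"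
    unfolding qf_def by (drule_tac arg_cong[of _ _ Re]) simp
  then show ?thesis using qf_nonneg[OF assms, of "\<lambda>a. u a + (- 1) * v a"] by linarith
qed

text \<open>\<open>P\<close> projects onto the eigenvalues of \<open>F\<close> that are at least
  \<open>\<theta>\<close>, \<open>Q\<close> onto the others; in eigenbasis coordinates each clause
  holds term by term. The first clause has the shape of the trace-preservation condition in
  \<open>kraus_cptp\<close>.\<close>

lemma spectral_projection:
  assumes F: "pos n F"
  obtains P Q where
    "\<And>x y. x < n \<Longrightarrow> y < n \<Longrightarrow> (\<Sum>i<n. cnj (P i y) * P i x) + (\<Sum>i<n. cnj (Q i y) * Q i x) = of_bool (x = y)"
    "\<And>u a. a < n \<Longrightarrow> u a = mat_app n P u a + mat_app n Q u a"
    "\<And>u. nrm2 n u = nrm2 n (mat_app n P u) + nrm2 n (mat_app n Q u)"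
    "\<And>u. \<theta> * nrm2 n (mat_app n P u) \<le> qf n F u"
    "\<And>u. qf n F (mat_app n Q u) \<le> \<theta> * nrm2 n (mat_app n Q u)"
proof -
  obtain e l where e: "orthonormal n e" and l: "\<And>k. k < n \<Longrightarrow> 0 \<le> l k"
    and Fe: "\<And>a b. a < n \<Longrightarrow> b < n \<Longrightarrow> F a b = (\<Sum>k<n. complex_of_real (l k) * e k a * cnj (e k b))"
    by (rule pos_spectral[OF F]) blast
  define T where "T = (\<lambda>(S::nat set) a b. \<Sum>k<n. of_bool (k \<in> S) * e k a * cnj (e k b))"
  define S where "S = {k. \<theta> \<le> l k}"
  have appT: "mat_app n (T R) u a = (\<Sum>k<n. of_bool (k \<in> R) * ip n (e k) u * e k a)" for R u a
  proof -
    have "mat_app n (T R) u a = (\<Sum>b<n. \<Sum>k<n. of_bool (k \<in> R) * e k a * cnj (e k b) * u b)"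
      by (simp only: mat_app_def T_def sum_distrib_right)
    also have "\<dots> = (\<Sum>k<n. \<Sum>b<n. of_bool (k \<in> R) * e k a * cnj (e k b) * u b)" by (rule sum.swap)
    finally show ?thesis by (simp add: ip_def sum_distrib_left sum_distrib_right mult_ac)
  qed
  have ipT: "ip n (e k) (mat_app n (T R) u) = of_bool (k \<in> R) * ip n (e k) u" if "k < n" for k R u
  proof -
    have "ip n (e k) (mat_app n (T R) u) = (\<Sum>j<n. of_bool (j \<in> R) * ip n (e j) u * ip n (e k) (e j))"
      unfolding appT ip_sum_right ip_scale_right ..
    also have "\<dots> = of_bool (k \<in> R) * ip n (e k) u * ip n (e k) (e k)"
      using e that by (subst sum_single[of _ k]) (auto simp: orthonormal_def)
    finally show ?thesis using e that by (simp add: orthonormal_def)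
  qed
  have nrm: "nrm2 n u = (\<Sum>k<n. (cmod (ip n (e k) u))\<^sup>2)" for u
    unfolding nrm2_def using parseval[OF e, of u] by simp
  have qF: "qf n F u = (\<Sum>k<n. l k * (cmod (ip n (e k) u))\<^sup>2)" for u
  proof -
    have "sf n F u u = sf n (\<lambda>a b. \<Sum>k<n. complex_of_real (l k) * e k a * cnj (e k b)) u u"
      unfolding sf_def by (intro sum.cong refl) (simp add: Fe)
    then show ?thesis by (simp only: qf_def sf_rank_one_sum Re_complex_of_real)
  qed
  \<comment> \<open>\<open>T R\<close> is a self-adjoint idempotent.\<close>
  have TT: "(\<Sum>i<n. cnj (T R i y) * T R i x) = T R y x" for R x y
  proof -
    have col: "T R i x = mat_app n (T R) (\<lambda>z. of_bool (z = x)) i" if "x < n" for i x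
      using that unfolding mat_app_def by (subst sum_single[of _ x]) auto
    have "(\<Sum>i<n. cnj (T R i y) * T R i x)
       = (\<Sum>k<n. \<Sum>j<n. of_bool (k \<in> R) * of_bool (j \<in> R) * e k y * cnj (e j x) * ip n (e k) (e j))"
    proof -
      have "(\<Sum>i<n. cnj (T R i y) * T R i x)
         = (\<Sum>i<n. \<Sum>k<n. \<Sum>j<n. of_bool (k \<in> R) * of_bool (j \<in> R) * e k y * cnj (e j x) * (cnj (e k i) * e j i))"
        unfolding T_def cnj_sum sum_product by (intro sum.cong refl) (simp add: mult_ac)
      also have "\<dots> = (\<Sum>k<n. \<Sum>j<n. \<Sum>i<n. of_bool (k \<in> R) * of_bool (j \<in> R) * e k y * cnj (e j x) * (cnj (e k i) * e j i))"
        unfolding sum.cartesian_product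
        by (rule sum.reindex_bij_witness[where i = "\<lambda>(k,j,i). (i,k,j)" and j = "\<lambda>(i,k,j). (k,j,i)"]) auto
      finally show ?thesis by (simp only: ip_def sum_distrib_left)
    qed
    also have "\<dots> = (\<Sum>k<n. of_bool (k \<in> R) * e k y * cnj (e k x))"
    proof (intro sum.cong refl)
      fix k assume k: "k \<in> {..<n}"
      show "(\<Sum>j<n. of_bool (k \<in> R) * of_bool (j \<in> R) * e k y * cnj (e j x) * ip n (e k) (e j))
         = of_bool (k \<in> R) * e k y * cnj (e k x)"
        using e k by (subst sum_single[of _ k]) (auto simp: orthonormal_def)
    qed
    finally show ?thesis by (simp add: T_def)
  qed
  have compl: "T S a b + T (- S) a b = of_bool (a = b)" if "a < n" "b < n" for a b
  proof -
    have "T S a b + T (- S) a b = (\<Sum>k<n. e k a * cnj (e k b))"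
      unfolding T_def sum.distrib[symmetric] by (intro sum.cong refl) auto
    then show ?thesis using orthonormal_complete[OF e that] by simp
  qed
  show ?thesis
  proof
    show "(\<Sum>i<n. cnj (T S i y) * T S i x) + (\<Sum>i<n. cnj (T (- S) i y) * T (- S) i x) = of_bool (x = y)"
      if "x < n" "y < n" for x y
      unfolding TT using compl[OF that(2,1)] by (simp add: eq_commute)
    show "u a = mat_app n (T S) u a + mat_app n (T (- S)) u a" if "a < n" for u a
    proof -
      have "mat_app n (T S) u a + mat_app n (T (- S)) u a = (\<Sum>b<n. of_bool (a = b) * u b)"
        unfolding mat_app_def sum.distrib[symmetric] distrib_right[symmetric]
        by (intro sum.cong refl) (use compl that in simp)
      also have "\<dots> = u a" using that by (subst sum_single[of _ a]) auto
      finally show ?thesis by simp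
    qed
    show "nrm2 n u = nrm2 n (mat_app n (T S) u) + nrm2 n (mat_app n (T (- S)) u)" for u
      unfolding nrm sum.distrib[symmetric]
      by (intro sum.cong refl) (auto simp: ipT)
    show "\<theta> * nrm2 n (mat_app n (T S) u) \<le> qf n F u" for u
      unfolding nrm qF sum_distrib_left
    proof (intro sum_mono)
      fix k assume "k \<in> {..<n}"
      then show "\<theta> * (cmod (ip n (e k) (mat_app n (T S) u)))\<^sup>2 \<le> l k * (cmod (ip n (e k) u))\<^sup>2"
        using l[of k] by (auto simp: ipT S_def intro: mult_right_mono)
    qed
    show "qf n F (mat_app n (T (- S)) u) \<le> \<theta> * nrm2 n (mat_app n (T (- S)) u)" for u
      unfolding nrm qF sum_distrib_left
    proof (intro sum_mono)
      fix k assume "k \<in> {..<n}"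
      then show "l k * (cmod (ip n (e k) (mat_app n (T (- S)) u)))\<^sup>2 \<le> \<theta> * (cmod (ip n (e k) (mat_app n (T (- S)) u)))\<^sup>2"
        by (auto simp: ipT S_def intro: mult_right_mono)
    qed
  qed
qed

text \<open>The largest share may stand anywhere in the list, so the split into A and B is given by
  coordinate maps instead of a tensor order.\<close>

locale bipartition =
  fixes N dA dB :: nat and fA fB :: "nat \<Rightarrow> nat"
  assumes bij: "bij_betw (\<lambda>x. (fA x, fB x)) {..<N} ({..<dA} \<times> {..<dB})"
begin

definition idx :: "nat \<Rightarrow> nat \<Rightarrow> nat" where
  "idx a b = inv_into {..<N} (\<lambda>x. (fA x, fB x)) (a,b)"

definition prod_vec :: "(nat \<Rightarrow> complex) \<Rightarrow> (nat \<Rightarrow> complex) \<Rightarrow> nat \<Rightarrow> complex" where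
  "prod_vec u v x = u (fA x) * v (fB x)"

text \<open>The partial trace over B.\<close>

definition reduced :: "(nat \<Rightarrow> nat \<Rightarrow> complex) \<Rightarrow> nat \<Rightarrow> nat \<Rightarrow> complex" where
  "reduced E a a' = (\<Sum>b<dB. E (idx a b) (idx a' b))"

text \<open>The operator \<open>K\<close> on A tensor the identity on B.\<close>

definition lift :: "(nat \<Rightarrow> nat \<Rightarrow> complex) \<Rightarrow> nat \<Rightarrow> nat \<Rightarrow> complex" where
  "lift K x y = of_bool (fB x = fB y) * K (fA x) (fA y)"

lemma f_bound: "x < N \<Longrightarrow> fA x < dA \<and> fB x < dB"
  using bij by (auto simp: bij_betw_def)

lemma idx: "a < dA \<Longrightarrow> b < dB \<Longrightarrow> idx a b < N \<and> fA (idx a b) = a \<and> fB (idx a b) = b"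
proof -
  assume "a < dA" "b < dB"
  then have ab: "(a,b) \<in> (\<lambda>x. (fA x, fB x)) ` {..<N}" using bij by (auto simp: bij_betw_def)
  show ?thesis using inv_into_into[OF ab] f_inv_into_f[OF ab] by (auto simp: idx_def)
qed

lemma idx_f: "x < N \<Longrightarrow> idx (fA x) (fB x) = x"
  using bij inv_into_f_f[of "\<lambda>x. (fA x, fB x)" "{..<N}" x] by (simp add: idx_def bij_betw_def)

lemma sum_N: "(\<Sum>x<N. g x) = (\<Sum>a<dA. \<Sum>b<dB. g (idx a b))"
proof -
  have "(\<Sum>x<N. g x) = (\<Sum>x<N. (\<lambda>(a,b). g (idx a b)) (fA x, fB x))"
    by (intro sum.cong refl) (simp add: idx_f)
  also have "\<dots> = (\<Sum>(a,b)\<in>{..<dA} \<times> {..<dB}. g (idx a b))"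
    by (rule sum.reindex_bij_betw[OF bij])
  finally show ?thesis by (simp add: sum.cartesian_product)
qed

lemma nrm2_prod_vec: "nrm2 N (prod_vec u v) = nrm2 dA u * nrm2 dB v"
  unfolding nrm2_def sum_N sum_product
  by (intro sum.cong refl) (simp add: prod_vec_def idx norm_mult power_mult_distrib)

lemma mat_app_lift: "x < N \<Longrightarrow> mat_app N (lift K) (prod_vec u v) x = prod_vec (mat_app dA K u) v x"
proof -
  assume x: "x < N"
  have "mat_app N (lift K) (prod_vec u v) x = (\<Sum>a<dA. \<Sum>b<dB. of_bool (fB x = b) * K (fA x) a * (u a * v b))"
    unfolding mat_app_def sum_N by (intro sum.cong refl) (simp add: lift_def prod_vec_def idx)
  also have "\<dots> = (\<Sum>a<dA. K (fA x) a * (u a * v (fB x)))"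
    by (intro sum.cong refl) (use f_bound[OF x] in \<open>subst sum_single[of _ "fB x"], auto\<close>)
  finally show ?thesis by (simp add: mat_app_def prod_vec_def sum_distrib_right mult.assoc)
qed

lemma qf_mat_app_lift: "qf N E (mat_app N (lift K) (prod_vec u v)) = qf N E (prod_vec (mat_app dA K u) v)"
  by (rule qf_cong) (rule mat_app_lift)

lemma qf_reduced: "qf dA (reduced E) u = (\<Sum>b<dB. qf N E (prod_vec u (\<lambda>y. of_bool (y = b))))"
proof -
  have "sf N E (prod_vec u (\<lambda>y. of_bool (y = b))) (prod_vec u (\<lambda>y. of_bool (y = b)))
     = (\<Sum>a<dA. \<Sum>a'<dA. cnj (u a) * E (idx a b) (idx a' b) * u a')" if "b < dB" for b
    unfolding sf_def sum_N
  proof (rule sum.cong[OF refl])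
    fix a assume a: "a \<in> {..<dA}"
    have "(\<Sum>y<dB. \<Sum>a'<dA. \<Sum>y'<dB. cnj (prod_vec u (\<lambda>y. of_bool (y = b)) (idx a y)) * E (idx a y) (idx a' y') * prod_vec u (\<lambda>y. of_bool (y = b)) (idx a' y'))
       = (\<Sum>y<dB. \<Sum>a'<dA. \<Sum>y'<dB. of_bool (y = b) * of_bool (y' = b) * (cnj (u a) * E (idx a y) (idx a' y') * u a'))"
      by (intro sum.cong refl) (use a in \<open>simp add: prod_vec_def idx\<close>)
    also have "\<dots> = (\<Sum>a'<dA. \<Sum>y'<dB. of_bool (y' = b) * (cnj (u a) * E (idx a b) (idx a' y') * u a'))"
      using that by (subst sum_single[of _ b]) auto
    also have "\<dots> = (\<Sum>a'<dA. cnj (u a) * E (idx a b) (idx a' b) * u a')"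
      by (intro sum.cong refl) (use that in \<open>subst sum_single[of _ b], auto\<close>)
    finally show "(\<Sum>y<dB. \<Sum>a'<dA. \<Sum>y'<dB. cnj (prod_vec u (\<lambda>y. of_bool (y = b)) (idx a y)) * E (idx a y) (idx a' y') * prod_vec u (\<lambda>y. of_bool (y = b)) (idx a' y'))
      = (\<Sum>a'<dA. cnj (u a) * E (idx a b) (idx a' b) * u a')" .
  qed
  then have "(\<Sum>b<dB. qf N E (prod_vec u (\<lambda>y. of_bool (y = b)))) = Re (\<Sum>b<dB. \<Sum>a<dA. \<Sum>a'<dA. cnj (u a) * E (idx a b) (idx a' b) * u a')"
    by (simp add: qf_def)
  also have "(\<Sum>b<dB. \<Sum>a<dA. \<Sum>a'<dA. cnj (u a) * E (idx a b) (idx a' b) * u a')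
     = (\<Sum>a<dA. \<Sum>a'<dA. \<Sum>b<dB. cnj (u a) * E (idx a b) (idx a' b) * u a')"
    unfolding sum.cartesian_product
    by (rule sum.reindex_bij_witness[where i = "\<lambda>(a,a',b). (b,a,a')" and j = "\<lambda>(b,a,a'). (a,a',b)"]) auto
  also have "\<dots> = sf dA (reduced E) u u"
    by (simp add: sf_def reduced_def sum_distrib_left sum_distrib_right)
  finally show ?thesis by (simp add: qf_def)
qed

text \<open>For fixed \<open>u\<close> the left-hand side is a positive form in \<open>v\<close>, and \<open>qf dA (reduced E) u\<close> is its trace.\<close>

lemma qf_prod_vec_le:
  assumes E: "pos N E"
  shows "qf N E (prod_vec u v) \<le> nrm2 dB v * qf dA (reduced E) u"
proof -
  define M where "M = (\<lambda>b b'. \<Sum>a<dA. \<Sum>a'<dA. cnj (u a) * E (idx a b) (idx a' b') * u a')"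
  have sfM: "sf N E (prod_vec u w) (prod_vec u w) = sf dB M w w" for w
  proof -
    have "sf N E (prod_vec u w) (prod_vec u w) = (\<Sum>a<dA. \<Sum>b<dB. \<Sum>a'<dA. \<Sum>b'<dB. cnj (w b) * (cnj (u a) * E (idx a b) (idx a' b') * u a') * w b')"
      unfolding sf_def sum_N by (intro sum.cong refl) (simp add: prod_vec_def idx mult_ac)
    also have "\<dots> = (\<Sum>b<dB. \<Sum>b'<dB. \<Sum>a<dA. \<Sum>a'<dA. cnj (w b) * (cnj (u a) * E (idx a b) (idx a' b') * u a') * w b')"
      unfolding sum.cartesian_product
      by (rule sum.reindex_bij_witness[where i = "\<lambda>(b,b',a,a'). (a,b,a',b')" and j = "\<lambda>(a,b,a',b'). (b,b',a,a')"]) auto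
    finally show ?thesis by (simp add: sf_def M_def sum_distrib_left sum_distrib_right)
  qed
  have pM: "pos dB M"
    by (rule posI[of _ _ "\<lambda>w. qf N E (prod_vec u w)"]) (use pos_real[OF E] qf_nonneg[OF E] in \<open>auto simp: qf_def simp flip: sfM\<close>)
  have "Re (M b b) = qf N E (prod_vec u (\<lambda>y. of_bool (y = b)))" if "b < dB" for b
    unfolding qf_def sfM using sf_delta[OF that that, of M] by simp
  then have "(\<Sum>b<dB. Re (M b b)) = qf dA (reduced E) u"
    by (simp add: qf_reduced)
  then show ?thesis
    using pos_le_trace[OF pM, of v] by (simp add: qf_def sfM nrm2_def)
qed

text \<open>Nonnegativity is visible in \<open>qf_reduced\<close>; that the form has no imaginary
  part comes from hermiticity of \<open>E\<close>, inherited by the partial trace.\<close>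

lemma pos_reduced:
  assumes "pos N E"
  shows "pos dA (reduced E)"
proof (rule posI)
  show "sf dA (reduced E) v v = complex_of_real (qf dA (reduced E) v)" for v
  proof -
    have "Im (sf dA (reduced E) v v) = 0"
    proof -
      have h: "reduced E a a' = cnj (reduced E a' a)" if "a < dA" "a' < dA" for a a'
        unfolding reduced_def cnj_sum
        by (intro sum.cong refl pos_hermitian[OF assms]) (use that idx in auto)
      have "cnj (sf dA (reduced E) v v) = (\<Sum>a<dA. \<Sum>a'<dA. cnj (v a') * reduced E a' a * v a)"
        unfolding sf_def cnj_sum
      proof (intro sum.cong refl)
        fix a a' assume "a \<in> {..<dA}" "a' \<in> {..<dA}"
        then have "cnj (reduced E a a') = reduced E a' a" using h[of a' a] by simp
        then show "cnj (cnj (v a) * reduced E a a' * v a') = cnj (v a') * reduced E a' a * v a" by simp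
      qed
      also have "\<dots> = sf dA (reduced E) v v" unfolding sf_def by (rule sum.swap)
      finally show ?thesis by (simp add: complex_eq_iff)
    qed
    then show ?thesis by (simp add: qf_def complex_eq_iff)
  qed
  show "0 \<le> qf dA (reduced E) v" for v
    unfolding qf_reduced by (intro sum_nonneg qf_nonneg assms)
qed

lemma nrm2_unit: "b < n \<Longrightarrow> nrm2 n (\<lambda>y. of_bool (y = b)) = 1"
  unfolding nrm2_def by (subst sum_single[of _ b]) auto

text \<open>The partial trace of the identity is \<open>dB\<close> times the identity. Divided by
  the number of messages, this is the average that makes a typical message unlikely.\<close>

lemma sum_qf_reduced:
  assumes "\<And>w. (\<Sum>m\<in>D. qf N (E m) w) = nrm2 N w"
  shows "(\<Sum>m\<in>D. qf dA (reduced (E m)) u) = dB * nrm2 dA u"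
proof -
  have "(\<Sum>m\<in>D. qf dA (reduced (E m)) u) = (\<Sum>b<dB. \<Sum>m\<in>D. qf N (E m) (prod_vec u (\<lambda>y. of_bool (y = b))))"
    unfolding qf_reduced by (rule sum.swap)
  also have "\<dots> = (\<Sum>b<dB. nrm2 dA u)"
    unfolding assms nrm2_prod_vec by (intro sum.cong refl) (simp add: nrm2_unit)
  finally show ?thesis by simp
qed

end

section \<open>Two tampering attacks\<close>

lemma exists_le_average:
  fixes f :: "'a \<Rightarrow> real"
  assumes "finite A" "A \<noteq> {}" "sum f A \<le> c"
  shows "\<exists>a\<in>A. f a \<le> c / card A"
proof (rule ccontr)
  assume "\<not> ?thesis"
  then have "\<forall>a\<in>A. c / card A < f a" by (meson not_le)
  then have "(\<Sum>a\<in>A. c / card A) < sum f A" by (intro sum_strict_mono) (use assms in auto)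
  moreover have "(\<Sum>a\<in>A. c / card A) = c" using assms(1,2) by simp
  ultimately show False using assms(3) by simp
qed

text \<open>The encoding of \<open>m\<close> is the sum over \<open>j\<close> in \<open>J m\<close>
  of the projectors onto the unnormalized product vectors \<open>U m j\<close> tensor
  \<open>V m j\<close>, with the mixture weights absorbed. \<open>normalized\<close> is its unit
  trace, \<open>decodes\<close> the perfect decoding.\<close>

locale code_family = bipartition N dA dB fA fB for N dA dB fA fB +
  fixes D :: nat and E :: "nat \<Rightarrow> nat \<Rightarrow> nat \<Rightarrow> complex"
    and J :: "nat \<Rightarrow> 'j set" and U V :: "nat \<Rightarrow> 'j \<Rightarrow> nat \<Rightarrow> complex"
  assumes E_pos: "\<And>m. m < D \<Longrightarrow> pos N (E m)"
    and E_sum: "\<And>w. (\<Sum>m<D. qf N (E m) w) = nrm2 N w"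
    and J_fin: "\<And>m. finite (J m)"
    and normalized: "\<And>m. m < D \<Longrightarrow> (\<Sum>j\<in>J m. nrm2 dA (U m j) * nrm2 dB (V m j)) = 1"
    and decodes: "\<And>m. m < D \<Longrightarrow> (\<Sum>j\<in>J m. qf N (E m) (prod_vec (U m j) (V m j))) = 1"
begin

text \<open>The probability that message \<open>m\<close>, tampered on A by the operators
  \<open>K s\<close>, is decoded as \<open>i\<close>.\<close>

definition response :: "'s set \<Rightarrow> ('s \<Rightarrow> nat \<Rightarrow> nat \<Rightarrow> complex) \<Rightarrow> nat \<Rightarrow> nat \<Rightarrow> real" where
  "response I K m i = (\<Sum>s\<in>I. \<Sum>j\<in>J m. qf N (E i) (prod_vec (mat_app dA (K s) (U m j)) (V m j)))"

lemma E_nonneg: "m < D \<Longrightarrow> 0 \<le> qf N (E m) w"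
  by (rule qf_nonneg[OF E_pos])

lemma E_le: "M \<subseteq> {..<D} \<Longrightarrow> (\<Sum>m\<in>M. qf N (E m) w) \<le> nrm2 N w"
  unfolding E_sum[symmetric] by (intro sum_mono2) (use E_nonneg in auto)

lemma E_le1: "m < D \<Longrightarrow> qf N (E m) w \<le> nrm2 N w"
  using E_le[of "{m}" w] by simp

text \<open>Perfect decoding of \<open>m\<close> forces its effect to have trace at least 1, and the
  traces add up to \<open>N\<close>. This bounds the rate by 1.\<close>

lemma messages_le: "D \<le> N"
proof -
  have d: "qf N (E m) (\<lambda>y. of_bool (y = x)) = Re (E m x x)" if "x < N" for m x
    using sf_delta[OF that that, of "E m"] by (simp add: qf_def)
  have "real D = (\<Sum>m<D. \<Sum>j\<in>J m. qf N (E m) (prod_vec (U m j) (V m j)))"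
    using decodes by simp
  also have "\<dots> \<le> (\<Sum>m<D. \<Sum>j\<in>J m. nrm2 N (prod_vec (U m j) (V m j)) * (\<Sum>x<N. Re (E m x x)))"
    by (intro sum_mono) (use pos_le_trace[OF E_pos] in \<open>auto simp: qf_def nrm2_def\<close>)
  also have "\<dots> = (\<Sum>m<D. \<Sum>x<N. Re (E m x x))"
    using normalized by (simp add: nrm2_prod_vec flip: sum_distrib_right)
  also have "\<dots> = (\<Sum>x<N. \<Sum>m<D. qf N (E m) (\<lambda>y. of_bool (y = x)))"
    by (subst sum.swap) (simp add: d)
  also have "\<dots> = real N" unfolding E_sum by (simp add: nrm2_unit)
  finally show ?thesis by simp
qed

text \<open>The rejected part has weight at most 1/8 for the effect, so \<open>qf_split\<close>
  gives 1 \<le> 2 w + 2/8 for the accepted weight w.\<close>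

lemma projected_weight:
  assumes m: "m < D"
    and PQ: "\<And>u a. a < dA \<Longrightarrow> u a = mat_app dA P u a + mat_app dA Q u a"
      "\<And>u. nrm2 dA u = nrm2 dA (mat_app dA P u) + nrm2 dA (mat_app dA Q u)"
    and Q: "\<And>u. qf dA (reduced (E m)) (mat_app dA Q u) \<le> 1 / 8 * nrm2 dA (mat_app dA Q u)"
  shows "3 / 8 \<le> (\<Sum>j\<in>J m. qf N (E m) (prod_vec (mat_app dA P (U m j)) (V m j)))"
proof -
  have "qf N (E m) (prod_vec u v) \<le> 2 * qf N (E m) (prod_vec (mat_app dA P u) v) + 1 / 4 * (nrm2 dA u * nrm2 dB v)" for u v
  proof -
    have "qf N (E m) (prod_vec u v) = qf N (E m) (\<lambda>x. prod_vec (mat_app dA P u) v x + prod_vec (mat_app dA Q u) v x)"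
      by (rule qf_cong) (use PQ(1)[of _ u] f_bound in \<open>simp add: prod_vec_def flip: distrib_right\<close>)
    also have "\<dots> \<le> 2 * qf N (E m) (prod_vec (mat_app dA P u) v) + 2 * qf N (E m) (prod_vec (mat_app dA Q u) v)"
      by (rule qf_split[OF E_pos[OF m]])
    also have "qf N (E m) (prod_vec (mat_app dA Q u) v) \<le> nrm2 dB v * qf dA (reduced (E m)) (mat_app dA Q u)"
      by (rule qf_prod_vec_le[OF E_pos[OF m]])
    also have "\<dots> \<le> nrm2 dB v * (1 / 8 * nrm2 dA u)"
      using Q[of u] PQ(2)[of u] nrm2_nonneg[of dA "mat_app dA P u"] by (intro mult_left_mono nrm2_nonneg) linarith
    finally show ?thesis by (simp add: algebra_simps)
  qed
  then have "(\<Sum>j\<in>J m. qf N (E m) (prod_vec (U m j) (V m j)))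
      \<le> (\<Sum>j\<in>J m. 2 * qf N (E m) (prod_vec (mat_app dA P (U m j)) (V m j)) + 1 / 4 * (nrm2 dA (U m j) * nrm2 dB (V m j)))"
    by (intro sum_mono)
  also have "\<dots> = 2 * (\<Sum>j\<in>J m. qf N (E m) (prod_vec (mat_app dA P (U m j)) (V m j))) + 1 / 4"
    by (simp only: sum.distrib sum_distrib_left[symmetric] normalized[OF m] mult_1_right)
  finally show ?thesis using decodes[OF m] by simp
qed

text \<open>The message m0 survives with probability at least 3/8 while m1 is seldom decoded as
  either of the two. Both decoded values matter: a large \<open>p\<close> would show at m1, a
  constant output m0 would show as m1 turning into m0.\<close>

lemma keep_or_erase:
  assumes dA: "0 < dA" and dB: "0 < dB" and large: "81 * dB \<le> D"
  obtains m0 m1 and I :: "(unit + nat) set" and K where "m0 < D" "m1 < D" "m0 \<noteq> m1" "finite I"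
    "\<And>x y. x < dA \<Longrightarrow> y < dA \<Longrightarrow> (\<Sum>s\<in>I. \<Sum>i<dA. cnj (K s i y) * K s i x) = of_bool (x = y)"
    "3 / 8 \<le> response I K m0 m0" "response I K m1 m1 + response I K m1 m0 \<le> 1 / 8"
proof -
  define e0 where "e0 = (\<lambda>a::nat. of_bool (a = 0) :: complex)"
  \<comment> \<open>An upper bound for the probability that the decoder announces \<open>m\<close>
    after A was reset to \<open>e0\<close>.\<close>
  define f where "f = (\<lambda>m. qf dA (reduced (E m)) e0)"
  have "(\<Sum>m<D. f m) = dB"
    unfolding f_def sum_qf_reduced[OF E_sum] e0_def using nrm2_unit[OF dA] by simp
  then obtain m1 where m1: "m1 < D" and f1: "f m1 \<le> dB / D"
    using exists_le_average[of "{..<D}" f dB] large dB by force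
  \<comment> \<open>The expectation of the reduced effect of \<open>m\<close> in the A-marginal of
    the encoding of m1.\<close>
  define G where "G = (\<lambda>m. \<Sum>j\<in>J m1. nrm2 dB (V m1 j) * qf dA (reduced (E m)) (U m1 j))"
  have "(\<Sum>m<D. G m) = (\<Sum>j\<in>J m1. nrm2 dB (V m1 j) * (dB * nrm2 dA (U m1 j)))"
    unfolding G_def sum_qf_reduced[OF E_sum, symmetric] sum_distrib_left by (rule sum.swap)
  also have "\<dots> = dB * (\<Sum>j\<in>J m1. nrm2 dA (U m1 j) * nrm2 dB (V m1 j))"
    by (simp add: sum_distrib_left mult_ac)
  finally have G: "(\<Sum>m<D. G m) = dB" using normalized[OF m1] by simp
  have f_nn: "0 \<le> f m" if "m < D" for m
    unfolding f_def by (rule qf_nonneg[OF pos_reduced[OF E_pos[OF that]]])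
  have G_nn: "0 \<le> G m" if "m < D" for m
    unfolding G_def by (intro sum_nonneg mult_nonneg_nonneg nrm2_nonneg qf_nonneg pos_reduced E_pos that)
  \<comment> \<open>The factor 8 is the inverse of the threshold: acceptance of m1 costs at most
    \<open>8 * G m0\<close>. One average over the sum controls both quantities for the same
    m0.\<close>
  have "(\<Sum>m\<in>{..<D} - {m1}. f m + 8 * G m) \<le> (\<Sum>m<D. f m + 8 * G m)"
    by (intro sum_mono2) (use f_nn G_nn in auto)
  also have "\<dots> = 9 * dB"
    using G \<open>(\<Sum>m<D. f m) = dB\<close> by (simp add: sum.distrib flip: sum_distrib_left)
  finally have "\<exists>m\<in>{..<D} - {m1}. f m + 8 * G m \<le> 9 * dB / card ({..<D} - {m1})"
  proof (intro exists_le_average)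
    have "card ({..<D} - {m1}) = D - 1" using m1 by simp
    moreover have "81 \<le> D" using large dB by linarith
    ultimately show "{..<D} - {m1} \<noteq> {}" by force
  qed auto
  then obtain m0 where m0: "m0 < D" "m0 \<noteq> m1" and fG: "f m0 + 8 * G m0 \<le> 9 * dB / (real D - 1)"
    using m1 by (auto simp: of_nat_diff)
  obtain P Q where
      tp: "\<And>x y. x < dA \<Longrightarrow> y < dA \<Longrightarrow> (\<Sum>i<dA. cnj (P i y) * P i x) + (\<Sum>i<dA. cnj (Q i y) * Q i x) = of_bool (x = y)"
    and PQ: "\<And>u a. a < dA \<Longrightarrow> u a = mat_app dA P u a + mat_app dA Q u a"
    and pyth: "\<And>u. nrm2 dA u = nrm2 dA (mat_app dA P u) + nrm2 dA (mat_app dA Q u)"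
    and P: "\<And>u. 1 / 8 * nrm2 dA (mat_app dA P u) \<le> qf dA (reduced (E m0)) u"
    and Q: "\<And>u. qf dA (reduced (E m0)) (mat_app dA Q u) \<le> 1 / 8 * nrm2 dA (mat_app dA Q u)"
    by (rule spectral_projection[OF pos_reduced[OF E_pos[OF m0(1)]], of "1 / 8"]) blast
  \<comment> \<open>The left summand keeps the accepted vector; label \<open>b\<close> on the right
    moves coordinate \<open>b\<close> of the rejected vector to \<open>e0\<close>, so that together
    these labels reset A.\<close>
  define K where "K = case_sum (\<lambda>_::unit. P) (\<lambda>b i x. e0 i * Q b x)"
  define I where "I = {()} <+> {..<dA}"
  have tpK: "(\<Sum>s\<in>I. \<Sum>i<dA. cnj (K s i y) * K s i x) = of_bool (x = y)" if "x < dA" "y < dA" for x y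
  proof -
    have "(\<Sum>i<dA. cnj (e0 i * Q b y) * (e0 i * Q b x)) = cnj (Q b y) * Q b x" for b
      using dA by (subst sum_single[of _ 0]) (auto simp: e0_def)
    then show ?thesis using tp[OF that] by (simp add: I_def K_def sum.Plus)
  qed
  have resp: "response I K m i = (\<Sum>j\<in>J m. qf N (E i) (prod_vec (mat_app dA P (U m j)) (V m j)))
      + (\<Sum>j\<in>J m. nrm2 dA (mat_app dA Q (U m j)) * qf N (E i) (prod_vec e0 (V m j)))" for m i
  proof -
    have "qf N (E i) (prod_vec (mat_app dA (\<lambda>i x. e0 i * Q b x) u) v) = (cmod (mat_app dA Q u b))\<^sup>2 * qf N (E i) (prod_vec e0 v)" for b u v
    proof -
      have "prod_vec (mat_app dA (\<lambda>i x. e0 i * Q b x) u) v = (\<lambda>x. mat_app dA Q u b * prod_vec e0 v x)"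
        by (auto simp: prod_vec_def mat_app_def sum_distrib_left sum_distrib_right mult_ac)
      then show ?thesis by (simp add: qf_scale)
    qed
    then have "response I K m i = (\<Sum>j\<in>J m. qf N (E i) (prod_vec (mat_app dA P (U m j)) (V m j)))
       + (\<Sum>b<dA. \<Sum>j\<in>J m. (cmod (mat_app dA Q (U m j) b))\<^sup>2 * qf N (E i) (prod_vec e0 (V m j)))"
      by (simp add: response_def I_def K_def sum.Plus)
    also have "(\<Sum>b<dA. \<Sum>j\<in>J m. (cmod (mat_app dA Q (U m j) b))\<^sup>2 * qf N (E i) (prod_vec e0 (V m j)))
        = (\<Sum>j\<in>J m. nrm2 dA (mat_app dA Q (U m j)) * qf N (E i) (prod_vec e0 (V m j)))"
      by (subst sum.swap) (simp add: nrm2_def sum_distrib_right)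
    finally show ?thesis .
  qed
  have erase: "(\<Sum>j\<in>J m1. nrm2 dA (mat_app dA Q (U m1 j)) * qf N (E i) (prod_vec e0 (V m1 j))) \<le> f i" if "i < D" for i
  proof -
    have "(\<Sum>j\<in>J m1. nrm2 dA (mat_app dA Q (U m1 j)) * qf N (E i) (prod_vec e0 (V m1 j)))
       \<le> (\<Sum>j\<in>J m1. nrm2 dA (U m1 j) * (nrm2 dB (V m1 j) * f i))"
    proof (intro sum_mono mult_mono)
      fix j
      show "nrm2 dA (mat_app dA Q (U m1 j)) \<le> nrm2 dA (U m1 j)"
        using pyth[of "U m1 j"] nrm2_nonneg[of dA "mat_app dA P (U m1 j)"] by simp
      show "qf N (E i) (prod_vec e0 (V m1 j)) \<le> nrm2 dB (V m1 j) * f i"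
        unfolding f_def by (rule qf_prod_vec_le[OF E_pos[OF that]])
    qed (use nrm2_nonneg E_nonneg that in auto)
    also have "\<dots> = f i" using normalized[OF m1] by (simp flip: mult.assoc sum_distrib_right)
    finally show ?thesis .
  qed
  have "3 / 8 \<le> (\<Sum>j\<in>J m0. qf N (E m0) (prod_vec (mat_app dA P (U m0 j)) (V m0 j)))"
    by (rule projected_weight[OF m0(1) PQ pyth Q])
  also have "\<dots> \<le> response I K m0 m0"
    unfolding resp by (simp add: sum_nonneg nrm2_nonneg E_nonneg m0)
  finally have 1: "3 / 8 \<le> response I K m0 m0" .
  \<comment> \<open>The two effects belong to one measurement, so their joint weight is at most the
    squared norm, which the threshold bounds by 8 times the reduced effect.\<close>
  have "(\<Sum>j\<in>J m1. qf N (E m1) (prod_vec (mat_app dA P (U m1 j)) (V m1 j))) + (\<Sum>j\<in>J m1. qf N (E m0) (prod_vec (mat_app dA P (U m1 j)) (V m1 j)))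
     \<le> (\<Sum>j\<in>J m1. 8 * (nrm2 dB (V m1 j) * qf dA (reduced (E m0)) (U m1 j)))"
    unfolding sum.distrib[symmetric]
  proof (intro sum_mono)
    fix j
    let ?w = "prod_vec (mat_app dA P (U m1 j)) (V m1 j)"
    have "qf N (E m1) ?w + qf N (E m0) ?w \<le> nrm2 N ?w"
      using E_le[of "{m0,m1}" ?w] m0 m1 by simp
    also have "\<dots> \<le> 8 * qf dA (reduced (E m0)) (U m1 j) * nrm2 dB (V m1 j)"
      unfolding nrm2_prod_vec using P[of "U m1 j"] by (intro mult_right_mono nrm2_nonneg) simp
    finally show "qf N (E m1) ?w + qf N (E m0) ?w \<le> 8 * (nrm2 dB (V m1 j) * qf dA (reduced (E m0)) (U m1 j))"
      by (simp add: mult_ac)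
  qed
  also have "\<dots> = 8 * G m0" by (simp add: G_def sum_distrib_left)
  finally have "response I K m1 m1 + response I K m1 m0 \<le> 8 * G m0 + f m1 + f m0"
    unfolding resp using erase[OF m1] erase[OF m0(1)] by simp
  also have "\<dots> \<le> dB / D + 9 * dB / (real D - 1)" using f1 fG by simp
  \<comment> \<open>The sum 1/81 + 9/80 lies just below 1/8. The denominator 80 arises since m0 is
    chosen among D - 1 messages and \<open>dB\<close> is at least 1.\<close>
  also have "\<dots> \<le> 1 / 81 + 9 / 80"
  proof -
    have l: "81 * real dB \<le> real D" "1 \<le> real dB" using large dB by linarith+
    then have "dB / D \<le> 1 / 81" by (simp add: field_simps)
    moreover have "9 * dB / (real D - 1) \<le> 9 / 80" using l by (simp add: field_simps)
    ultimately show ?thesis by linarith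
  qed
  finally have 2: "response I K m1 m1 + response I K m1 m0 \<le> 1 / 8" by simp
  show ?thesis
    by (rule that[OF m0(1) m1 m0(2) _ tpK 1 2]) (simp add: I_def)
qed

text \<open>With B trivial the tampering sees the whole codeword and can prepare a fresh one.
  Acceptance by the test for message 0 is answered with an encoding of 1, rejection with an encoding
  of 0.\<close>

lemma swap_messages:
  assumes dA: "0 < dA" and dB: "dB = 1" and D: "2 \<le> D"
  obtains I :: "('j \<times> nat + 'j \<times> nat) set" and K where "finite I"
    "\<And>x y. x < dA \<Longrightarrow> y < dA \<Longrightarrow> (\<Sum>s\<in>I. \<Sum>i<dA. cnj (K s i y) * K s i x) = of_bool (x = y)"
    "3 / 8 \<le> response I K 0 1" "1 \<le> response I K 1 0"
proof -
  have D01: "0 < D" "1 < D" using D by auto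
  obtain P Q where
      tp: "\<And>x y. x < dA \<Longrightarrow> y < dA \<Longrightarrow> (\<Sum>i<dA. cnj (P i y) * P i x) + (\<Sum>i<dA. cnj (Q i y) * Q i x) = of_bool (x = y)"
    and PQ: "\<And>u a. a < dA \<Longrightarrow> u a = mat_app dA P u a + mat_app dA Q u a"
    and pyth: "\<And>u. nrm2 dA u = nrm2 dA (mat_app dA P u) + nrm2 dA (mat_app dA Q u)"
    and P: "\<And>u. 1 / 8 * nrm2 dA (mat_app dA P u) \<le> qf dA (reduced (E 0)) u"
    and Q: "\<And>u. qf dA (reduced (E 0)) (mat_app dA Q u) \<le> 1 / 8 * nrm2 dA (mat_app dA Q u)"
    by (rule spectral_projection[OF pos_reduced[OF E_pos[OF D01(1)]], of "1 / 8"]) blast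
  have nB: "nrm2 dB v = (cmod (v 0))\<^sup>2" for v using dB by (simp add: nrm2_def)
  \<comment> \<open>With \<open>dB = 1\<close> the second factor is a scalar; absorbing it makes
    \<open>S m c\<close> a complete Gram vector of the encoding of \<open>m\<close>.\<close>
  define S where "S = (\<lambda>m c a. U m c a * V m c 0)"
  have nS: "(\<Sum>c\<in>J m. nrm2 dA (S m c)) = 1" if "m < D" for m
  proof -
    have "nrm2 dA (S m c) = nrm2 dA (U m c) * nrm2 dB (V m c)" for c
      using nrm2_scale[of dA "V m c 0" "U m c"] by (simp add: S_def nB mult.commute)
    then show ?thesis using normalized[OF that] by simp
  qed
  define K where "K = case_sum (\<lambda>(c,b) i x. S 1 c i * P b x) (\<lambda>(c,b) i x. S 0 c i * Q b x)"
  define I where "I = (J 1 \<times> {..<dA}) <+> (J 0 \<times> {..<dA})"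
  \<comment> \<open>Preparing a state of unit trace preserves the trace, so only the measurement
    operators remain.\<close>
  have prep: "(\<Sum>s\<in>J m \<times> {..<dA}. \<Sum>i<dA. cnj ((\<lambda>(c,b) i x. S m c i * R b x) s i y) * (\<lambda>(c,b) i x. S m c i * R b x) s i x)
     = (\<Sum>b<dA. cnj (R b y) * R b x)" if "m < D" for m R x y
  proof -
    have "(\<Sum>i<dA. cnj (S m c i * R b y) * (S m c i * R b x)) = complex_of_real (nrm2 dA (S m c)) * (cnj (R b y) * R b x)" for c b
    proof -
      have "complex_of_real (nrm2 dA (S m c)) = (\<Sum>i<dA. S m c i * cnj (S m c i))"
        by (simp only: nrm2_def of_real_sum complex_norm_square)
      then show ?thesis
        by (simp only: sum_distrib_right) (intro sum.cong refl, simp add: mult_ac)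
    qed
    then have "(\<Sum>s\<in>J m \<times> {..<dA}. \<Sum>i<dA. cnj ((\<lambda>(c,b) i x. S m c i * R b x) s i y) * (\<lambda>(c,b) i x. S m c i * R b x) s i x)
       = (\<Sum>c\<in>J m. \<Sum>b<dA. complex_of_real (nrm2 dA (S m c)) * (cnj (R b y) * R b x))"
      by (subst sum.cartesian_product) (auto intro!: sum.cong)
    also have "\<dots> = complex_of_real (\<Sum>c\<in>J m. nrm2 dA (S m c)) * (\<Sum>b<dA. cnj (R b y) * R b x)"
      by (simp add: sum_product)
    finally show ?thesis using nS[OF that] by simp
  qed
  have tpK: "(\<Sum>s\<in>I. \<Sum>i<dA. cnj (K s i y) * K s i x) = of_bool (x = y)" if "x < dA" "y < dA" for x y
    using tp[OF that] prep[OF D01(1), of Q y x] prep[OF D01(2), of P y x] J_fin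
    by (simp add: I_def K_def sum.Plus)
  \<comment> \<open>The prepared codeword decodes perfectly, so the branch contributes exactly its
    probability of being taken.\<close>
  have branch: "(\<Sum>s\<in>J m' \<times> {..<dA}. \<Sum>j\<in>J m. qf N (E m') (prod_vec (mat_app dA ((\<lambda>(c,b) i x. S m' c i * R b x) s) (U m j)) (V m j)))
     = (\<Sum>j\<in>J m. nrm2 dA (mat_app dA R (U m j)) * nrm2 dB (V m j))" if m': "m' < D" for m m' R
  proof -
    have "qf N (E m') (prod_vec (mat_app dA (\<lambda>i x. S m' c i * R b x) u) v) = (cmod (mat_app dA R u b))\<^sup>2 * nrm2 dB v * qf N (E m') (prod_vec (U m' c) (V m' c))"
      for c b u v
    proof -
      have "prod_vec (mat_app dA (\<lambda>i x. S m' c i * R b x) u) v x = (mat_app dA R u b * v 0) * prod_vec (U m' c) (V m' c) x" if "x < N" for x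
      proof -
        have "fB x = 0" using f_bound[OF that] dB by simp
        then show ?thesis by (simp add: prod_vec_def mat_app_def S_def sum_distrib_left sum_distrib_right mult_ac)
      qed
      then have "qf N (E m') (prod_vec (mat_app dA (\<lambda>i x. S m' c i * R b x) u) v) = qf N (E m') (\<lambda>x. (mat_app dA R u b * v 0) * prod_vec (U m' c) (V m' c) x)"
        by (rule qf_cong)
      then show ?thesis by (simp only: qf_scale nB norm_mult power_mult_distrib)
    qed
    then have "(\<Sum>s\<in>J m' \<times> {..<dA}. \<Sum>j\<in>J m. qf N (E m') (prod_vec (mat_app dA ((\<lambda>(c,b) i x. S m' c i * R b x) s) (U m j)) (V m j)))
       = (\<Sum>c\<in>J m'. \<Sum>b<dA. \<Sum>j\<in>J m. (cmod (mat_app dA R (U m j) b))\<^sup>2 * nrm2 dB (V m j) * qf N (E m') (prod_vec (U m' c) (V m' c)))"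
      by (subst sum.cartesian_product) (auto intro!: sum.cong)
    also have "\<dots> = (\<Sum>c\<in>J m'. \<Sum>j\<in>J m. \<Sum>b<dA. (cmod (mat_app dA R (U m j) b))\<^sup>2 * nrm2 dB (V m j) * qf N (E m') (prod_vec (U m' c) (V m' c)))"
      by (intro sum.cong refl sum.swap)
    also have "\<dots> = (\<Sum>c\<in>J m'. \<Sum>j\<in>J m. qf N (E m') (prod_vec (U m' c) (V m' c)) * (nrm2 dA (mat_app dA R (U m j)) * nrm2 dB (V m j)))"
      by (intro sum.cong refl) (simp add: nrm2_def sum_distrib_right sum_distrib_left mult_ac)
    also have "\<dots> = (\<Sum>c\<in>J m'. qf N (E m') (prod_vec (U m' c) (V m' c))) * (\<Sum>j\<in>J m. nrm2 dA (mat_app dA R (U m j)) * nrm2 dB (V m j))"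
      by (simp only: sum_product)
    finally show ?thesis using decodes[OF m'] by simp
  qed
  have nn: "0 \<le> (\<Sum>s\<in>T. \<Sum>j\<in>J m. qf N (E i) (prod_vec (mat_app dA (L s) (U m j)) (V m j)))" if "i < D" for T and L :: "'j \<times> nat \<Rightarrow> nat \<Rightarrow> nat \<Rightarrow> complex" and m i
    by (intro sum_nonneg E_nonneg that)
  have r01: "(\<Sum>j\<in>J 0. nrm2 dA (mat_app dA P (U 0 j)) * nrm2 dB (V 0 j)) \<le> response I K 0 1"
    unfolding response_def I_def K_def using J_fin branch[OF D01(2), of P 0] nn[OF D01(2)]
    by (simp add: sum.Plus)
  have r10: "(\<Sum>j\<in>J 1. nrm2 dA (mat_app dA Q (U 1 j)) * nrm2 dB (V 1 j)) \<le> response I K 1 0"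
    unfolding response_def I_def K_def using J_fin branch[OF D01(1), of Q 1] nn[OF D01(1)]
    by (simp add: sum.Plus)
  have "3 / 8 \<le> (\<Sum>j\<in>J 0. qf N (E 0) (prod_vec (mat_app dA P (U 0 j)) (V 0 j)))"
    by (rule projected_weight[OF D01(1) PQ pyth Q])
  also have "\<dots> \<le> (\<Sum>j\<in>J 0. nrm2 dA (mat_app dA P (U 0 j)) * nrm2 dB (V 0 j))"
    by (intro sum_mono) (use E_le1[OF D01(1)] nrm2_prod_vec in metis)
  also note r01
  finally have 1: "3 / 8 \<le> response I K 0 1" .
  have "(\<Sum>j\<in>J 1. qf N (E 0) (prod_vec (U 1 j) (V 1 j))) + (\<Sum>j\<in>J 1. qf N (E 1) (prod_vec (U 1 j) (V 1 j)))
      \<le> (\<Sum>j\<in>J 1. nrm2 dA (U 1 j) * nrm2 dB (V 1 j))"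
    unfolding sum.distrib[symmetric] nrm2_prod_vec[symmetric]
  proof (intro sum_mono)
    fix j
    show "qf N (E 0) (prod_vec (U 1 j) (V 1 j)) + qf N (E 1) (prod_vec (U 1 j) (V 1 j)) \<le> nrm2 N (prod_vec (U 1 j) (V 1 j))"
      using E_le[of "{0,1}" "prod_vec (U 1 j) (V 1 j)"] D01 by simp
  qed
  then have z: "(\<Sum>j\<in>J 1. qf N (E 0) (prod_vec (U 1 j) (V 1 j))) \<le> 0"
    using decodes[OF D01(2)] normalized[OF D01(2)] by simp
  \<comment> \<open>For trivial B the reduced effect is the effect itself, so the acceptance
    probability of message 1 is at most 8 times zero.\<close>
  have "(\<Sum>j\<in>J 1. nrm2 dA (mat_app dA P (U 1 j)) * nrm2 dB (V 1 j)) \<le> (\<Sum>j\<in>J 1. 8 * qf N (E 0) (prod_vec (U 1 j) (V 1 j)))"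
  proof (intro sum_mono)
    fix j
    let ?u = "U 1 j" and ?v = "V 1 j"
    have "nrm2 dA (mat_app dA P ?u) * nrm2 dB ?v \<le> (8 * qf dA (reduced (E 0)) ?u) * nrm2 dB ?v"
      using P[of ?u] by (intro mult_right_mono nrm2_nonneg) simp
    also have "qf dA (reduced (E 0)) ?u = qf N (E 0) (prod_vec ?u (\<lambda>y. of_bool (y = 0)))"
      unfolding qf_reduced by (simp add: dB)
    also have "8 * \<dots> * nrm2 dB ?v = 8 * ((cmod (?v 0))\<^sup>2 * qf N (E 0) (prod_vec ?u (\<lambda>y. of_bool (y = 0))))"
      by (simp add: nB)
    also have "(cmod (?v 0))\<^sup>2 * qf N (E 0) (prod_vec ?u (\<lambda>y. of_bool (y = 0))) = qf N (E 0) (prod_vec ?u ?v)"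
      unfolding qf_scale[symmetric]
    proof (rule qf_cong)
      fix x assume "x < N"
      then have "fB x = 0" using f_bound dB by fastforce
      then show "?v 0 * prod_vec ?u (\<lambda>y. of_bool (y = 0)) x = prod_vec ?u ?v x" by (simp add: prod_vec_def)
    qed
    finally show "nrm2 dA (mat_app dA P ?u) * nrm2 dB ?v \<le> 8 * qf N (E 0) (prod_vec ?u ?v)" .
  qed
  also have "\<dots> \<le> 0" using z by (simp flip: sum_distrib_left)
  finally have zP: "(\<Sum>j\<in>J 1. nrm2 dA (mat_app dA P (U 1 j)) * nrm2 dB (V 1 j)) \<le> 0" .
  have "(\<Sum>j\<in>J 1. nrm2 dA (U 1 j) * nrm2 dB (V 1 j)) = (\<Sum>j\<in>J 1. nrm2 dA (mat_app dA P (U 1 j)) * nrm2 dB (V 1 j))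
      + (\<Sum>j\<in>J 1. nrm2 dA (mat_app dA Q (U 1 j)) * nrm2 dB (V 1 j))"
    unfolding sum.distrib[symmetric] distrib_right[symmetric] by (intro sum.cong refl arg_cong2[where f = "(*)"] pyth)
  then have 2: "1 \<le> response I K 1 0" using zP r10 normalized[OF D01(2)] by simp
  show ?thesis by (rule that[OF _ tpK 1 2]) (simp add: I_def J_fin)
qed

end

section \<open>The rate bound\<close>

text \<open>The coordinate of B packs the digits left and right of A into one number in base
  \<open>dR\<close>; \<open>?g\<close> unpacks it and puts the digit of A back in the
  middle.\<close>

lemma bipartition_middle:
  fixes dL dA dR :: nat
  assumes "0 < dA" "0 < dR"
  shows "bipartition (dL * (dA * dR)) dA (dL * dR) (\<lambda>x. x mod (dA * dR) div dR) (\<lambda>x. x div (dA * dR) * dR + x mod dR)"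
proof
  let ?f = "\<lambda>x. (x mod (dA * dR) div dR, x div (dA * dR) * dR + x mod dR)"
  let ?g = "\<lambda>(a,b). b div dR * (dA * dR) + (a * dR + b mod dR)"
  show "bij_betw ?f {..<dL * (dA * dR)} ({..<dA} \<times> {..<dL * dR})"
  proof (rule bij_betw_byWitness[where f' = ?g])
    show "\<forall>x\<in>{..<dL * (dA * dR)}. ?g (?f x) = x"
    proof
      fix x
      have "x mod (dA * dR) div dR * dR + x mod dR = x mod (dA * dR)"
        using div_mult_mod_eq[of "x mod (dA * dR)" dR] by (simp add: mod_mod_cancel)
      moreover have "(x div (dA * dR) * dR + x mod dR) div dR = x div (dA * dR)"
        using assms by (intro index_div) simp
      moreover have "(x div (dA * dR) * dR + x mod dR) mod dR = x mod dR" by simp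
      ultimately show "?g (?f x) = x" by (simp only: prod.case div_mult_mod_eq)
    qed
    show "\<forall>p\<in>{..<dA} \<times> {..<dL * dR}. ?f (?g p) = p"
    proof
      fix p assume "p \<in> {..<dA} \<times> {..<dL * dR}"
      then obtain a b where p: "p = (a,b)" and a: "a < dA" by auto
      have r: "a * dR + b mod dR < dA * dR" using index_bound[OF a] assms by simp
      have "(b div dR * (dA * dR) + (a * dR + b mod dR)) mod (dA * dR) = a * dR + b mod dR"
        using r by simp
      moreover have "(b div dR * (dA * dR) + (a * dR + b mod dR)) div (dA * dR) = b div dR"
        using r by (rule index_div)
      moreover have "(b div dR * (dA * dR) + (a * dR + b mod dR)) mod dR = b mod dR"
        by (metis mod_mult_self3 mod_mod_trivial mult.assoc)
      moreover have "(a * dR + b mod dR) div dR = a" using assms by (intro index_div) simp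
      ultimately show "?f (?g p) = p" by (simp add: p)
    qed
    show "?f ` {..<dL * (dA * dR)} \<subseteq> {..<dA} \<times> {..<dL * dR}"
    proof (rule image_subsetI)
      fix x assume "x \<in> {..<dL * (dA * dR)}"
      then have "x div (dA * dR) < dL" by (simp add: less_mult_imp_div_less)
      moreover have "x mod (dA * dR) div dR < dA" using assms by (simp add: less_mult_imp_div_less)
      ultimately show "?f x \<in> {..<dA} \<times> {..<dL * dR}" using assms by (simp add: index_bound)
    qed
    show "?g ` ({..<dA} \<times> {..<dL * dR}) \<subseteq> {..<dL * (dA * dR)}"
    proof (rule image_subsetI)
      fix p assume "p \<in> {..<dA} \<times> {..<dL * dR}"
      then obtain a b where p: "p = (a,b)" and a: "a < dA" and b: "b < dL * dR" by auto
      have r: "a * dR + b mod dR < dA * dR" using index_bound[OF a] assms by simp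
      have "b div dR < dL" using b by (simp add: less_mult_imp_div_less)
      from index_bound[OF this r] show "?g p \<in> {..<dL * (dA * dR)}" by (simp add: p)
    qed
  qed
qed

text \<open>Every factor of every product term has Gram vectors. Those of the factors before and
  after A combine into vectors on B, and the root of the mixture weight is absorbed into
  \<open>V\<close>; the label in \<open>J\<close> records the term and one Gram vector each for
  left, A and right.\<close>

lemma separable_product_gram:
  assumes sep: "separable (pre @ dA # post) \<rho>"
  defines "dL \<equiv> prod_list pre" and "dR \<equiv> prod_list post"
  assumes dR: "0 < dR"
  shows "\<exists>(J :: (nat \<times> nat \<times> nat \<times> nat) set) U V. finite J \<and>
    (\<forall>x<dL * (dA * dR). \<forall>y<dL * (dA * dR). \<rho> $$ (x,y) = (\<Sum>j\<in>J.
       (U j (x mod (dA * dR) div dR) * V j (x div (dA * dR) * dR + x mod dR))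
       * cnj (U j (y mod (dA * dR) div dR) * V j (y div (dA * dR) * dR + y mod dR))))"
proof -
  let ?ds = "pre @ dA # post" and ?M = "dA * dR"
  let ?t = "length ?ds" and ?i = "length pre"
  have pl: "prod_list ?ds = dL * ?M" by (simp add: dL_def dR_def)
  obtain m :: nat and p \<rho>s where H: "(\<forall>j<m. (0::real) \<le> p j) \<and> (\<Sum>j<m. p j) = 1 \<and> (\<forall>j<m. \<forall>i<?t. density (?ds ! i) (\<rho>s j i)) \<and>
      \<rho> = mat (dL * ?M) (dL * ?M) (\<lambda>(x,y). \<Sum>j<m. complex_of_real (p j) * kron_list (map (\<rho>s j) [0..<?t]) $$ (x,y))"
    using sep unfolding separable_def pl by (elim exE) (rule that, assumption)
  then have p: "0 \<le> p j" and dens: "i < ?t \<Longrightarrow> density (?ds ! i) (\<rho>s j i)" if "j < m" for i j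
    using that by simp_all
  have \<rho>: "\<rho> = mat (dL * ?M) (dL * ?M) (\<lambda>(x,y). \<Sum>j<m. complex_of_real (p j) * kron_list (map (\<rho>s j) [0..<?t]) $$ (x,y))"
    using H by (elim conjE)
  define A where "A = (\<lambda>j. map (\<rho>s j) [0..<?i])"
  define B where "B = (\<lambda>j. map (\<rho>s j) [Suc ?i..<?t])"
  have sq: "square_psd (\<rho>s j i)" "dim_row (\<rho>s j i) = ?ds ! i" if "j < m" "i < ?t" for j i
    using dens[OF that] by (auto simp: density_def square_psd_def)
  have split: "map (\<rho>s j) [0..<?t] = A j @ \<rho>s j ?i # B j" for j
  proof -
    have "[0..<?t] = [0..<?i] @ ?i # [Suc ?i..<?t]"
      using upt_add_eq_append[of 0 ?i "Suc (length post)"] upt_conv_Cons[of ?i ?t] by simp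
    then show ?thesis by (simp add: A_def B_def)
  qed
  have dA: "map dim_row (A j) = pre" if "j < m" for j
    by (rule nth_equalityI) (simp_all add: A_def sq(2)[OF that] nth_append)
  have dB: "map dim_row (B j) = post" if "j < m" for j
  proof -
    have "map dim_row (B j) = map (\<lambda>i. dim_row (\<rho>s j i)) [Suc ?i..<?t]" by (simp add: B_def)
    also have "\<dots> = post" by (rule map_upt_eqI) (simp_all add: sq(2)[OF that] nth_append)
    finally show ?thesis .
  qed
  have di: "dim_row (\<rho>s j ?i) = dA" if "j < m" for j using sq(2)[OF that, of ?i] by simp
  have sqA: "square_psd X" if "j < m" "X \<in> set (A j)" for j X
    using that sq(1)[of j] by (auto simp: A_def)
  have sqB: "square_psd X" if "j < m" "X \<in> set (B j)" for j X
    using that sq(1)[of j] by (auto simp: B_def)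
  have sqi: "square_psd (\<rho>s j ?i)" if "j < m" for j using sq(1)[OF that, of ?i] by simp
  have "\<exists>f. j < m \<longrightarrow> (\<forall>x<dL. \<forall>y<dL. kron_list (A j) $$ (x,y) = (\<Sum>c<dL. f c x * cnj (f c y)))" for j
  proof (cases "j < m")
    case True
    from kron_list_gram[of "A j", unfolded dA[OF True], folded dL_def] sqA[OF True]
    show ?thesis by blast
  qed simp
  then have "\<forall>j. \<exists>f. j < m \<longrightarrow> (\<forall>x<dL. \<forall>y<dL. kron_list (A j) $$ (x,y) = (\<Sum>c<dL. f c x * cnj (f c y)))" ..
  from choice[OF this] obtain f where f: "\<And>j x y. j < m \<Longrightarrow> x < dL \<Longrightarrow> y < dL \<Longrightarrow> kron_list (A j) $$ (x,y) = (\<Sum>c<dL. f j c x * cnj (f j c y))"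
    by blast
  have "\<exists>f. j < m \<longrightarrow> (\<forall>x<dR. \<forall>y<dR. kron_list (B j) $$ (x,y) = (\<Sum>c<dR. f c x * cnj (f c y)))" for j
  proof (cases "j < m")
    case True
    from kron_list_gram[of "B j", unfolded dB[OF True], folded dR_def] sqB[OF True]
    show ?thesis by blast
  qed simp
  then have "\<forall>j. \<exists>f. j < m \<longrightarrow> (\<forall>x<dR. \<forall>y<dR. kron_list (B j) $$ (x,y) = (\<Sum>c<dR. f c x * cnj (f c y)))" ..
  from choice[OF this] obtain h where h: "\<And>j x y. j < m \<Longrightarrow> x < dR \<Longrightarrow> y < dR \<Longrightarrow> kron_list (B j) $$ (x,y) = (\<Sum>c<dR. h j c x * cnj (h j c y))"
    by blast
  have "\<exists>f. j < m \<longrightarrow> (\<forall>x<dA. \<forall>y<dA. \<rho>s j ?i $$ (x,y) = (\<Sum>c<dA. f c x * cnj (f c y)))" for j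
  proof (cases "j < m")
    case True
    have "\<rho>s j ?i \<in> carrier_mat dA dA" "psd (\<rho>s j ?i)"
      using sqi[OF True] di[OF True] by (auto simp: square_psd_def)
    then obtain f where "\<And>x y. x < dA \<Longrightarrow> y < dA \<Longrightarrow> \<rho>s j ?i $$ (x,y) = (\<Sum>c<dA. f c x * cnj (f c y))"
      by (rule psd_gram) blast
    then show ?thesis by blast
  qed simp
  then have "\<forall>j. \<exists>f. j < m \<longrightarrow> (\<forall>x<dA. \<forall>y<dA. \<rho>s j ?i $$ (x,y) = (\<Sum>c<dA. f c x * cnj (f c y)))" ..
  from choice[OF this] obtain g where g: "\<And>j x y. j < m \<Longrightarrow> x < dA \<Longrightarrow> y < dA \<Longrightarrow> \<rho>s j ?i $$ (x,y) = (\<Sum>c<dA. g j c x * cnj (g j c y))"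
    by blast
  define J where "J = {..<m} \<times> {..<dL} \<times> {..<dA} \<times> {..<dR}"
  define U where "U = (\<lambda>(j::nat,c1::nat,c2::nat,c3::nat) a. g j c2 a)"
  define V where "V = (\<lambda>(j::nat,c1::nat,c2::nat,c3::nat) b. complex_of_real (sqrt (p j)) * (f j c1 (b div dR) * h j c3 (b mod dR)))"
  have "\<rho> $$ (x,y) = (\<Sum>j\<in>J. (U j (x mod ?M div dR) * V j (x div ?M * dR + x mod dR))
       * cnj (U j (y mod ?M div dR) * V j (y div ?M * dR + y mod dR)))"
    if x: "x < dL * ?M" and y: "y < dL * ?M" for x y
  proof -
    have M: "0 < ?M" using x by (cases "?M = 0") auto
    have b: "z div ?M < dL" "z mod ?M div dR < dA" "z mod dR < dR" if "z < dL * ?M" for z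
      using that M dR by (auto simp: less_mult_imp_div_less)
    have eqb: "(z div ?M * dR + z mod dR) div dR = z div ?M" "(z div ?M * dR + z mod dR) mod dR = z mod dR" for z
      using dR by (auto intro: index_div)
    define H where "H = (\<lambda>z j c1 c2 c3. f j c1 (z div ?M) * (g j c2 (z mod ?M div dR) * h j c3 (z mod dR)))"
    have "\<rho> $$ (x,y) = (\<Sum>j<m. complex_of_real (p j) * kron_list (A j @ \<rho>s j ?i # B j) $$ (x,y))"
      using x y by (simp add: \<rho> flip: split)
    also have "\<dots> = (\<Sum>j<m. complex_of_real (p j) * (\<Sum>c1<dL. \<Sum>c2<dA. \<Sum>c3<dR. H x j c1 c2 c3 * cnj (H y j c1 c2 c3)))"
    proof (intro sum.cong refl arg_cong2[where f = "(*)"])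
      fix j assume "j \<in> {..<m}"
      then have j: "j < m" by simp
      have sqall: "square_psd X" if "X \<in> set (A j @ \<rho>s j ?i # B j)" for X
        using that sqA[OF j] sqB[OF j] sqi[OF j] by auto
      have dims: "prod_list (map dim_row (A j @ \<rho>s j ?i # B j)) = dL * ?M"
        by (simp add: dA[OF j] dB[OF j] di[OF j] dL_def dR_def)
      have "kron_list (A j @ \<rho>s j ?i # B j) $$ (x,y) = kron_list (A j) $$ (x div ?M, y div ?M)
         * (\<rho>s j ?i $$ (x mod ?M div dR, y mod ?M div dR) * kron_list (B j) $$ (x mod dR, y mod dR))"
        using kron_list_split[of "A j" "\<rho>s j ?i" "B j" x y, unfolded dims dB[OF j] di[OF j], folded dR_def] sqall x y
        by blast
      also have "\<dots> = (\<Sum>c1<dL. f j c1 (x div ?M) * cnj (f j c1 (y div ?M)))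
        * ((\<Sum>c2<dA. g j c2 (x mod ?M div dR) * cnj (g j c2 (y mod ?M div dR))) * (\<Sum>c3<dR. h j c3 (x mod dR) * cnj (h j c3 (y mod dR))))"
        using b[OF x] b[OF y] by (simp only: f[OF j] g[OF j] h[OF j])
      also have "\<dots> = (\<Sum>c1<dL. \<Sum>c2<dA. \<Sum>c3<dR. H x j c1 c2 c3 * cnj (H y j c1 c2 c3))"
        by (simp only: sum_product, simp only: sum_distrib_left)
          (intro sum.cong refl, simp add: H_def mult_ac)
      finally show "kron_list (A j @ \<rho>s j ?i # B j) $$ (x,y) = (\<Sum>c1<dL. \<Sum>c2<dA. \<Sum>c3<dR. H x j c1 c2 c3 * cnj (H y j c1 c2 c3))" .
    qed
    also have "\<dots> = (\<Sum>j<m. \<Sum>c1<dL. \<Sum>c2<dA. \<Sum>c3<dR. complex_of_real (p j) * (H x j c1 c2 c3 * cnj (H y j c1 c2 c3)))"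
      by (simp only: sum_distrib_left)
    also have "\<dots> = (\<Sum>(j,c1,c2,c3)\<in>J. complex_of_real (p j) * (H x j c1 c2 c3 * cnj (H y j c1 c2 c3)))"
      by (simp only: sum.cartesian_product J_def)
    also have "\<dots> = (\<Sum>j\<in>J. (U j (x mod ?M div dR) * V j (x div ?M * dR + x mod dR))
       * cnj (U j (y mod ?M div dR) * V j (y div ?M * dR + y mod dR)))"
    proof (intro sum.cong refl)
      fix q assume "q \<in> J"
      then obtain j c1 c2 c3 where q: "q = (j,c1,c2,c3)" and j: "j < m" by (auto simp: J_def)
      have "complex_of_real (p j) = complex_of_real (sqrt (p j)) * complex_of_real (sqrt (p j))"
        using p[OF j] by (simp flip: of_real_mult)
      then show "(case q of (j,c1,c2,c3) \<Rightarrow> complex_of_real (p j) * (H x j c1 c2 c3 * cnj (H y j c1 c2 c3)))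
        = (U q (x mod ?M div dR) * V q (x div ?M * dR + x mod dR)) * cnj (U q (y mod ?M div dR) * V q (y div ?M * dR + y mod dR))"
        unfolding q U_def V_def H_def prod.case eqb by (simp add: mult_ac)
    qed
    finally show ?thesis .
  qed
  moreover have "finite J" by (simp add: J_def)
  ultimately show ?thesis by blast
qed

section \<open>From tampering on one share to lower bounds on the error\<close>

lemma prod_list_pow2: "prod_list (map (\<lambda>q. 2 ^ q) qs) = (2 ^ sum_list qs :: nat)"
  by (induction qs) (simp_all add: power_add)

text \<open>A channel on one share together with identities on the others is a member of
  \<open>LO\<close>; its Kraus operators come from \<open>kraus_tensor_list\<close>.\<close>

lemma local_tampering:
  assumes qs: "qs = pre @ a # post"
    and fin: "finite (I :: 's set)"
    and tp: "\<And>x y. x < 2 ^ a \<Longrightarrow> y < 2 ^ a \<Longrightarrow> (\<Sum>s\<in>I. \<Sum>i<2 ^ a. cnj (K s i y) * K s i x) = of_bool (x = y)"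
  defines "dR \<equiv> 2 ^ sum_list post" and "dA \<equiv> 2 ^ a"
  shows "\<exists>\<Lambda> \<in> LO qs. kraus (2 ^ sum_list qs) I
    (\<lambda>s x y. of_bool (x div (dA * dR) = y div (dA * dR)) *
       (of_bool (x mod dR = y mod dR) * K s (x mod (dA * dR) div dR) (y mod (dA * dR) div dR))) \<Lambda>"
proof -
  let ?i = "length pre" and ?t = "length qs"
  define \<Phi> :: "cmat \<Rightarrow> cmat" where
    "\<Phi> X = mat dA dA (\<lambda>(i,j). \<Sum>s\<in>I. \<Sum>x<dA. \<Sum>y<dA. K s i x * X $$ (x,y) * cnj (K s j y))" for X
  have K: "kraus dA I K \<Phi>" using fin by (simp add: kraus_def \<Phi>_def)
  have \<Phi>: "cptp dA dA \<Phi>" by (rule kraus_cptp[OF K]) (use tp in \<open>simp add: dA_def\<close>)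
  define \<Lambda>s where "\<Lambda>s = (\<lambda>i. if i = ?i then \<Phi> else (\<lambda>X. X))"
  define P where "P = map (\<lambda>i. (2 ^ (qs ! i) :: nat, \<Lambda>s i)) [0..<?i]"
  define R where "R = map (\<lambda>i. (2 ^ (qs ! i) :: nat, \<Lambda>s i)) [Suc ?i..<?t]"
  have qi: "qs ! ?i = a" "?i < ?t" by (simp_all add: qs)
  have "[0..<?t] = [0..<?i] @ ?i # [Suc ?i..<?t]"
    using upt_add_eq_append[of 0 ?i "Suc (length post)"] upt_conv_Cons[of ?i ?t] by (simp add: qs)
  then have split: "map (\<lambda>i. (2 ^ (qs ! i), \<Lambda>s i)) [0..<?t] = P @ (dA, \<Phi>) # R"
    by (simp add: P_def R_def qi(1)) (simp add: \<Lambda>s_def dA_def)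
  have "map fst P = map (\<lambda>q. 2 ^ q) pre"
    by (rule nth_equalityI) (auto simp: P_def qs nth_append)
  then have pP: "(\<Prod>p\<leftarrow>P. fst p) = 2 ^ sum_list pre" by (simp add: prod_list_pow2)
  have "map fst R = map (\<lambda>i. 2 ^ (qs ! i)) [Suc ?i..<?t]" by (simp add: R_def)
  also have "\<dots> = map (\<lambda>q. 2 ^ q) post" by (rule map_upt_eqI) (simp_all add: qs nth_append)
  finally have "map fst R = map (\<lambda>q. 2 ^ q) post" .
  then have pR: "(\<Prod>p\<leftarrow>R. fst p) = dR" by (simp add: prod_list_pow2 dR_def)
  have idP: "snd p = (\<lambda>X. X)" if "p \<in> set P" for p using that by (auto simp: P_def \<Lambda>s_def)
  have idR: "snd p = (\<lambda>X. X)" if "p \<in> set R" for p using that by (auto simp: R_def \<Lambda>s_def)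
  have N: "2 ^ sum_list pre * (dA * dR) = 2 ^ sum_list qs"
    by (simp add: qs dA_def dR_def power_add)
  have "kraus (2 ^ sum_list qs) I
    (\<lambda>s x y. of_bool (x div (dA * dR) = y div (dA * dR)) *
       (of_bool (x mod dR = y mod dR) * K s (x mod (dA * dR) div dR) (y mod (dA * dR) div dR)))
    (superop_tensor_list (P @ (dA, \<Phi>) # R))"
    by (rule kraus_tensor_list[OF K, where post = R and pre = P, unfolded pP pR N]) (erule idR idP)+
  moreover have "superop_tensor_list (P @ (dA, \<Phi>) # R) \<in> LO qs"
    unfolding LO_def split[symmetric] using \<Phi> cptp_id qi(1)
    by (auto simp: \<Lambda>s_def dA_def)
  ultimately show ?thesis by blast
qed

text \<open>Here \<open>b\<close> is the number of qubits outside the chosen share. The third bound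
  comes from \<open>keep_or_erase\<close>, the fourth from \<open>swap_messages\<close>.\<close>

lemma share_bounds:
  assumes code: "quantum_code k qs Enc Dec" and nm: "non_malleable_LO k qs Enc Dec \<epsilon>"
    and sep: "\<And>\<psi>. density (2 ^ k) \<psi> \<Longrightarrow> separable (map (\<lambda>q. 2 ^ q) qs) (Enc \<psi>)"
    and qs: "qs = pre @ a # post"
  defines "b \<equiv> sum_list pre + sum_list post"
  shows "k \<le> sum_list qs" "0 \<le> \<epsilon>" "81 * 2 ^ b \<le> (2 ^ k :: nat) \<Longrightarrow> 1 / 12 \<le> \<epsilon>"
    "b = 0 \<Longrightarrow> 0 < k \<Longrightarrow> 1 / 12 \<le> \<epsilon>"
proof -
  define dR :: nat where "dR = 2 ^ sum_list post"
  define dL :: nat where "dL = 2 ^ sum_list pre"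
  define dA :: nat where "dA = 2 ^ a"
  define D :: nat where "D = 2 ^ k"
  define N :: nat where "N = 2 ^ sum_list qs"
  define fA where "fA = (\<lambda>x. x mod (dA * dR) div dR)"
  define fB where "fB = (\<lambda>x. x div (dA * dR) * dR + x mod dR)"
  have N: "N = dL * (dA * dR)" by (simp add: N_def dL_def dA_def dR_def qs power_add)
  have dB: "dL * dR = 2 ^ b" by (simp add: dL_def dR_def b_def power_add)
  have pos: "0 < dR" "0 < dA" "0 < D" by (simp_all add: dR_def dA_def D_def)
  interpret bipartition N dA "dL * dR" fA fB
    unfolding N fA_def fB_def by (rule bipartition_middle) (use pos in auto)
  have Enc: "cptp D N Enc" and Dec: "cptp N D Dec" and inv: "\<And>\<rho>. \<rho> \<in> carrier_mat D D \<Longrightarrow> Dec (Enc \<rho>) = \<rho>"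
    using code by (simp_all add: quantum_code_def D_def N_def)
  have pvx: "prod_vec u v x = u (x mod (dA * dR) div dR) * v (x div (dA * dR) * dR + x mod dR)" for u v x
    unfolding prod_vec_def by (simp add: fA_def fB_def)
  define W where "W = (\<lambda>m. Enc (ketbra D m m))"
  have Wc: "W m \<in> carrier_mat N N" for m using Enc by (simp add: cptp_def W_def)
  \<comment> \<open>Labels and both vector families are bundled into one triple, so that a single
    choice over all \<open>m\<close> suffices; for \<open>m\<close> outside the message range the
    label set is empty.\<close>
  have "\<exists>T :: (nat \<times> nat \<times> nat \<times> nat) set \<times> _ \<times> _. finite (fst T) \<and> (m < D \<longrightarrow> (\<forall>x<N. \<forall>y<N.
      W m $$ (x,y) = (\<Sum>j\<in>fst T. prod_vec (fst (snd T) j) (snd (snd T) j) x * cnj (prod_vec (fst (snd T) j) (snd (snd T) j) y))))" for m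
  proof (cases "m < D")
    case True
    have "separable (map (\<lambda>q. 2 ^ q) pre @ 2 ^ a # map (\<lambda>q. 2 ^ q) post) (W m)"
      using sep[OF density_ketbra] True by (simp add: qs W_def D_def)
    from separable_product_gram[OF this, unfolded prod_list_pow2, folded dL_def dA_def dR_def, OF pos(1)]
    have "\<exists>(J :: (nat \<times> nat \<times> nat \<times> nat) set) U V. finite J \<and>
        (\<forall>x<N. \<forall>y<N. W m $$ (x,y) = (\<Sum>j\<in>J. prod_vec (U j) (V j) x * cnj (prod_vec (U j) (V j) y)))"
      unfolding pvx N .
    then obtain J :: "(nat \<times> nat \<times> nat \<times> nat) set" and U V where "finite J \<and>
        (\<forall>x<N. \<forall>y<N. W m $$ (x,y) = (\<Sum>j\<in>J. prod_vec (U j) (V j) x * cnj (prod_vec (U j) (V j) y)))"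
      by (elim exE) (rule that, assumption)
    then show ?thesis by (intro exI[of _ "(J,U,V)"]) (unfold fst_conv snd_conv, blast)
  next
    case False
    then show ?thesis by (intro exI[of _ "({}, undefined)"]) simp
  qed
  then have "\<forall>m. \<exists>T :: (nat \<times> nat \<times> nat \<times> nat) set \<times> _ \<times> _. finite (fst T) \<and> (m < D \<longrightarrow> (\<forall>x<N. \<forall>y<N.
      W m $$ (x,y) = (\<Sum>j\<in>fst T. prod_vec (fst (snd T) j) (snd (snd T) j) x * cnj (prod_vec (fst (snd T) j) (snd (snd T) j) y))))" ..
  from choice[OF this] obtain T :: "nat \<Rightarrow> (nat \<times> nat \<times> nat \<times> nat) set \<times> _ \<times> _" where
    T: "\<forall>m. finite (fst (T m)) \<and> (m < D \<longrightarrow> (\<forall>x<N. \<forall>y<N. W m $$ (x,y)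
      = (\<Sum>j\<in>fst (T m). prod_vec (fst (snd (T m)) j) (snd (snd (T m)) j) x * cnj (prod_vec (fst (snd (T m)) j) (snd (snd (T m)) j) y))))"
    by (elim exE) (rule that, assumption)
  define J where "J = (\<lambda>m. fst (T m))"
  define U where "U = (\<lambda>m. fst (snd (T m)))"
  define V where "V = (\<lambda>m. snd (snd (T m)))"
  have J: "finite (J m)" for m using T by (simp add: J_def)
  have gram: "W m $$ (x,y) = (\<Sum>j\<in>J m. prod_vec (U m j) (V m j) x * cnj (prod_vec (U m j) (V m j) y))"
    if "m < D" "x < N" "y < N" for m x y
    using T that by (simp add: J_def U_def V_def)
  interpret code_family N dA "dL * dR" fA fB D "effect N Dec" J U V
  proof
    show "pos N (effect N Dec m)" if "m < D" for m using effect_pos[OF Dec that] .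
    show "(\<Sum>m<D. qf N (effect N Dec m) w) = nrm2 N w" for w
      using effect_sum[OF Dec] by (simp add: qf_def nrm2_def)
    show "finite (J m)" for m by (rule J)
    fix m assume m: "m < D"
    have "complex_of_real (\<Sum>j\<in>J m. nrm2 N (prod_vec (U m j) (V m j))) = (\<Sum>j\<in>J m. \<Sum>x<N. prod_vec (U m j) (V m j) x * cnj (prod_vec (U m j) (V m j) x))"
      by (simp only: nrm2_def of_real_sum complex_norm_square)
    also have "\<dots> = (\<Sum>x<N. W m $$ (x,x))"
      by (subst sum.swap) (simp add: gram[OF m])
    also have "\<dots> = mtrace (W m)" using Wc[of m] by (simp add: mtrace_def)
    also have "\<dots> = 1" using Enc density_ketbra[OF m] by (simp add: cptp_def W_def density_def)
    finally show "(\<Sum>j\<in>J m. nrm2 dA (U m j) * nrm2 (dL * dR) (V m j)) = 1"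
      unfolding nrm2_prod_vec of_real_eq_1_iff .
    have "(\<Sum>j\<in>J m. sf N (effect N Dec m) (prod_vec (U m j) (V m j)) (prod_vec (U m j) (V m j))) = Dec (W m) $$ (m,m)"
      by (rule effect_gram[OF Dec Wc m gram[OF m], symmetric])
    also have "\<dots> = 1" using m by (simp add: W_def inv)
    finally show "(\<Sum>j\<in>J m. qf N (effect N Dec m) (prod_vec (U m j) (V m j))) = 1"
      unfolding qf_def by (metis Re_sum one_complex.sel(1))
  qed
  have tamper: "\<exists>p g. 0 \<le> p \<and> p \<le> 1 \<and> (\<forall>i<D. 0 \<le> g i) \<and> (\<Sum>i<D. g i) = 1 \<and>
      (\<forall>m<D. \<forall>i<D. \<bar>response I K m i - (p * of_bool (i = m) + (1 - p) * g i)\<bar> \<le> \<epsilon>)"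
    if fin: "finite I" and tp: "\<And>x y. x < dA \<Longrightarrow> y < dA \<Longrightarrow> (\<Sum>s\<in>I. \<Sum>i<dA. cnj (K s i y) * K s i x) = of_bool (x = y)"
    for I :: "'s set" and K
  proof -
    \<comment> \<open>Equal B coordinates mean equal left and right digits, so the Kraus operators
      of the tampering are lifts from A.\<close>
    have "(of_bool (x div (dA * dR) = y div (dA * dR)) * (of_bool (x mod dR = y mod dR) * K s (x mod (dA * dR) div dR) (y mod (dA * dR) div dR)))
       = lift (K s) x y" for s x y
    proof -
      have "(fB x = fB y) = (x div (dA * dR) = y div (dA * dR) \<and> x mod dR = y mod dR)"
        unfolding fB_def using pos(1) index_div by (metis mod_less_divisor mod_mult_self3 mod_mod_trivial)
      then show ?thesis unfolding lift_def by (simp add: fA_def)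
    qed
    moreover have "\<exists>\<Lambda>\<in>LO qs. kraus N I (\<lambda>s x y. of_bool (x div (dA * dR) = y div (dA * dR)) *
        (of_bool (x mod dR = y mod dR) * K s (x mod (dA * dR) div dR) (y mod (dA * dR) div dR))) \<Lambda>"
      unfolding dR_def dA_def N_def by (rule local_tampering[OF qs fin]) (use tp in \<open>simp add: dA_def\<close>)
    ultimately have "\<exists>\<Lambda>\<in>LO qs. kraus N I (\<lambda>s x y. lift (K s) x y) \<Lambda>" by (simp only:)
    then obtain \<Lambda> where L: "\<Lambda> \<in> LO qs" and K: "kraus N I (\<lambda>s. lift (K s)) \<Lambda>" by blast
    have resp: "Re (Dec (\<Lambda> (W m)) $$ (i,i)) = response I K m i" if m: "m < D" and i: "i < D" for m i
    proof -
      have "Dec (\<Lambda> (W m)) $$ (i,i) = (\<Sum>q\<in>I \<times> J m. sf N (effect N Dec i)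
          (mat_app N (lift (K (fst q))) (prod_vec (U m (snd q)) (V m (snd q)))) (mat_app N (lift (K (fst q))) (prod_vec (U m (snd q)) (V m (snd q)))))"
        by (rule effect_gram[OF Dec kraus_carrier[OF K Wc] i])
          (simp add: kraus_gram[OF K Wc gram[OF m]] mat_app_def case_prod_beta)
      then have "Re (Dec (\<Lambda> (W m)) $$ (i,i)) = (\<Sum>q\<in>I \<times> J m. qf N (effect N Dec i) (mat_app N (lift (K (fst q))) (prod_vec (U m (snd q)) (V m (snd q)))))"
        by (simp add: qf_def)
      then show ?thesis
        by (simp add: qf_mat_app_lift response_def sum.cartesian_product case_prod_beta)
    qed
    have c: "Dec (\<Lambda> (Enc X)) \<in> carrier_mat (2 ^ k) (2 ^ k)" if "X \<in> carrier_mat (2 ^ k) (2 ^ k)" for X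
    proof -
      have "Enc X \<in> carrier_mat N N" using Enc that by (simp add: cptp_def D_def)
      then have "\<Lambda> (Enc X) \<in> carrier_mat N N" by (rule kraus_carrier[OF K])
      then show ?thesis using Dec by (simp add: cptp_def D_def)
    qed
    show ?thesis
      using non_malleable_diagonal[OF nm L c] resp by (simp add: W_def flip: D_def)
  qed
  have "D \<le> N" by (rule messages_le)
  then show "k \<le> sum_list qs" by (simp add: D_def N_def)
  show "0 \<le> \<epsilon>"
  proof -
    \<comment> \<open>The identity tampering yields an absolute value bounded by
      \<open>\<epsilon>\<close>.\<close>
    have "(\<Sum>s\<in>{()}. \<Sum>i<dA. cnj (of_bool (i = y)) * of_bool (i = x)) = (of_bool (x = y) :: complex)" if "x < dA" for x y
    proof -
      have "(\<Sum>i<dA. cnj (of_bool (i = y)) * of_bool (i = x)) = (of_bool (x = y) :: complex)"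
        using that by (subst sum_single[of _ x]) auto
      then show ?thesis by simp
    qed
    from tamper[OF _ this] show ?thesis using pos(3) by (meson abs_ge_zero finite.emptyI finite.insertI order.trans)
  qed
  show "1 / 12 \<le> \<epsilon>" if large: "81 * 2 ^ b \<le> (2 ^ k :: nat)"
  proof -
    have dB0: "0 < dL * dR" and D81: "81 * (dL * dR) \<le> D" using large by (simp_all add: dB D_def)
    obtain m0 m1 and I :: "(unit + nat) set" and K where m: "m0 < D" "m1 < D" "m0 \<noteq> m1" and fin: "finite I"
      and tp: "\<And>x y. x < dA \<Longrightarrow> y < dA \<Longrightarrow> (\<Sum>s\<in>I. \<Sum>i<dA. cnj (K s i y) * K s i x) = of_bool (x = y)"
      and r: "3 / 8 \<le> response I K m0 m0" "response I K m1 m1 + response I K m1 m0 \<le> 1 / 8"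
      by (rule keep_or_erase[OF pos(2) dB0 D81]) blast
    from tamper[OF fin tp] obtain p g where p: "0 \<le> p" "p \<le> 1" and g: "\<And>i. i < D \<Longrightarrow> 0 \<le> g i"
      and e: "\<And>m i. m < D \<Longrightarrow> i < D \<Longrightarrow> \<bar>response I K m i - (p * of_bool (i = m) + (1 - p) * g i)\<bar> \<le> \<epsilon>"
      by blast
    \<comment> \<open>Chaining gives 3/8 \<le> p + (1 - p) g(m0) + \<epsilon> \<le> 1/8 + 3
      \<epsilon>, where p is read off from m1 staying m1 and the other term from m1 becoming
      m0.\<close>
    have "0 \<le> (1 - p) * g m1" using p g m by simp
    moreover have "response I K m0 m0 \<le> p + (1 - p) * g m0 + \<epsilon>" using e[OF m(1,1)] by simp
    moreover have "(1 - p) * g m0 \<le> response I K m1 m0 + \<epsilon>" using e[OF m(2,1)] m(3) by simp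
    moreover have "p + (1 - p) * g m1 \<le> response I K m1 m1 + \<epsilon>" using e[OF m(2,2)] by simp
    ultimately show ?thesis using r by linarith
  qed
  show "1 / 12 \<le> \<epsilon>" if b0: "b = 0" and k0: "0 < k"
  proof -
    have D2: "2 \<le> D" using k0 self_le_power[of "2::nat" k] by (simp add: D_def)
    have dB1: "dL * dR = 1" by (simp add: dB b0)
    obtain I :: "((nat \<times> nat \<times> nat \<times> nat) \<times> nat + (nat \<times> nat \<times> nat \<times> nat) \<times> nat) set" and K where fin: "finite I"
      and tp: "\<And>x y. x < dA \<Longrightarrow> y < dA \<Longrightarrow> (\<Sum>s\<in>I. \<Sum>i<dA. cnj (K s i y) * K s i x) = of_bool (x = y)"
      and r: "3 / 8 \<le> response I K 0 1" "1 \<le> response I K 1 0"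
      by (rule swap_messages[OF pos(2) dB1 D2]) blast
    from tamper[OF fin tp] obtain p g where p: "0 \<le> p" "p \<le> 1" and g: "\<forall>i<D. 0 \<le> g i" "(\<Sum>i<D. g i) = 1"
      and e: "\<And>m i. m < D \<Longrightarrow> i < D \<Longrightarrow> \<bar>response I K m i - (p * of_bool (i = m) + (1 - p) * g i)\<bar> \<le> \<epsilon>"
      by blast
    \<comment> \<open>Both swaps must come from the constant part of total mass at most 1, so 11/8
      \<le> 1 + 2 \<epsilon>.\<close>
    have "(\<Sum>i\<in>{0,1}. g i) \<le> (\<Sum>i<D. g i)" by (rule sum_mono2) (use D2 g in auto)
    then have "g 0 + g 1 \<le> 1" using g by simp
    then have "(1 - p) * (g 0 + g 1) \<le> 1"
      using p g D2 by (intro mult_le_one) auto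
    moreover have "response I K 0 1 \<le> (1 - p) * g 1 + \<epsilon>" using e[of 0 1] D2 by simp
    moreover have "response I K 1 0 \<le> (1 - p) * g 0 + \<epsilon>" using e[of 1 0] D2 by simp
    ultimately show ?thesis using r by (simp add: algebra_simps)
  qed
qed

section \<open>Parameter count: from the rate to the size of the remaining shares\<close>

lemma exists_large_share:
  fixes qs :: "nat list"
  assumes "qs \<noteq> []"
  shows "\<exists>a\<in>set qs. real (sum_list qs) / real (length qs) \<le> real a"
proof -
  let ?a = "Max (set qs)"
  have "sum_list qs \<le> sum_list (map (\<lambda>_. ?a) qs)"
    using sum_list_mono[of qs "\<lambda>x. x" "\<lambda>_. ?a"] by simp
  then have "sum_list qs \<le> length qs * ?a" by (simp add: sum_list_triv)
  then have "real (sum_list qs) \<le> real (length qs) * real ?a"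
    by (metis of_nat_le_iff of_nat_mult)
  then have "real (sum_list qs) / real (length qs) \<le> real ?a"
    using assms by (simp add: field_simps)
  then show ?thesis using assms by (intro bexI[of _ ?a]) auto
qed

theorem theorem10p1:
  "\<exists>c::real. c > 0 \<and>
    (\<forall>(k::nat) (qs::nat list) Enc Dec (\<epsilon>::real) (\<delta>::real).
       let t = length qs; n = sum_list qs in
       quantum_code k qs Enc Dec \<and>
       non_malleable_LO k qs Enc Dec \<epsilon> \<and>
       (\<forall>\<psi>. density (2 ^ k) \<psi> \<longrightarrow> separable (map (\<lambda>q. 2 ^ q) qs) (Enc \<psi>)) \<and>
       \<delta> \<ge> 4 * log 2 (real n) / real n \<and>
       real k / real n \<ge> 1 - 1 / real t + \<delta>
       \<longrightarrow> \<epsilon> \<ge> c * \<delta>\<^sup>2)"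
proof (intro exI[of _ "1 / 12"] conjI allI)
  fix k :: nat and qs :: "nat list" and Enc Dec and \<epsilon> \<delta> :: real
  show "let t = length qs; n = sum_list qs in
       quantum_code k qs Enc Dec \<and>
       non_malleable_LO k qs Enc Dec \<epsilon> \<and>
       (\<forall>\<psi>. density (2 ^ k) \<psi> \<longrightarrow> separable (map (\<lambda>q. 2 ^ q) qs) (Enc \<psi>)) \<and>
       \<delta> \<ge> 4 * log 2 (real n) / real n \<and>
       real k / real n \<ge> 1 - 1 / real t + \<delta>
       \<longrightarrow> \<epsilon> \<ge> 1 / 12 * \<delta>\<^sup>2"
    unfolding Let_def
  proof (intro impI, elim conjE)
    let ?n = "sum_list qs" and ?t = "length qs"
    assume code: "quantum_code k qs Enc Dec" and nm: "non_malleable_LO k qs Enc Dec \<epsilon>"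
      and sep: "\<forall>\<psi>. density (2 ^ k) \<psi> \<longrightarrow> separable (map (\<lambda>q. 2 ^ q) qs) (Enc \<psi>)"
      and d: "4 * log 2 (real ?n) / real ?n \<le> \<delta>" and rate: "1 - 1 / real ?t + \<delta> \<le> real k / real ?n"
    have d0: "0 \<le> \<delta>"
    proof (cases "?n = 0")
      \<comment> \<open>Division by zero gives 0, so the hypothesis reads 0 \<le> \<delta>.\<close>
      case True
      then show ?thesis using d by (simp only: of_nat_0 div_by_0)
    next
      case False
      then have "1 \<le> real ?n" by linarith
      then have "0 \<le> log 2 (real ?n)" by simp
      then have "0 \<le> 4 * log 2 (real ?n) / real ?n" by (intro divide_nonneg_nonneg mult_nonneg_nonneg) simp_all
      then show ?thesis using d by linarith
    qed
    \<comment> \<open>For the empty list both quotients are 0 and the rate condition becomes 1 +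
      \<delta> \<le> 0.\<close>
    have "qs \<noteq> []" using rate d0 by auto
    then obtain a where a: "a \<in> set qs" and large: "real ?n / real ?t \<le> real a"
      using exists_large_share by blast
    from a obtain pre post where qs: "qs = pre @ a # post" by (meson split_list)
    define b where "b = sum_list pre + sum_list post"
    have n: "?n = a + b" by (simp add: qs b_def)
    note bounds = share_bounds[OF code nm sep[rule_format] qs, folded b_def]
    have t1: "1 / real ?t \<le> 1" using \<open>qs \<noteq> []\<close> by (simp add: Suc_le_eq)
    have "real k / real ?n \<le> 1" 
    proof (cases "?n = 0")
      case False
      then have "0 < real ?n" by linarith
      then show ?thesis using bounds(1) by (simp only: divide_le_eq_1_pos of_nat_le_iff)
    qed (simp only: of_nat_0 div_by_0 zero_le_one)
    then have d1: "\<delta> \<le> 1" using rate t1 by linarith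
    then have dd: "1 / 12 * \<delta>\<^sup>2 \<le> 1 / 12" using d0 by (simp add: power_le_one)
    show "1 / 12 * \<delta>\<^sup>2 \<le> \<epsilon>"
    proof (cases "\<delta> = 0")
      case True
      then show ?thesis using bounds(2) by simp
    next
      case False
      then have dpos: "0 < \<delta>" using d0 by simp
      have n0: "0 < ?n"
      proof (rule ccontr)
        assume "\<not> 0 < ?n"
        then have "?n = 0" by simp
        then have "1 - 1 / real ?t + \<delta> \<le> 0" using rate by (simp only: of_nat_0 div_by_0)
        then show False using t1 dpos by linarith
      qed
      have "(1 - 1 / real ?t + \<delta>) * real ?n \<le> real k"
        using rate n0 by (simp add: pos_le_divide_eq)
      \<comment> \<open>The chosen share has at least n/t qubits, so n - n/t is at least
        \<open>b\<close>.\<close>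
      then have k: "real b + \<delta> * real ?n \<le> real k"
        using large n by (simp add: algebra_simps)
      have dn: "4 * log 2 (real ?n) \<le> \<delta> * real ?n"
        using d n0 by (simp add: pos_divide_le_eq)
      consider "?n = 1" | "?n = 2" | "3 \<le> ?n" using n0 by linarith
      then show ?thesis
      proof cases
        case 1
        have "0 < real ?n / real ?t" using n0 \<open>qs \<noteq> []\<close> by simp
        then have "0 < a" using large by linarith
        then have "b = 0" using 1 n by linarith
        moreover have "0 < \<delta> * real ?n" using dpos n0 by simp
        then have "0 < k" using k by linarith
        ultimately show ?thesis using bounds(4) dd by linarith
      next
        \<comment> \<open>Here the logarithm is 1 and the hypothesis would give \<delta> \<ge>
          2.\<close>
        case 2
        then show ?thesis using dn d1 by simp
      next
        case 3
        \<comment> \<open>This is where 81 = 3^4 comes from: \<open>4 * log 2 n\<close> extra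
          message qubits supply the factor n^4.\<close>
        have "81 * 2 powr real b \<le> (real ?n) ^ 4 * 2 powr real b"
          using power_mono[of 3 "real ?n" 4] 3 by (intro mult_right_mono) auto
        also have "(real ?n) ^ 4 = 2 powr (4 * log 2 (real ?n))"
        proof -
          have "2 powr (4 * log 2 (real ?n)) = (2 powr log 2 (real ?n)) powr 4"
            by (simp add: powr_powr mult.commute)
          also have "\<dots> = (real ?n) ^ 4" using n0 by (simp add: powr_numeral)
          finally show ?thesis by simp
        qed
        also have "2 powr (4 * log 2 (real ?n)) * 2 powr real b \<le> 2 powr real k"
          unfolding powr_add[symmetric] using dn k by (intro powr_mono) auto
        finally have "real (81 * 2 ^ b) \<le> real (2 ^ k)" by (simp add: powr_realpow)
        then have "81 * 2 ^ b \<le> (2 ^ k :: nat)" by (simp only: of_nat_le_iff)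
        then show ?thesis using bounds(3) dd by linarith
      qed
    qed
  qed
qed simp

end
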